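(* The \textsc{Spanner} problem (given a connected undirected graph $G=(V,E)$ with edge weights $w\colon E\to\mathbb{N}_{\ge0}$, edge lengths $\ell\colon E\to\mathbb{N}_{\ge1}$, a stretch factor $\alpha\ge1$ and a weight bound $W\in\mathbb{N}$, is there an $\alpha$-spanner $H=(V,F)$ of $G$ with $\sum_{e\in F}w(e)\le W$?) parameterized by $W$ is $\mathbf{W[2]}$-hard, even when restricted to unit-length instances ($\ell(e)=1$ for all $e\in E$) on bipartite graphs with constant $\alpha$ and only three distinct edge weights.
   Context: For a subgraph $G'\subseteq G$ and $u,v\in V$, $\ell_{G'}[u,v]$ is the length of a shortest $u$-$v$-path in $G'$ w.r.t. $\ell$. A subgraph $H=(V,F)$, $F\subseteq E$, is an $\alpha$-spanner of $G$ if $\ell_H[u,v]\le\alpha\,\ell_G[u,v]$ for all $u,v\in V$; equivalently, for all $\{u,v\}\in E$. $\mathbf{W[2]}$-hardness is meant w.r.t. parameterized (FPT) reductions. "Three distinct weights" means that in each instance $w$ attains only three distinct values (the values may depend on the instance). *)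

theory Defs
  imports Complex_Main "HOL-Library.Extended_Real"
begin

section \<open>Model of computation\<close>

text \<open>
  Programs are those of Jones's language WHILE over binary trees. A tree with \<open>m\<close> inner and
  leaf nodes is, read in preorder, just a binary word of length \<open>m\<close>, so sets of trees play the
  role of languages.
\<close>

datatype tree = Leaf | Node tree tree

fun tsize :: "tree \<Rightarrow> nat" where
  "tsize Leaf = 1"
| "tsize (Node a b) = 1 + tsize a + tsize b"

type_synonym state = "nat \<Rightarrow> tree"

datatype exp = Var nat | ENil | ECons exp exp | Hd exp | Tl exp

fun eval :: "exp \<Rightarrow> state \<Rightarrow> tree" where
  "eval (Var i) s = s i"
| "eval ENil s = Leaf"
| "eval (ECons e f) s = Node (eval e s) (eval f s)"
| "eval (Hd e) s = (case eval e s of Leaf \<Rightarrow> Leaf | Node a b \<Rightarrow> a)"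
| "eval (Tl e) s = (case eval e s of Leaf \<Rightarrow> Leaf | Node a b \<Rightarrow> b)"

datatype com =
    Skip
  | Assign nat exp
  | Seq com com
  | Cond exp com com
  | While exp com

text \<open>
  \<open>exec c s t s'\<close>: started in \<open>s\<close>, the program \<open>c\<close> stops in \<open>s'\<close> after time \<open>t\<close>. An assignment is
  charged the size of the tree it stores. Hence a run of time \<open>t\<close> on an input of size \<open>m\<close> only
  stores trees of size at most \<open>t + m\<close>, and this time measure agrees with that of
  deterministic Turing machines up to a polynomial. (With unit cost, iterating
  \<open>X := ECons X X\<close> would build trees of exponential size.)
\<close>

inductive exec :: "com \<Rightarrow> state \<Rightarrow> nat \<Rightarrow> state \<Rightarrow> bool" where
  Skip: "exec Skip s 1 s"
| Assign: "exec (Assign i e) s (1 + tsize (eval e s)) (s(i := eval e s))"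
| Seq: "exec c s t s' \<Longrightarrow> exec d s' t' s'' \<Longrightarrow> exec (Seq c d) s (t + t') s''"
| IfTrue: "eval e s \<noteq> Leaf \<Longrightarrow> exec c s t s' \<Longrightarrow> exec (Cond e c d) s (1 + t) s'"
| IfFalse: "eval e s = Leaf \<Longrightarrow> exec d s t s' \<Longrightarrow> exec (Cond e c d) s (1 + t) s'"
| WhileFalse: "eval e s = Leaf \<Longrightarrow> exec (While e c) s 1 s"
| WhileTrue: "eval e s \<noteq> Leaf \<Longrightarrow> exec c s t s' \<Longrightarrow> exec (While e c) s' t' s'' \<Longrightarrow>
    exec (While e c) s (1 + t + t') s''"

text \<open>Input and output are in variable 0; all other variables initially hold \<open>Leaf\<close>.\<close>

definition computes_in :: "com \<Rightarrow> tree \<Rightarrow> tree \<Rightarrow> nat \<Rightarrow> bool" where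
  "computes_in c x y t \<longleftrightarrow> (\<exists>s. exec c ((\<lambda>_. Leaf)(0 := x)) t s \<and> s 0 = y)"


section \<open>Encodings\<close>

fun enc_unary :: "nat \<Rightarrow> tree" where
  "enc_unary 0 = Leaf"
| "enc_unary (Suc n) = Node Leaf (enc_unary n)"

fun enc_list :: "('a \<Rightarrow> tree) \<Rightarrow> 'a list \<Rightarrow> tree" where
  "enc_list f [] = Leaf"
| "enc_list f (x # xs) = Node (f x) (enc_list f xs)"

definition enc_bool :: "bool \<Rightarrow> tree" where
  "enc_bool b = (if b then Node Leaf Leaf else Leaf)"

text \<open>Binary, least significant bit first.\<close>

fun enc_nat :: "nat \<Rightarrow> tree" where
  "enc_nat n = (if n = 0 then Leaf else Node (enc_bool (odd n)) (enc_nat (n div 2)))"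

declare enc_nat.simps [simp del]

text \<open>Only used for nonnegative rationals.\<close>

definition enc_rat :: "rat \<Rightarrow> tree" where
  "enc_rat a = Node (enc_nat (nat (fst (quotient_of a)))) (enc_nat (nat (snd (quotient_of a))))"


section \<open>Parameterized problems and reductions\<close>

text \<open>A parameterized problem is a set of pairs of an instance and its parameter.\<close>

type_synonym param_problem = "(tree \<times> nat) set"

definition enc_param_instance :: "tree \<times> nat \<Rightarrow> tree" where
  "enc_param_instance = (\<lambda>(x, k). Node x (enc_unary k))"

definition computable :: "(nat \<Rightarrow> nat) \<Rightarrow> bool" where
  "computable g \<longleftrightarrow> (\<exists>c. \<forall>n. \<exists>t. computes_in c (enc_unary n) (enc_unary (g n)) t)"

text \<open>
  \<open>fpt_reduces_into C P Q\<close>: there is an FPT reduction from \<open>P\<close> to \<open>Q\<close> all of whose values lie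
  in the class \<open>C\<close> of instances, i.e. one from \<open>P\<close> to \<open>Q\<close> restricted to \<open>C\<close>.
\<close>

definition fpt_reduces_into ::
    "(tree \<times> nat) set \<Rightarrow> param_problem \<Rightarrow> param_problem \<Rightarrow> bool" where
  "fpt_reduces_into C P Q \<longleftrightarrow>
     (\<exists>(f :: tree \<times> nat \<Rightarrow> tree \<times> nat) c g h (d :: nat).
        computable g \<and> computable h \<and>
        (\<forall>x k.
           (\<exists>t \<le> g k * tsize x ^ d.
              computes_in c (enc_param_instance (x, k)) (enc_param_instance (f (x, k))) t) \<and>
           ((x, k) \<in> P \<longleftrightarrow> f (x, k) \<in> Q) \<and>
           snd (f (x, k)) \<le> h k \<and>
           f (x, k) \<in> C))"

definition fpt_reduces :: "param_problem \<Rightarrow> param_problem \<Rightarrow> bool" where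
  "fpt_reduces P Q \<longleftrightarrow> fpt_reduces_into UNIV P Q"


section \<open>The W-hierarchy\<close>

text \<open>
  We follow Flum and Grohe (Parameterized Complexity Theory, 2006), who define W[t] as the
  closure under FPT reductions of the weighted Fagin definability problems for
  first-order \<open>\<Pi>\<^sub>t\<close>-formulas with a free relation variable.
\<close>

text \<open>\<open>Rel r\<close> is the \<open>r\<close>-th symbol of the vocabulary; \<open>XRel\<close> is the free relation variable \<open>X\<close>.\<close>

datatype fm =
    Eq nat nat
  | Rel nat "nat list"
  | XRel "nat list"
  | Neg fm
  | Conj fm fm
  | Disj fm fm
  | Ex nat fm
  | All nat fm

text \<open>A vocabulary is the list \<open>\<tau>\<close> of the arities of its symbols; \<open>s\<close> is the arity of \<open>X\<close>.\<close>

fun wf_fm :: "nat list \<Rightarrow> nat \<Rightarrow> fm \<Rightarrow> bool" where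
  "wf_fm \<tau> s (Eq x y) \<longleftrightarrow> True"
| "wf_fm \<tau> s (Rel r xs) \<longleftrightarrow> r < length \<tau> \<and> length xs = \<tau> ! r"
| "wf_fm \<tau> s (XRel xs) \<longleftrightarrow> length xs = s"
| "wf_fm \<tau> s (Neg \<phi>) \<longleftrightarrow> wf_fm \<tau> s \<phi>"
| "wf_fm \<tau> s (Conj \<phi> \<psi>) \<longleftrightarrow> wf_fm \<tau> s \<phi> \<and> wf_fm \<tau> s \<psi>"
| "wf_fm \<tau> s (Disj \<phi> \<psi>) \<longleftrightarrow> wf_fm \<tau> s \<phi> \<and> wf_fm \<tau> s \<psi>"
| "wf_fm \<tau> s (Ex x \<phi>) \<longleftrightarrow> wf_fm \<tau> s \<phi>"
| "wf_fm \<tau> s (All x \<phi>) \<longleftrightarrow> wf_fm \<tau> s \<phi>"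

fun free_vars :: "fm \<Rightarrow> nat set" where
  "free_vars (Eq x y) = {x, y}"
| "free_vars (Rel r xs) = set xs"
| "free_vars (XRel xs) = set xs"
| "free_vars (Neg \<phi>) = free_vars \<phi>"
| "free_vars (Conj \<phi> \<psi>) = free_vars \<phi> \<union> free_vars \<psi>"
| "free_vars (Disj \<phi> \<psi>) = free_vars \<phi> \<union> free_vars \<psi>"
| "free_vars (Ex x \<phi>) = free_vars \<phi> - {x}"
| "free_vars (All x \<phi>) = free_vars \<phi> - {x}"

fun quantifier_free :: "fm \<Rightarrow> bool" where
  "quantifier_free (Neg \<phi>) \<longleftrightarrow> quantifier_free \<phi>"
| "quantifier_free (Conj \<phi> \<psi>) \<longleftrightarrow> quantifier_free \<phi> \<and> quantifier_free \<psi>"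
| "quantifier_free (Disj \<phi> \<psi>) \<longleftrightarrow> quantifier_free \<phi> \<and> quantifier_free \<psi>"
| "quantifier_free (Ex x \<phi>) \<longleftrightarrow> False"
| "quantifier_free (All x \<phi>) \<longleftrightarrow> False"
| "quantifier_free _ \<longleftrightarrow> True"

inductive Sigma_fm :: "nat \<Rightarrow> fm \<Rightarrow> bool" and Pi_fm :: "nat \<Rightarrow> fm \<Rightarrow> bool" where
  "quantifier_free \<phi> \<Longrightarrow> Sigma_fm 0 \<phi>"
| "quantifier_free \<phi> \<Longrightarrow> Pi_fm 0 \<phi>"
| "Pi_fm t \<phi> \<Longrightarrow> Sigma_fm (Suc t) \<phi>"
| "Sigma_fm (Suc t) \<phi> \<Longrightarrow> Sigma_fm (Suc t) (Ex x \<phi>)"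
| "Sigma_fm t \<phi> \<Longrightarrow> Pi_fm (Suc t) \<phi>"
| "Pi_fm (Suc t) \<phi> \<Longrightarrow> Pi_fm (Suc t) (All x \<phi>)"

text \<open>
  Satisfaction in the structure with universe \<open>{..<n}\<close> and relations \<open>R\<close>, where \<open>X\<close> is
  interpreted by \<open>S\<close> and the individual variables by \<open>v\<close>.
\<close>

fun sat :: "nat \<Rightarrow> (nat \<Rightarrow> nat list set) \<Rightarrow> nat list set \<Rightarrow> (nat \<Rightarrow> nat) \<Rightarrow> fm \<Rightarrow> bool" where
  "sat n R S v (Eq x y) \<longleftrightarrow> v x = v y"
| "sat n R S v (Rel r xs) \<longleftrightarrow> map v xs \<in> R r"
| "sat n R S v (XRel xs) \<longleftrightarrow> map v xs \<in> S"
| "sat n R S v (Neg \<phi>) \<longleftrightarrow> \<not> sat n R S v \<phi>"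
| "sat n R S v (Conj \<phi> \<psi>) \<longleftrightarrow> sat n R S v \<phi> \<and> sat n R S v \<psi>"
| "sat n R S v (Disj \<phi> \<psi>) \<longleftrightarrow> sat n R S v \<phi> \<or> sat n R S v \<psi>"
| "sat n R S v (Ex x \<phi>) \<longleftrightarrow> (\<exists>a<n. sat n R S (v(x := a)) \<phi>)"
| "sat n R S v (All x \<phi>) \<longleftrightarrow> (\<forall>a<n. sat n R S (v(x := a)) \<phi>)"

definition tuples :: "nat \<Rightarrow> nat \<Rightarrow> nat list set" where
  "tuples n s = {xs. length xs = s \<and> set xs \<subseteq> {..<n}}"

text \<open>A finite structure is given by the size of its universe and, per symbol, a list of tuples.\<close>

type_synonym fin_struct = "nat \<times> nat list list list"

definition wf_struct :: "nat list \<Rightarrow> fin_struct \<Rightarrow> bool" where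
  "wf_struct \<tau> = (\<lambda>(n, Rs). n \<ge> 1 \<and> length Rs = length \<tau> \<and>
     (\<forall>r < length \<tau>. set (Rs ! r) \<subseteq> tuples n (\<tau> ! r)))"

text \<open>The size of the universe is in unary, since it counts towards the size of a structure.\<close>

definition enc_struct :: "fin_struct \<Rightarrow> tree" where
  "enc_struct = (\<lambda>(n, Rs). Node (enc_unary n) (enc_list (enc_list (enc_list enc_nat)) Rs))"

text \<open>
  Given a structure and \<open>k\<close>, is there a solution for \<open>\<phi>(X)\<close> with exactly \<open>k\<close> elements? The initial
  valuation is irrelevant, as \<open>\<phi>\<close> will have no free individual variables.
\<close>

definition p_WD :: "nat list \<Rightarrow> nat \<Rightarrow> fm \<Rightarrow> param_problem" where
  "p_WD \<tau> s \<phi> = {(enc_struct (n, Rs), k) | n Rs k.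
     wf_struct \<tau> (n, Rs) \<and>
     (\<exists>S \<subseteq> tuples n s. card S = k \<and> sat n (\<lambda>r. set (Rs ! r)) S (\<lambda>_. 0) \<phi>)}"

definition W_class :: "nat \<Rightarrow> param_problem set" where
  "W_class t = {P. \<exists>\<tau> s \<phi>. (\<forall>r \<in> set \<tau>. r \<ge> 1) \<and> s \<ge> 1 \<and> wf_fm \<tau> s \<phi> \<and> free_vars \<phi> = {} \<and>
     Pi_fm t \<phi> \<and> fpt_reduces P (p_WD \<tau> s \<phi>)}"

definition W_hard_on :: "nat \<Rightarrow> param_problem \<Rightarrow> (tree \<times> nat) set \<Rightarrow> bool" where
  "W_hard_on t Q C \<longleftrightarrow> (\<forall>P \<in> W_class t. fpt_reduces_into C P Q)"

abbreviation W_hard :: "nat \<Rightarrow> param_problem \<Rightarrow> bool" where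
  "W_hard t Q \<equiv> W_hard_on t Q UNIV"


section \<open>Graphs and spanners\<close>

definition simple_graph :: "'v set \<Rightarrow> 'v set set \<Rightarrow> bool" where
  "simple_graph V E \<longleftrightarrow> finite V \<and> V \<noteq> {} \<and> E \<subseteq> {{u, v} | u v. u \<in> V \<and> v \<in> V \<and> u \<noteq> v}"

definition graph_path :: "'v set set \<Rightarrow> 'v \<Rightarrow> 'v list \<Rightarrow> 'v \<Rightarrow> bool" where
  "graph_path E u p v \<longleftrightarrow>
     p \<noteq> [] \<and> hd p = u \<and> last p = v \<and> distinct p \<and> successively (\<lambda>a b. {a, b} \<in> E) p"

definition path_length :: "('v set \<Rightarrow> nat) \<Rightarrow> 'v list \<Rightarrow> nat" where
  "path_length l p = (\<Sum>(a, b) \<leftarrow> zip p (tl p). l {a, b})"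

text \<open>This is \<open>\<infinity>\<close> if there is no path.\<close>

definition graph_dist :: "'v set set \<Rightarrow> ('v set \<Rightarrow> nat) \<Rightarrow> 'v \<Rightarrow> 'v \<Rightarrow> ereal" where
  "graph_dist E l u v = (INF p \<in> {p. graph_path E u p v}. ereal (real (path_length l p)))"

definition connected_graph :: "'v set \<Rightarrow> 'v set set \<Rightarrow> bool" where
  "connected_graph V E \<longleftrightarrow> (\<forall>u \<in> V. \<forall>v \<in> V. \<exists>p. graph_path E u p v)"

definition bipartite_graph :: "'v set \<Rightarrow> 'v set set \<Rightarrow> bool" where
  "bipartite_graph V E \<longleftrightarrow>
     (\<exists>A B. A \<union> B = V \<and> A \<inter> B = {} \<and> (\<forall>e \<in> E. \<exists>a \<in> A. \<exists>b \<in> B. e = {a, b}))"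

definition is_spanner ::
    "'v set \<Rightarrow> 'v set set \<Rightarrow> ('v set \<Rightarrow> nat) \<Rightarrow> rat \<Rightarrow> 'v set set \<Rightarrow> bool" where
  "is_spanner V E l \<alpha> F \<longleftrightarrow> F \<subseteq> E \<and>
     (\<forall>u \<in> V. \<forall>v \<in> V. graph_dist F l u v \<le> ereal (of_rat \<alpha>) * graph_dist E l u v)"

definition spanner_instance ::
    "'v set \<Rightarrow> 'v set set \<Rightarrow> ('v set \<Rightarrow> nat) \<Rightarrow> ('v set \<Rightarrow> nat) \<Rightarrow> rat \<Rightarrow> bool" where
  "spanner_instance V E w l \<alpha> \<longleftrightarrow>
     simple_graph V E \<and> connected_graph V E \<and> (\<forall>e \<in> E. l e \<ge> 1) \<and> \<alpha> \<ge> 1"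

text \<open>
  \<open>x\<close> encodes the instance on the vertex set \<open>{..<n}\<close> with the given edges, weights \<open>w\<close>
  and lengths \<open>l\<close> (both in binary) and stretch factor \<open>\<alpha>\<close>; the entry \<open>(u, v, a, b)\<close> stands for
  the edge \<open>{u, v}\<close> of weight \<open>a\<close> and length \<open>b\<close>. The weight bound is the parameter and hence not
  part of \<open>x\<close>. The values of \<open>w\<close> and \<open>l\<close> outside \<open>E\<close> are irrelevant.
\<close>

definition enc_edge :: "nat \<times> nat \<times> nat \<times> nat \<Rightarrow> tree" where
  "enc_edge = (\<lambda>(u, v, a, b). enc_list enc_nat [u, v, a, b])"

definition encodes_spanner_instance ::
    "tree \<Rightarrow> nat set \<Rightarrow> nat set set \<Rightarrow> (nat set \<Rightarrow> nat) \<Rightarrow> (nat set \<Rightarrow> nat) \<Rightarrow> rat \<Rightarrow> bool" where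
  "encodes_spanner_instance x V E w l \<alpha> \<longleftrightarrow>
     (\<exists>n es. x = Node (enc_unary n) (Node (enc_list enc_edge es) (enc_rat \<alpha>)) \<and>
        V = {..<n} \<and> E = {{u, v} | u v a b. (u, v, a, b) \<in> set es} \<and>
        (\<forall>(u, v, a, b) \<in> set es. w {u, v} = a \<and> l {u, v} = b))"

definition Spanner :: param_problem where
  "Spanner = {(x, B). \<exists>V E w l \<alpha>.
     encodes_spanner_instance x V E w l \<alpha> \<and> spanner_instance V E w l \<alpha> \<and>
     (\<exists>F. is_spanner V E l \<alpha> F \<and> (\<Sum>e \<in> F. w e) \<le> B)}"

definition bipartite_unit_length_three_weights :: "rat \<Rightarrow> (tree \<times> nat) set" where
  "bipartite_unit_length_three_weights \<alpha> = {(x, B). \<exists>V E w l.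
     encodes_spanner_instance x V E w l \<alpha> \<and> spanner_instance V E w l \<alpha> \<and>
     (\<forall>e \<in> E. l e = 1) \<and> bipartite_graph V E \<and> card (w ` E) \<le> 3}"

end

theory Submission
  imports Defs
begin

text \<open>
  Let \<open>\<phi>\<close> be a \<open>\<Pi>\<^sub>2\<close>-formula; we look for a \<open>k\<close>-element set \<open>S\<close> of \<open>s\<close>-tuples with \<open>\<phi>(S)\<close>.
  List all \<open>s\<close>-tuples, and describe \<open>S\<close> by the increasing sequence \<open>f\<close> of the positions of its
  elements, framed by sentinels \<open>f 0\<close> and \<open>f (k + 1)\<close>. A tuple lies in \<open>S\<close> iff its position is some
  \<open>f j\<close> with \<open>1 \<le> j \<le> k\<close>, and outside \<open>S\<close> iff it lies strictly between some \<open>f j\<close> and \<open>f (j + 1)\<close>;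
  so the truth values of the \<open>d\<close> atoms \<open>X(...)\<close> of the matrix of \<open>\<phi>\<close> at a given valuation are
  certified by at most \<open>2 d\<close> values of \<open>f\<close>. Take as elements of a hitting set instance the guesses
  \<open>(j, f j)\<close> for \<open>m = 2 d + 1\<close> arguments at once. A hitting set of size \<open>(k + 2)\<^sup>m\<close> must contain exactly
  one guess for each of the \<open>(k + 2)\<^sup>m\<close> tuples of arguments (its slot). Further sets to be hit enforce that
  the guesses agree with one increasing \<open>f\<close>, and that for each valuation of the universally
  quantified variables some guess certifies the \<open>\<Sigma>\<^sub>1\<close>-part.

  Hitting set reduces to spanners of stretch 3: vertices \<open>p, a, x, y\<close>, the elements \<open>e\<close> and the sets
  \<open>c\<close>; edges \<open>pa\<close>, \<open>ax\<close>, \<open>xy\<close>, \<open>ye\<close> and \<open>ec\<close> (if \<open>e\<close> hits \<open>c\<close>) of weight 0, \<open>ae\<close> of weight 1, and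
  \<open>pc\<close> of a weight exceeding the budget. An edge \<open>ae\<close> may be dropped because of the path \<open>a x y e\<close>,
  whereas \<open>pc\<close> has to be replaced by a path \<open>p a e c\<close>.

  Polynomial running time is shown for functions on trees, closed under composition, pairing, case
  distinction and iterations that meet only trees of polynomial size; lists are encoded so that
  every tree is a list of trees.
\<close>

section \<open>Polynomial time on trees\<close>

text \<open>The base \<open>m + 2\<close> is at least 2 even for \<open>m = 0\<close>, so constants
  and sums are absorbed by a larger exponent.\<close>

definition pbound :: "(nat \<Rightarrow> nat) \<Rightarrow> bool" where
  "pbound T \<longleftrightarrow> (\<exists>d. \<forall>m. T m \<le> (m + 2) ^ d)"

named_theorems pbound_intros

lemma pbound_const [pbound_intros]: "pbound (\<lambda>_. c)"
proof -
  have "c \<le> (m + 2) ^ c" for m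
    by (rule order_trans[OF less_imp_le[OF less_exp] power_mono]) auto
  then show ?thesis unfolding pbound_def by blast
qed

lemma pbound_id [pbound_intros]: "pbound (\<lambda>m. m)"
  unfolding pbound_def by (rule exI[of _ 1]) simp

lemma pbound_add [pbound_intros]:
  assumes "pbound S" "pbound T"
  shows "pbound (\<lambda>m. S m + T m)"
proof -
  obtain d e where d: "\<And>m. S m \<le> (m + 2) ^ d" and e: "\<And>m. T m \<le> (m + 2) ^ e"
    using assms unfolding pbound_def by blast
  have "S m + T m \<le> (m + 2) ^ Suc (d + e)" for m
  proof -
    have "S m \<le> (m + 2) ^ (d + e)" "T m \<le> (m + 2) ^ (d + e)"
      by (rule order_trans[OF d] order_trans[OF e], rule power_increasing; simp)+
    then have "S m + T m \<le> 2 * (m + 2) ^ (d + e)" by simp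
    also have "\<dots> \<le> (m + 2) * (m + 2) ^ (d + e)" by (rule mult_le_mono) auto
    finally show ?thesis by simp
  qed
  then show ?thesis unfolding pbound_def by blast
qed

lemma pbound_mult [pbound_intros]:
  assumes "pbound S" "pbound T"
  shows "pbound (\<lambda>m. S m * T m)"
proof -
  obtain d e where "\<And>m. S m \<le> (m + 2) ^ d" and "\<And>m. T m \<le> (m + 2) ^ e"
    using assms unfolding pbound_def by blast
  then have "S m * T m \<le> (m + 2) ^ (d + e)" for m
    unfolding power_add by (intro mult_le_mono)
  then show ?thesis unfolding pbound_def by blast
qed

lemma pbound_power [pbound_intros]:
  assumes "pbound S"
  shows "pbound (\<lambda>m. S m ^ d)"
  using assms by (induction d) (auto intro: pbound_intros)

text \<open>A stored tree has been charged its size. Running times therefore bound the sizes of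
  results, except for variables that still hold their initial value.\<close>

lemma exec_size: "exec c s t s' \<Longrightarrow> s' i = s i \<or> tsize (s' i) \<le> t"
  by (induction rule: exec.induct) auto

text \<open>The program can be placed at any base \<open>b\<close>: it works from arbitrary contents
  of the variables above \<open>b\<close> and preserves those below, where a caller may keep values.
  So programs can be nested without clearing variables in between.\<close>

definition ptime :: "(tree \<Rightarrow> tree) \<Rightarrow> bool" where
  "ptime F \<longleftrightarrow> (\<forall>b. \<exists>C T. pbound T \<and> (\<forall>s. \<exists>s' t. exec C s t s' \<and> s' b = F (s b) \<and>
     (\<forall>i < b. s' i = s i) \<and> t \<le> T (tsize (s b))))"

lemma ptimeI:
  assumes "pbound T"
    and "\<And>b s. \<exists>s' t. exec (C b) s t s' \<and> s' b = F (s b) \<and> (\<forall>i < b. s' i = s i) \<and> t \<le> T (tsize (s b))"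
  shows "ptime F"
  unfolding ptime_def using assms by meson

lemma ptimeE:
  assumes "ptime F"
  obtains C d where "\<And>s. \<exists>s' t. exec C s t s' \<and> s' b = F (s b) \<and> (\<forall>i < b. s' i = s i) \<and>
    t \<le> (tsize (s b) + 2) ^ d"
proof -
  from assms obtain C T where "pbound T" and C: "\<And>s. \<exists>s' t. exec C s t s' \<and> s' b = F (s b) \<and>
     (\<forall>i < b. s' i = s i) \<and> t \<le> T (tsize (s b))" unfolding ptime_def by blast
  moreover obtain d where "\<And>m. T m \<le> (m + 2) ^ d" using \<open>pbound T\<close> unfolding pbound_def by blast
  ultimately show ?thesis using that[of C d] by (meson order_trans)
qed

lemma ptime_size:
  assumes "ptime F"
  obtains d where "\<And>x. tsize (F x) \<le> (tsize x + 2) ^ d"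
proof -
  obtain C d where C: "\<And>s. \<exists>s' t. exec C s t s' \<and> s' 0 = F (s 0) \<and> (\<forall>i < 0. s' i = s i) \<and>
    t \<le> (tsize (s 0) + 2) ^ d" using ptimeE[OF assms, where b = 0] by blast
  have "tsize (F x) \<le> tsize x + (tsize x + 2) ^ d" for x
    using C[of "\<lambda>_. x"] by (auto dest: exec_size[where i = 0])
  moreover have "pbound (\<lambda>m. m + (m + 2) ^ d)" by (intro pbound_intros)
  then obtain e where "\<And>m::nat. m + (m + 2) ^ d \<le> (m + 2) ^ e" unfolding pbound_def by blast
  ultimately show ?thesis using that order_trans by blast
qed

section \<open>Closure of polynomial time under the basic program constructions\<close>

named_theorems ptime_intros

lemma ptime_id [ptime_intros]: "ptime (\<lambda>x. x)"
proof (rule ptimeI[where T = "\<lambda>_. 1" and C = "\<lambda>_. Skip"])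
  show "\<exists>s' t. exec Skip s t s' \<and> s' b = s b \<and> (\<forall>i < b. s' i = s i) \<and> t \<le> 1" for b s
    by (intro exI conjI, rule exec.Skip) auto
qed (intro pbound_intros)

lemma ptime_assign:
  assumes e: "\<And>s b. eval (e b) s = F (s b)" and T: "pbound T" "\<And>x. tsize (F x) \<le> T (tsize x)"
  shows "ptime F"
proof (rule ptimeI[where T = "\<lambda>m. 1 + T m" and C = "\<lambda>b. Assign b (e b)"])
  show "\<exists>s' t. exec (Assign b (e b)) s t s' \<and> s' b = F (s b) \<and> (\<forall>i < b. s' i = s i) \<and>
    t \<le> 1 + T (tsize (s b))" for b s
    by (intro exI conjI, rule exec.Assign) (auto simp: e T(2))
qed (intro pbound_intros T)

fun const_exp :: "tree \<Rightarrow> exp" where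
  "const_exp Leaf = ENil"
| "const_exp (Node a b) = ECons (const_exp a) (const_exp b)"

lemma eval_const_exp [simp]: "eval (const_exp a) s = a"
  by (induction a) auto

lemma ptime_const [ptime_intros]: "ptime (\<lambda>_. a)"
  by (rule ptime_assign[where e = "\<lambda>_. const_exp a", OF _ pbound_const]) auto

fun thd :: "tree \<Rightarrow> tree" where
  "thd Leaf = Leaf"
| "thd (Node a b) = a"

fun ttl :: "tree \<Rightarrow> tree" where
  "ttl Leaf = Leaf"
| "ttl (Node a b) = b"

lemma ptime_thd_prim: "ptime thd"
proof (rule ptime_assign[where e = "\<lambda>b. Hd (Var b)", OF _ pbound_id])
  show "eval (Hd (Var b)) s = thd (s b)" for s b by (cases "s b") auto
  show "tsize (thd x) \<le> tsize x" for x by (cases x) auto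
qed

lemma ptime_ttl_prim: "ptime ttl"
proof (rule ptime_assign[where e = "\<lambda>b. Tl (Var b)", OF _ pbound_id])
  show "eval (Tl (Var b)) s = ttl (s b)" for s b by (cases "s b") auto
  show "tsize (ttl x) \<le> tsize x" for x by (cases x) auto
qed

text \<open>The second program is timed in the size of the intermediate result, which
  \<open>ptime_size\<close> bounds polynomially in the input.\<close>

lemma ptime_comp:
  assumes G: "ptime G" and F: "ptime F"
  shows "ptime (\<lambda>x. G (F x))"
  unfolding ptime_def
proof
  fix b
  obtain e where e: "\<And>x. tsize (F x) \<le> (tsize x + 2) ^ e" using ptime_size[OF F] by blast
  obtain CF dF where CF: "\<And>s. \<exists>s' t. exec CF s t s' \<and> s' b = F (s b) \<and> (\<forall>i < b. s' i = s i) \<and>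
    t \<le> (tsize (s b) + 2) ^ dF" using ptimeE[OF F] by blast
  obtain CG dG where CG: "\<And>s. \<exists>s' t. exec CG s t s' \<and> s' b = G (s b) \<and> (\<forall>i < b. s' i = s i) \<and>
    t \<le> (tsize (s b) + 2) ^ dG" using ptimeE[OF G] by blast
  let ?T = "\<lambda>m. (m + 2) ^ dF + ((m + 2) ^ e + 2) ^ dG"
  have "\<exists>s' t. exec (Seq CF CG) s t s' \<and> s' b = G (F (s b)) \<and> (\<forall>i < b. s' i = s i) \<and>
    t \<le> ?T (tsize (s b))" for s
  proof -
    obtain s1 t1 where 1: "exec CF s t1 s1" "s1 b = F (s b)" "\<forall>i < b. s1 i = s i"
      "t1 \<le> (tsize (s b) + 2) ^ dF" using CF by blast
    obtain s2 t2 where 2: "exec CG s1 t2 s2" "s2 b = G (s1 b)" "\<forall>i < b. s2 i = s1 i"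
      "t2 \<le> (tsize (s1 b) + 2) ^ dG" using CG by blast
    have "(tsize (s1 b) + 2) ^ dG \<le> ((tsize (s b) + 2) ^ e + 2) ^ dG"
      using e[of "s b"] 1(2) by (intro power_mono) auto
    then show ?thesis
      using 1 2 by (intro exI[of _ s2] exI[of _ "t1 + t2"]) (auto intro: exec.Seq)
  qed
  moreover have "pbound ?T" by (intro pbound_intros)
  ultimately show "\<exists>C T. pbound T \<and> (\<forall>s. \<exists>s' t. exec C s t s' \<and> s' b = G (F (s b)) \<and>
     (\<forall>i < b. s' i = s i) \<and> t \<le> T (tsize (s b)))" by blast
qed

lemmas ptime_thd [ptime_intros] = ptime_comp[OF ptime_thd_prim]
lemmas ptime_ttl [ptime_intros] = ptime_comp[OF ptime_ttl_prim]

text \<open>The argument survives in variable \<open>b\<close> while \<open>F\<close> runs at base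
  \<open>b + 1\<close> on a copy; then \<open>G\<close> runs at base \<open>b + 2\<close> on a
  second copy and leaves the result of \<open>F\<close> alone.\<close>

lemma ptime_Node [ptime_intros]:
  assumes F: "ptime F" and G: "ptime G"
  shows "ptime (\<lambda>x. Node (F x) (G x))"
  unfolding ptime_def
proof
  fix b
  obtain e where e: "\<And>x. tsize (F x) \<le> (tsize x + 2) ^ e" using ptime_size[OF F] by blast
  obtain e' where e': "\<And>x. tsize (G x) \<le> (tsize x + 2) ^ e'" using ptime_size[OF G] by blast
  obtain CF dF where CF: "\<And>s. \<exists>s' t. exec CF s t s' \<and> s' (b + 1) = F (s (b + 1)) \<and>
    (\<forall>i < b + 1. s' i = s i) \<and> t \<le> (tsize (s (b + 1)) + 2) ^ dF" using ptimeE[OF F] by blast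
  obtain CG dG where CG: "\<And>s. \<exists>s' t. exec CG s t s' \<and> s' (b + 2) = G (s (b + 2)) \<and>
    (\<forall>i < b + 2. s' i = s i) \<and> t \<le> (tsize (s (b + 2)) + 2) ^ dG" using ptimeE[OF G] by blast
  define C where "C = Seq (Assign (b + 1) (Var b)) (Seq CF (Seq (Assign (b + 2) (Var b))
    (Seq CG (Assign b (ECons (Var (b + 1)) (Var (b + 2)))))))"
  let ?T = "\<lambda>m. (1 + m) + ((m + 2) ^ dF + ((1 + m) + ((m + 2) ^ dG +
    (2 + (m + 2) ^ e + (m + 2) ^ e'))))"
  have "\<exists>s' t. exec C s t s' \<and> s' b = Node (F (s b)) (G (s b)) \<and> (\<forall>i < b. s' i = s i) \<and>
    t \<le> ?T (tsize (s b))" for s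
  proof -
    define s1 where "s1 = s(b + 1 := s b)"
    have 1: "exec (Assign (b + 1) (Var b)) s (1 + tsize (s b)) s1"
      using exec.Assign[of "b + 1" "Var b" s] by (simp add: s1_def)
    obtain s2 t2 where 2: "exec CF s1 t2 s2" "s2 (b + 1) = F (s1 (b + 1))" "\<forall>i < b + 1. s2 i = s1 i"
      "t2 \<le> (tsize (s1 (b + 1)) + 2) ^ dF" using CF by blast
    define s3 where "s3 = s2(b + 2 := s2 b)"
    have 3: "exec (Assign (b + 2) (Var b)) s2 (1 + tsize (s2 b)) s3"
      using exec.Assign[of "b + 2" "Var b" s2] by (simp add: s3_def)
    obtain s4 t4 where 4: "exec CG s3 t4 s4" "s4 (b + 2) = G (s3 (b + 2))" "\<forall>i < b + 2. s4 i = s3 i"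
      "t4 \<le> (tsize (s3 (b + 2)) + 2) ^ dG" using CG by blast
    define s5 where "s5 = s4(b := Node (s4 (b + 1)) (s4 (b + 2)))"
    have 5: "exec (Assign b (ECons (Var (b + 1)) (Var (b + 2)))) s4
      (1 + tsize (Node (s4 (b + 1)) (s4 (b + 2)))) s5"
      using exec.Assign[of b "ECons (Var (b + 1)) (Var (b + 2))" s4] by (simp add: s5_def)
    have s2b: "s2 b = s b" using 2(3) by (simp add: s1_def)
    have F: "s4 (b + 1) = F (s b)" using 2(2) 4(3) by (simp add: s1_def s3_def)
    have G: "s4 (b + 2) = G (s b)" using 4(2) by (simp add: s3_def s2b)
    have "\<forall>i < b. s5 i = s i" using 2(3) 4(3) by (simp add: s5_def s3_def s1_def)
    moreover have "s5 b = Node (F (s b)) (G (s b))" by (simp only: s5_def fun_upd_same F G)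
    moreover have "(1 + tsize (s b)) + (t2 + ((1 + tsize (s2 b)) + (t4 +
      (1 + tsize (Node (s4 (b + 1)) (s4 (b + 2))))))) \<le> ?T (tsize (s b))"
      unfolding F G tsize.simps using 2(4) 4(4) e[of "s b"] e'[of "s b"] s2b
      by (auto simp: s1_def s3_def intro!: add_mono)
    moreover have "exec C s ((1 + tsize (s b)) + (t2 + ((1 + tsize (s2 b)) + (t4 +
      (1 + tsize (Node (s4 (b + 1)) (s4 (b + 2)))))))) s5"
      unfolding C_def by (intro exec.Seq[OF 1] exec.Seq[OF 2(1)] exec.Seq[OF 3] exec.Seq[OF 4(1)] 5)
    ultimately show ?thesis by blast
  qed
  moreover have "pbound ?T" by (intro pbound_intros)
  ultimately show "\<exists>C T. pbound T \<and> (\<forall>s. \<exists>s' t. exec C s t s' \<and> s' b = Node (F (s b)) (G (s b)) \<and>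
     (\<forall>i < b. s' i = s i) \<and> t \<le> T (tsize (s b)))" by blast
qed

lemma ptime_cond:
  assumes P: "ptime P" and F: "ptime F" and G: "ptime G"
  shows "ptime (\<lambda>x. if P x \<noteq> Leaf then F x else G x)"
  unfolding ptime_def
proof
  fix b
  obtain CP dP where CP: "\<And>s. \<exists>s' t. exec CP s t s' \<and> s' (b + 1) = P (s (b + 1)) \<and>
    (\<forall>i < b + 1. s' i = s i) \<and> t \<le> (tsize (s (b + 1)) + 2) ^ dP" using ptimeE[OF P] by blast
  obtain CF dF where CF: "\<And>s. \<exists>s' t. exec CF s t s' \<and> s' b = F (s b) \<and>
    (\<forall>i < b. s' i = s i) \<and> t \<le> (tsize (s b) + 2) ^ dF" using ptimeE[OF F] by blast
  obtain CG dG where CG: "\<And>s. \<exists>s' t. exec CG s t s' \<and> s' b = G (s b) \<and>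
    (\<forall>i < b. s' i = s i) \<and> t \<le> (tsize (s b) + 2) ^ dG" using ptimeE[OF G] by blast
  define C where "C = Seq (Assign (b + 1) (Var b)) (Seq CP (Cond (Var (b + 1)) CF CG))"
  let ?T = "\<lambda>m. (1 + m) + ((m + 2) ^ dP + (1 + ((m + 2) ^ dF + (m + 2) ^ dG)))"
  have "\<exists>s' t. exec C s t s' \<and> s' b = (if P (s b) \<noteq> Leaf then F (s b) else G (s b)) \<and>
    (\<forall>i < b. s' i = s i) \<and> t \<le> ?T (tsize (s b))" for s
  proof -
    define s1 where "s1 = s(b + 1 := s b)"
    have 1: "exec (Assign (b + 1) (Var b)) s (1 + tsize (s b)) s1"
      using exec.Assign[of "b + 1" "Var b" s] by (simp add: s1_def)
    obtain s2 t2 where 2: "exec CP s1 t2 s2" "s2 (b + 1) = P (s1 (b + 1))" "\<forall>i < b + 1. s2 i = s1 i"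
      "t2 \<le> (tsize (s1 (b + 1)) + 2) ^ dP" using CP by blast
    have s2: "s2 b = s b" "\<forall>i < b. s2 i = s i" "s2 (b + 1) = P (s b)"
      using 2 by (auto simp: s1_def)
    obtain s3 t3 where 3: "exec (Cond (Var (b + 1)) CF CG) s2 (1 + t3) s3"
      "s3 b = (if P (s b) \<noteq> Leaf then F (s b) else G (s b))" "\<forall>i < b. s3 i = s i"
      "t3 \<le> (tsize (s b) + 2) ^ dF + (tsize (s b) + 2) ^ dG"
    proof (cases "P (s b) = Leaf")
      case True
      obtain s3 t3 where "exec CG s2 t3 s3" "s3 b = G (s2 b)" "\<forall>i < b. s3 i = s2 i"
        "t3 \<le> (tsize (s2 b) + 2) ^ dG" using CG by blast
      moreover from this have "exec (Cond (Var (b + 1)) CF CG) s2 (1 + t3) s3"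
        using s2 True by (intro exec.IfFalse) auto
      ultimately show ?thesis using that[of t3 s3] s2 True by simp
    next
      case False
      obtain s3 t3 where "exec CF s2 t3 s3" "s3 b = F (s2 b)" "\<forall>i < b. s3 i = s2 i"
        "t3 \<le> (tsize (s2 b) + 2) ^ dF" using CF by blast
      moreover from this have "exec (Cond (Var (b + 1)) CF CG) s2 (1 + t3) s3"
        using s2 False by (intro exec.IfTrue) auto
      ultimately show ?thesis using that[of t3 s3] s2 False by simp
    qed
    have "exec C s ((1 + tsize (s b)) + (t2 + (1 + t3))) s3"
      unfolding C_def by (intro exec.Seq[OF 1] exec.Seq[OF 2(1)] 3)
    moreover have "(1 + tsize (s b)) + (t2 + (1 + t3)) \<le> ?T (tsize (s b))"
      using 2(4) 3(4) by (auto simp: s1_def intro!: add_mono)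
    ultimately show ?thesis using 3 by blast
  qed
  moreover have "pbound ?T" by (intro pbound_intros)
  ultimately show "\<exists>C T. pbound T \<and> (\<forall>s. \<exists>s' t. exec C s t s' \<and>
     s' b = (if P (s b) \<noteq> Leaf then F (s b) else G (s b)) \<and>
     (\<forall>i < b. s' i = s i) \<and> t \<le> T (tsize (s b)))" by blast
qed

text \<open>\<open>n\<close> counts the iterations, and \<open>M\<close> bounds the size of all intermediate states.\<close>

inductive loop :: "(tree \<Rightarrow> tree) \<Rightarrow> nat \<Rightarrow> nat \<Rightarrow> tree \<Rightarrow> tree \<Rightarrow> bool" for F M where
  loop_stop: "thd z = Leaf \<Longrightarrow> tsize z \<le> M \<Longrightarrow> loop F M 0 z z"
| loop_step: "thd z \<noteq> Leaf \<Longrightarrow> tsize z \<le> M \<Longrightarrow> loop F M n (F z) z' \<Longrightarrow> loop F M (Suc n) z z'"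

text \<open>Polynomially many rounds of a polynomial-time step may still produce trees of
  exponential size, because sizes compound. Hence the same \<open>T\<close> bounds the number of
  rounds and every intermediate state.\<close>

lemma ptime_loop:
  assumes F: "ptime F" and I: "ptime I" and T: "pbound T"
    and loop: "\<And>x. \<exists>n \<le> T (tsize x). loop F (T (tsize x)) n (I x) (G x)"
  shows "ptime G"
  unfolding ptime_def
proof
  fix b
  obtain CI dI where CI: "\<And>s. \<exists>s' t. exec CI s t s' \<and> s' b = I (s b) \<and>
    (\<forall>i < b. s' i = s i) \<and> t \<le> (tsize (s b) + 2) ^ dI" using ptimeE[OF I] by blast
  obtain CF dF where CF: "\<And>s. \<exists>s' t. exec CF s t s' \<and> s' b = F (s b) \<and>
    (\<forall>i < b. s' i = s i) \<and> t \<le> (tsize (s b) + 2) ^ dF" using ptimeE[OF F] by blast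
  define C where "C = While (Hd (Var b)) CF"
  have hd: "eval (Hd (Var b)) s = thd (s b)" for s by (cases "s b") auto
  have *: "loop F M n z z' \<Longrightarrow> s b = z \<Longrightarrow> \<exists>s' t. exec C s t s' \<and> s' b = z' \<and>
    (\<forall>i < b. s' i = s i) \<and> t \<le> 1 + n * (1 + (M + 2) ^ dF)" for M n z z' s
  proof (induction arbitrary: s rule: loop.induct)
    case (loop_stop z)
    then have "exec C s 1 s" unfolding C_def by (intro exec.WhileFalse) (simp only: hd)
    then show ?case using loop_stop by (intro exI[of _ s] exI[of _ 1]) auto
  next
    case (loop_step z n z')
    obtain s1 t1 where 1: "exec CF s t1 s1" "s1 b = F (s b)" "\<forall>i < b. s1 i = s i"
      "t1 \<le> (tsize (s b) + 2) ^ dF" using CF by blast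
    obtain s2 t2 where 2: "exec C s1 t2 s2" "s2 b = z'" "\<forall>i < b. s2 i = s1 i"
      "t2 \<le> 1 + n * (1 + (M + 2) ^ dF)" using loop_step.IH[of s1] 1 loop_step.prems by auto
    have "t1 \<le> (M + 2) ^ dF"
      using 1(4) by (rule order_trans) (use loop_step in \<open>auto intro: power_mono\<close>)
    moreover have "exec C s (1 + t1 + t2) s2" unfolding C_def
      by (rule exec.WhileTrue[OF _ 1(1) 2(1)[unfolded C_def]])
        (use loop_step in \<open>auto simp: hd simp del: eval.simps\<close>)
    ultimately show ?case using 1 2 by (intro exI[of _ s2] exI[of _ "1 + t1 + t2"]) auto
  qed
  let ?T = "\<lambda>m. (m + 2) ^ dI + (1 + T m * (1 + (T m + 2) ^ dF))"
  have "\<exists>s' t. exec (Seq CI C) s t s' \<and> s' b = G (s b) \<and> (\<forall>i < b. s' i = s i) \<and>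
    t \<le> ?T (tsize (s b))" for s
  proof -
    obtain n where n: "n \<le> T (tsize (s b))" "loop F (T (tsize (s b))) n (I (s b)) (G (s b))"
      using loop by blast
    obtain s1 t1 where 1: "exec CI s t1 s1" "s1 b = I (s b)" "\<forall>i < b. s1 i = s i"
      "t1 \<le> (tsize (s b) + 2) ^ dI" using CI by blast
    obtain s2 t2 where 2: "exec C s1 t2 s2" "s2 b = G (s b)" "\<forall>i < b. s2 i = s1 i"
      "t2 \<le> 1 + n * (1 + (T (tsize (s b)) + 2) ^ dF)"
      using *[OF n(2), of s1] 1(2) by blast
    have "t2 \<le> 1 + T (tsize (s b)) * (1 + (T (tsize (s b)) + 2) ^ dF)"
      using 2(4) by (rule order_trans) (intro add_mono mult_le_mono n(1) order_refl)
    then have "t1 + t2 \<le> ?T (tsize (s b))" using 1(4) by (intro add_mono)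
    then show ?thesis using 1 2 by (intro exI[of _ s2] exI[of _ "t1 + t2"]) (auto intro: exec.Seq)
  qed
  moreover have "pbound ?T" by (intro pbound_intros T)
  ultimately show "\<exists>C T. pbound T \<and> (\<forall>s. \<exists>s' t. exec C s t s' \<and> s' b = G (s b) \<and>
     (\<forall>i < b. s' i = s i) \<and> t \<le> T (tsize (s b)))" by blast
qed

section \<open>Trees as lists\<close>

fun ls :: "tree \<Rightarrow> tree list" where
  "ls Leaf = []"
| "ls (Node a b) = a # ls b"

fun mk :: "tree list \<Rightarrow> tree" where
  "mk [] = Leaf"
| "mk (x # xs) = Node x (mk xs)"

lemma ls_mk [simp]: "ls (mk xs) = xs"
  by (induction xs) auto

lemma mk_ls [simp]: "mk (ls t) = t"
  by (induction t) auto

lemma mk_eq_iff [simp]: "mk xs = mk ys \<longleftrightarrow> xs = ys"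
  by (metis ls_mk)

lemma enc_list_conv_mk: "enc_list f xs = mk (map f xs)"
  by (induction xs) auto

lemma tsize_mk: "tsize (mk xs) = 1 + length xs + (\<Sum>x\<leftarrow>xs. tsize x)"
  by (induction xs) auto

lemma tsize_mem: "x \<in> set xs \<Longrightarrow> tsize x < tsize (mk xs)"
  by (induction xs) auto

lemma length_le_tsize_mk: "length xs \<le> tsize (mk xs)"
  by (simp add: tsize_mk)

lemma tsize_pos [simp]: "tsize t \<ge> 1"
  by (cases t) auto

lemma tsize_thd_ttl: "tsize (thd t) \<le> tsize t" "tsize (ttl t) \<le> tsize t"
  by (cases t; simp)+

text \<open>The state consists of the rest of the list and the accumulator. After the prefix
  \<open>l1\<close> the accumulator is \<open>fold f l1 a\<close>, so a bound for all prefixes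
  bounds all states of the loop.\<close>

lemma loop_fold:
  assumes "\<And>l1 l2. l = l1 @ l2 \<Longrightarrow> tsize (fold f l1 a) + tsize (mk l) + 2 \<le> M"
  shows "loop (\<lambda>st. Node (ttl (thd st)) (f (thd (thd st)) (ttl st))) M (length l)
    (Node (mk l) a) (Node Leaf (fold f l a))"
  using assms
proof (induction l arbitrary: a)
  case Nil
  show ?case using Nil(1)[of "[]" "[]"] by (auto intro!: loop.loop_stop)
next
  case (Cons y l)
  show ?case
    unfolding list.size add_0_right add_Suc_right mk.simps
  proof (rule loop.loop_step)
    have "tsize (fold f l1 (f y a)) + tsize (mk l) + 2 \<le> M" if "l = l1 @ l2" for l1 l2
      using Cons.prems(1)[of "y # l1" l2] that by auto
    then have "loop (\<lambda>st. Node (ttl (thd st)) (f (thd (thd st)) (ttl st))) M (length l)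
      (Node (mk l) (f y a)) (Node Leaf (fold f l (f y a)))" using Cons.IH Cons.prems by auto
    then show "loop (\<lambda>st. Node (ttl (thd st)) (f (thd (thd st)) (ttl st))) M (length l)
      (Node (ttl (thd (Node (Node y (mk l)) a)))
        (f (thd (thd (Node (Node y (mk l)) a))) (ttl (Node (Node y (mk l)) a))))
      (Node Leaf (fold f (y # l) a))" by simp
  qed (use Cons.prems(1)[of "[]" "y # l"] in auto)
qed

lemma ptime_fold:
  assumes f: "ptime (\<lambda>z. f (thd z) (ttl z))" and T: "pbound T"
    and size: "\<And>l a. tsize (fold f l a) \<le> T (tsize (mk l) + tsize a)"
    and L: "ptime L" and A: "ptime A"
  shows "ptime (\<lambda>x. fold f (ls (L x)) (A x))"
proof -
  obtain d where d: "\<And>m. T m \<le> (m + 2) ^ d" using T unfolding pbound_def by blast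
  obtain dL where dL: "\<And>x. tsize (L x) \<le> (tsize x + 2) ^ dL" using ptime_size[OF L] by blast
  obtain dA where dA: "\<And>x. tsize (A x) \<le> (tsize x + 2) ^ dA" using ptime_size[OF A] by blast
  let ?f = "\<lambda>st. Node (ttl (thd st)) (f (thd (thd st)) (ttl st))"
  let ?T = "\<lambda>m. ((m + 2) ^ dL + (m + 2) ^ dA + 2) ^ d + (m + 2) ^ dL + 2"
  have *: "ptime (\<lambda>st. f (thd (thd st)) (ttl st))"
  proof -
    have "ptime (\<lambda>st. Node (thd (thd st)) (ttl st))" by (intro ptime_intros)
    from ptime_comp[OF f this] show ?thesis by simp
  qed
  have "ptime (\<lambda>x. Node Leaf (fold f (ls (L x)) (A x)))"
  proof (rule ptime_loop[where F = ?f and I = "\<lambda>x. Node (L x) (A x)" and T = ?T])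
    fix x
    let ?l = "ls (L x)"
    have "tsize (fold f l1 (A x)) + tsize (mk ?l) + 2 \<le> ?T (tsize x)" if "?l = l1 @ l2" for l1 l2
    proof -
      have "tsize (mk l1) \<le> tsize (mk ?l)" unfolding that by (simp add: tsize_mk)
      also have "\<dots> \<le> (tsize x + 2) ^ dL" using dL by simp
      finally have "(tsize (mk l1) + tsize (A x) + 2) ^ d \<le>
        ((tsize x + 2) ^ dL + (tsize x + 2) ^ dA + 2) ^ d"
        using dA[of x] by (intro power_mono) auto
      then show ?thesis using size[of l1 "A x"] d[of "tsize (mk l1) + tsize (A x)"] dL[of x]
        by simp
    qed
    from loop_fold[of ?l f "A x", OF this] have
      "loop ?f (?T (tsize x)) (length ?l) (Node (L x) (A x)) (Node Leaf (fold f ?l (A x)))"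
      by simp
    moreover have "length ?l \<le> ?T (tsize x)"
      using length_le_tsize_mk[of ?l] dL[of x] by simp
    ultimately show "\<exists>n \<le> ?T (tsize x). loop ?f (?T (tsize x)) n (Node (L x) (A x))
      (Node Leaf (fold f ?l (A x)))" by blast
  qed (intro ptime_intros pbound_intros L A *)+
  from ptime_ttl[OF this] show ?thesis by simp
qed

text \<open>This one fold provides the reversal of lists, and it pushes the outputs of a loop onto
  its accumulator.\<close>

lemma fold_Node: "fold Node l a = mk (rev l @ ls a)"
  by (induction l arbitrary: a) auto

lemma ptime_fold_Node [ptime_intros]:
  assumes "ptime L" "ptime A"
  shows "ptime (\<lambda>x. fold Node (ls (L x)) (A x))"
proof (rule ptime_fold[where T = "\<lambda>m. m"])
  have "tsize (fold Node l a) \<le> tsize (mk l) + tsize (mk (ls a))" for l a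
    unfolding fold_Node tsize_mk by (simp flip: rev_map)
  then show "tsize (fold Node l a) \<le> tsize (mk l) + tsize a" for l a by simp
qed (intro ptime_intros pbound_intros assms)+

section \<open>List-valued functions and decisions in polynomial time\<close>

definition plist :: "(tree \<Rightarrow> tree list) \<Rightarrow> bool" where
  "plist f \<longleftrightarrow> ptime (\<lambda>x. mk (f x))"

definition pdec :: "(tree \<Rightarrow> bool) \<Rightarrow> bool" where
  "pdec P \<longleftrightarrow> ptime (\<lambda>x. enc_bool (P x))"

lemma ptime_mk [ptime_intros]: "plist f \<Longrightarrow> ptime (\<lambda>x. mk (f x))"
  by (simp add: plist_def)

lemma plist_ls [ptime_intros]: "ptime F \<Longrightarrow> plist (\<lambda>x. ls (F x))"
  by (simp add: plist_def)

lemma plist_Nil [ptime_intros]: "plist (\<lambda>_. [])"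
  unfolding plist_def mk.simps by (rule ptime_intros)

lemma plist_Cons [ptime_intros]: "ptime F \<Longrightarrow> plist f \<Longrightarrow> plist (\<lambda>x. F x # f x)"
  unfolding plist_def mk.simps by (rule ptime_intros)

lemma enc_bool_eq_Leaf [simp]: "enc_bool p = Leaf \<longleftrightarrow> \<not> p"
  by (simp add: enc_bool_def)

lemma plist_rev [ptime_intros]: "plist f \<Longrightarrow> plist (\<lambda>x. rev (f x))"
  unfolding plist_def using ptime_fold_Node[of "\<lambda>x. mk (f x)" "\<lambda>_. Leaf"] ptime_const
  by (simp add: fold_Node)

lemma ptime_If [ptime_intros]:
  "pdec P \<Longrightarrow> ptime F \<Longrightarrow> ptime G \<Longrightarrow> ptime (\<lambda>x. if P x then F x else G x)"
  unfolding pdec_def using ptime_cond[of "\<lambda>x. enc_bool (P x)" F G] by simp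

lemma plist_If [ptime_intros]:
  assumes "pdec P" "plist f" "plist g"
  shows "plist (\<lambda>x. if P x then f x else g x)"
  using ptime_If[of P "\<lambda>x. mk (f x)" "\<lambda>x. mk (g x)"] assms
  by (simp add: plist_def if_distrib[of mk])

lemma pdec_eq_Leaf [ptime_intros]:
  assumes "ptime F"
  shows "pdec (\<lambda>x. F x = Leaf)"
proof -
  have "enc_bool (F x = Leaf) = (if F x \<noteq> Leaf then Leaf else Node Leaf Leaf)" for x
    by (simp add: enc_bool_def)
  then show ?thesis unfolding pdec_def
    using ptime_cond[of F "\<lambda>_. Leaf" "\<lambda>_. Node Leaf Leaf"] assms ptime_const by simp
qed

lemma pdec_If [ptime_intros]:
  assumes "pdec P" "pdec Q" "pdec R"
  shows "pdec (\<lambda>x. if P x then Q x else R x)"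
  using ptime_If[of P "\<lambda>x. enc_bool (Q x)" "\<lambda>x. enc_bool (R x)"] assms
  by (simp add: pdec_def if_distrib[of enc_bool])

lemma pdec_const [ptime_intros]: "pdec (\<lambda>_. p)"
  unfolding pdec_def by (rule ptime_intros)

lemma pdec_not [ptime_intros]:
  assumes "pdec P"
  shows "pdec (\<lambda>x. \<not> P x)"
proof -
  have *: "(\<not> P x) = (if P x then False else True)" for x by simp
  show ?thesis unfolding * by (intro pdec_If pdec_const assms)
qed

lemma pdec_conj [ptime_intros]:
  assumes "pdec P" "pdec Q"
  shows "pdec (\<lambda>x. P x \<and> Q x)"
proof -
  have *: "(P x \<and> Q x) = (if P x then Q x else False)" for x by simp
  show ?thesis unfolding * by (intro pdec_If pdec_const assms)
qed

lemma pdec_disj [ptime_intros]: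
  assumes "pdec P" "pdec Q"
  shows "pdec (\<lambda>x. P x \<or> Q x)"
proof -
  have *: "(P x \<or> Q x) = (if P x then True else Q x)" for x by simp
  show ?thesis unfolding * by (intro pdec_If pdec_const assms)
qed

lemma pdec_imp [ptime_intros]:
  assumes "pdec P" "pdec Q"
  shows "pdec (\<lambda>x. P x \<longrightarrow> Q x)"
proof -
  have *: "(P x \<longrightarrow> Q x) = (if P x then Q x else True)" for x by simp
  show ?thesis unfolding * by (intro pdec_If pdec_const assms)
qed

text \<open>The body may depend on the surrounding input \<open>x\<close>, so it is given as a
  function of the pair of \<open>x\<close> and \<open>y\<close>. A fold step sees only
  \<open>y\<close> and the accumulator; the latter therefore carries \<open>x\<close> along. The
  outputs pile up in reverse and are turned round at the end.\<close>

lemma plist_concat_map [ptime_intros]: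
  assumes g: "plist (\<lambda>z. g (thd z) (ttl z))" and f: "plist f"
  shows "plist (\<lambda>x. concat (map (\<lambda>y. g x y) (f x)))"
proof -
  let ?f = "\<lambda>y a. Node (thd a) (fold Node (g (thd a) y) (ttl a))"
  have g': "ptime (\<lambda>z. mk (g (thd z) (ttl z)))" using g by (simp add: plist_def)
  obtain e where "\<And>z. tsize (mk (g (thd z) (ttl z))) \<le> (tsize z + 2) ^ e"
    using ptime_size[OF g'] by blast
  from this[of "Node _ _"] have e: "tsize (mk (g u v)) \<le> (tsize u + tsize v + 3) ^ e" for u v
    by (simp add: add_ac numeral_eq_Suc)
  have fold: "fold ?f l (Node u a) = Node u (mk (rev (concat (map (g u) l)) @ ls a))" for l u a
    by (induction l arbitrary: a) (auto simp: fold_Node)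
  have size: "tsize (fold ?f l (Node u a)) \<le> 1 + tsize u + tsize a + length l * (tsize u + tsize (mk l) + 3) ^ e"
    for l u a
  proof -
    have "tsize (mk (rev (concat (map (g u) l')) @ ls a)) \<le> tsize a + length l' * N"
      if "\<And>y. y \<in> set l' \<Longrightarrow> tsize (mk (g u y)) \<le> N" for l' N
      using that
    proof (induction l')
      case Nil
      show ?case by simp
    next
      case (Cons y l')
      have "tsize (mk (rev (concat (map (g u) (y # l'))) @ ls a)) \<le>
        tsize (mk (rev (concat (map (g u) l')) @ ls a)) + tsize (mk (g u y))"
        by (simp add: tsize_mk flip: rev_map)
      then show ?case using Cons.IH[OF Cons.prems] Cons.prems[of y] by simp
    qed
    from this[of l "(tsize u + tsize (mk l) + 3) ^ e"]
    have "tsize (mk (rev (concat (map (g u) l)) @ ls a)) \<le> tsize a + length l * (tsize u + tsize (mk l) + 3) ^ e"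
      if "\<And>y. y \<in> set l \<Longrightarrow> tsize (mk (g u y)) \<le> (tsize u + tsize (mk l) + 3) ^ e" using that .
    moreover have "tsize (mk (g u y)) \<le> (tsize u + tsize (mk l) + 3) ^ e" if "y \<in> set l" for y
      using e[of u y] by (rule order_trans) (use tsize_mem[OF that] in \<open>auto intro: power_mono\<close>)
    ultimately show ?thesis unfolding fold tsize.simps by auto
  qed
  let ?T = "\<lambda>m. m + m + m + 2 + m * (m + 4) ^ e"
  have "ptime (\<lambda>x. fold ?f (ls (mk (f x))) (Node x Leaf))"
  proof (rule ptime_fold[where T = ?T])
    have "ptime (\<lambda>z. mk (g (thd (ttl z)) (thd z)))"
    proof -
      have "ptime (\<lambda>z. Node (thd (ttl z)) (thd z))" by (intro ptime_intros)
      from ptime_comp[OF g' this] show ?thesis by simp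
    qed
    then have "ptime (\<lambda>z. fold Node (ls (mk (g (thd (ttl z)) (thd z)))) (ttl (ttl z)))"
      by (rule ptime_fold_Node) (intro ptime_intros)
    then have "ptime (\<lambda>z. Node (thd (ttl z)) (fold Node (ls (mk (g (thd (ttl z)) (thd z)))) (ttl (ttl z))))"
      by (rule ptime_Node[rotated]) (intro ptime_intros)
    then show "ptime (\<lambda>z. ?f (thd z) (ttl z))" by simp
    show "tsize (fold ?f l a) \<le> ?T (tsize (mk l) + tsize a)" for l a
    proof (cases "l = []")
      case False
      \<comment> \<open>The step reads the accumulator through \<open>thd\<close> and
        \<open>ttl\<close> only, so a nonempty fold cannot distinguish \<open>Leaf\<close> from
        \<open>Node Leaf Leaf\<close>.\<close>
      have "fold ?f l a = fold ?f l (Node (thd a) (ttl a))" using False by (cases l) auto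
      also have "tsize \<dots> \<le> 1 + tsize (thd a) + tsize (ttl a) + length l * (tsize (thd a) + tsize (mk l) + 3) ^ e"
        by (rule size)
      also have "\<dots> \<le> 1 + tsize a + tsize a + (tsize (mk l) + tsize a) * (tsize (mk l) + tsize a + 4) ^ e"
      proof (rule add_mono)
        show "length l * (tsize (thd a) + tsize (mk l) + 3) ^ e \<le>
          (tsize (mk l) + tsize a) * (tsize (mk l) + tsize a + 4) ^ e"
          using tsize_thd_ttl[of a] length_le_tsize_mk[of l] by (intro mult_le_mono power_mono) auto
      qed (use tsize_thd_ttl[of a] in simp)
      finally show ?thesis by simp
    qed simp
    show "ptime (\<lambda>x. mk (f x))" using f by (simp add: plist_def)
  qed (intro ptime_intros pbound_intros)+
  then have "ptime (\<lambda>x. fold Node (ls (ttl (fold ?f (ls (mk (f x))) (Node x Leaf)))) Leaf)"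
    by (intro ptime_intros)
  then show ?thesis unfolding plist_def fold by (simp add: fold_Node)
qed

lemma plist_map [ptime_intros]:
  assumes "ptime (\<lambda>z. g (thd z) (ttl z))" "plist f"
  shows "plist (\<lambda>x. map (\<lambda>y. g x y) (f x))"
proof -
  have "plist (\<lambda>x. concat (map (\<lambda>y. [g x y]) (f x)))" by (intro ptime_intros assms)
  then show ?thesis by simp
qed

lemma plist_append [ptime_intros]:
  assumes "plist f" "plist g"
  shows "plist (\<lambda>x. f x @ g x)"
proof -
  have "plist (\<lambda>x. concat (map (\<lambda>y. ls y) [mk (f x), mk (g x)]))" by (intro ptime_intros assms)
  then show ?thesis by simp
qed

text \<open>Here \<open>d\<close> is a constant of the program and not an input, so nesting
  \<open>d\<close> loops stays polynomial.\<close>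

lemma plist_n_lists [ptime_intros]:
  assumes "plist f"
  shows "plist (\<lambda>x. map mk (List.n_lists d (f x)))"
proof (induction d)
  case 0
  show ?case by (simp, intro ptime_intros)
next
  case (Suc d)
  have "plist (\<lambda>x. concat (map (\<lambda>l. map (\<lambda>y. Node y l) (f x)) (map mk (List.n_lists d (f x)))))"
    by (intro ptime_intros Suc assms, unfold plist_def, rule ptime_comp[OF assms[unfolded plist_def]])
      (intro ptime_intros)
  then show ?case by (simp add: map_concat comp_def)
qed

lemma pdec_bex [ptime_intros]:
  assumes "pdec (\<lambda>z. P (thd z) (ttl z))" "plist f"
  shows "pdec (\<lambda>x. \<exists>y \<in> set (f x). P x y)"
proof -
  have "pdec (\<lambda>x. \<not> mk (concat (map (\<lambda>y. if P x y then [Leaf] else []) (f x))) = Leaf)"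
    by (intro ptime_intros assms)
  moreover have "(\<not> mk l = Leaf) \<longleftrightarrow> l \<noteq> []" for l by (cases l) auto
  moreover have "concat (map (\<lambda>y. if P x y then [Leaf] else []) (f x)) \<noteq> [] \<longleftrightarrow> (\<exists>y \<in> set (f x). P x y)" for x
    by auto
  ultimately show ?thesis by simp
qed

lemma pdec_ball [ptime_intros]:
  assumes "pdec (\<lambda>z. P (thd z) (ttl z))" "plist f"
  shows "pdec (\<lambda>x. \<forall>y \<in> set (f x). P x y)"
proof -
  have "pdec (\<lambda>x. \<not> (\<exists>y \<in> set (f x). \<not> P x y))" by (intro ptime_intros assms)
  then show ?thesis by simp
qed

lemma ptime_enc_unary_length [ptime_intros]:
  assumes "plist f"
  shows "ptime (\<lambda>x. enc_unary (length (f x)))"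
proof -
  have "ptime (\<lambda>x. mk (map (\<lambda>_. Leaf) (f x)))" by (intro ptime_intros assms)
  moreover have "mk (map (\<lambda>_. Leaf) l) = enc_unary (length l)" for l :: "tree list" by (induction l) auto
  ultimately show ?thesis by simp
qed


text \<open>Equality of trees is tested iteratively. A mismatch of shapes empties the stack and
  replaces the prepared answer by \<open>Leaf\<close>; otherwise the answer is kept until the stack
  runs empty.\<close>

fun eq_step :: "tree \<Rightarrow> tree" where
  "eq_step st = (let p = thd (thd st); r = ttl (thd st) in
    if thd p = Leaf \<and> ttl p = Leaf then Node r (ttl st)
    else if thd p = Leaf \<or> ttl p = Leaf then Node Leaf Leaf
    else Node (Node (Node (thd (thd p)) (thd (ttl p))) (Node (Node (ttl (thd p)) (ttl (ttl p))) r)) (ttl st))"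

declare eq_step.simps [simp del]

lemma ptime_eq_step: "ptime eq_step"
  unfolding eq_step.simps Let_def by (intro ptime_intros)

text \<open>The first component of the state is the stack of the pairs still to be compared. The steps
  never enlarge it, since a pair of inner nodes is replaced by the two pairs of their sons.\<close>

lemma loop_eq_step:
  assumes "tsize (mk (map (\<lambda>(a, b). Node a b) ps)) + tsize r + 1 \<le> M"
  shows "\<exists>n \<le> (\<Sum>(a, b)\<leftarrow>ps. tsize a). loop eq_step M n (Node (mk (map (\<lambda>(a, b). Node a b) ps)) r)
    (Node Leaf (if \<forall>(a, b) \<in> set ps. a = b then r else Leaf))"
  using assms
\<comment> \<open>A step that does not fail removes exactly one node from the left components, so
  their total size bounds the number of steps.\<close>
proof (induction "\<Sum>(a, b)\<leftarrow>ps. tsize a" arbitrary: ps rule: less_induct)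
  case less
  show ?case
  proof (cases ps)
    case Nil
    then show ?thesis using less.prems by (auto intro!: loop.loop_stop)
  next
    case (Cons p ps')
    obtain a b where p: "p = (a, b)" by (cases p)
    let ?st = "\<lambda>ps. Node (mk (map (\<lambda>(a, b). Node a b) ps)) r"
    let ?res = "\<lambda>ps. Node Leaf (if \<forall>(a, b) \<in> set ps. a = b then r else Leaf)"
    have step: "loop eq_step M (Suc n) (?st ps) z" if "loop eq_step M n (eq_step (?st ps)) z" for n z
      by (rule loop.loop_step) (use that less.prems Cons p in auto)
    have fail: "\<exists>n \<le> (\<Sum>(a, b)\<leftarrow>ps. tsize a). loop eq_step M n (?st ps) (?res ps)"
      if "eq_step (?st ps) = Node Leaf Leaf" "a \<noteq> b"
    proof -
      have "loop eq_step M 0 (Node Leaf Leaf) (Node Leaf Leaf)"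
        by (rule loop.loop_stop) (use less.prems Cons p in \<open>auto intro: order_trans[rotated]\<close>)
      from step[unfolded that, OF this] show ?thesis using Cons p that(2) tsize_pos[of a]
        by (intro exI[of _ "Suc 0"]) auto
    qed
    have continue: "\<exists>n \<le> (\<Sum>(a, b)\<leftarrow>ps. tsize a). loop eq_step M n (?st ps) (?res ps)"
      if 1: "eq_step (?st ps) = ?st qs" and 2: "(\<Sum>(a, b)\<leftarrow>qs. tsize a) < (\<Sum>(a, b)\<leftarrow>ps. tsize a)"
        and 3: "tsize (?st qs) \<le> tsize (?st ps)" and 4: "(\<forall>(a, b) \<in> set qs. a = b) \<longleftrightarrow> (\<forall>(a, b) \<in> set ps. a = b)" for qs
    proof -
      obtain n where "n \<le> (\<Sum>(a, b)\<leftarrow>qs. tsize a)" "loop eq_step M n (?st qs) (?res qs)"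
        using less.hyps[OF 2] 3 less.prems by auto
      then show ?thesis using step[of n, unfolded 1] 2 4 by (intro exI[of _ "Suc n"]) auto
    qed
    show ?thesis
    proof (cases a)
      case a: Leaf
      show ?thesis
      proof (cases b)
        case Leaf
        show ?thesis by (rule continue[of ps']) (auto simp: Cons p a Leaf eq_step.simps)
      next
        case (Node b1 b2)
        show ?thesis by (rule fail) (auto simp: Cons p a Node eq_step.simps)
      qed
    next
      case a: (Node a1 a2)
      show ?thesis
      proof (cases b)
        case Leaf
        show ?thesis by (rule fail) (auto simp: Cons p a Leaf eq_step.simps)
      next
        case (Node b1 b2)
        show ?thesis by (rule continue[of "(a1, b1) # (a2, b2) # ps'"]) (auto simp: Cons p a Node eq_step.simps)
      qed
    qed
  qed
qed

lemma pdec_eq [ptime_intros]: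
  assumes F: "ptime F" and G: "ptime G"
  shows "pdec (\<lambda>x. F x = G x)"
proof -
  obtain d where d: "\<And>x. tsize (F x) \<le> (tsize x + 2) ^ d" using ptime_size[OF F] by blast
  obtain e where e: "\<And>x. tsize (G x) \<le> (tsize x + 2) ^ e" using ptime_size[OF G] by blast
  let ?T = "\<lambda>m. (m + 2) ^ d + (m + 2) ^ e + 10"
  have "ptime (\<lambda>x. Node Leaf (enc_bool (F x = G x)))"
  proof (rule ptime_loop[OF ptime_eq_step, where T = ?T])
    show "ptime (\<lambda>x. Node (Node (Node (F x) (G x)) Leaf) (Node Leaf Leaf))"
      by (intro ptime_intros F G)
    fix x
    have "tsize (mk (map (\<lambda>(a, b). Node a b) [(F x, G x)])) + tsize (Node Leaf Leaf) + 1 \<le> ?T (tsize x)"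
      using d[of x] e[of x] by simp
    from loop_eq_step[OF this] obtain n where n: "n \<le> tsize (F x)"
      "loop eq_step (?T (tsize x)) n (Node (Node (Node (F x) (G x)) Leaf) (Node Leaf Leaf))
        (Node Leaf (enc_bool (F x = G x)))" by (auto simp: enc_bool_def)
    moreover from n have "n \<le> ?T (tsize x)" using d[of x] by linarith
    ultimately show "\<exists>n \<le> ?T (tsize x). loop eq_step (?T (tsize x)) n
      (Node (Node (Node (F x) (G x)) Leaf) (Node Leaf Leaf)) (Node Leaf (enc_bool (F x = G x)))"
      by blast
  qed (intro pbound_intros)
  from ptime_ttl[OF this] show ?thesis by (simp add: pdec_def)
qed

lemma pdec_mem [ptime_intros]:
  assumes F: "ptime F" and f: "plist f"
  shows "pdec (\<lambda>x. F x \<in> set (f x))"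
proof -
  have "pdec (\<lambda>x. \<exists>y \<in> set (f x). y = F x)"
    by (intro ptime_intros f ptime_comp[OF F])
  then show ?thesis by (simp add: eq_commute)
qed

text \<open>The proper suffixes of a list, longest first. Among unary numerals they are the smaller
  numerals, among the suffixes of one list they are the shorter ones. So membership in
  \<open>ptl\<close> serves as the order on ranks and on positions alike.\<close>

fun ptl :: "tree \<Rightarrow> tree list" where
  "ptl Leaf = []"
| "ptl (Node a b) = b # ptl b"

text \<open>The entries \<open>y\<close> merely count the rounds; each round shortens the stored
  suffix and records it. As there are linearly many suffixes, the total size is quadratic.\<close>

lemma plist_ptl [ptime_intros]:
  assumes "ptime F"
  shows "plist (\<lambda>x. ptl (F x))"
proof -
  let ?f = "\<lambda>y a. Node (ttl (thd a)) (Node (ttl (thd a)) (ttl a))"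
  have fold: "fold ?f (ls t) (Node t a) = Node Leaf (mk (rev (ptl t) @ ls a))" for t a
    by (induction t arbitrary: a) auto
  have "ptime (\<lambda>x. fold ?f (ls (F x)) (Node (F x) Leaf))"
  \<comment> \<open>The 5 is the size of \<open>Node Leaf (Node Leaf Leaf)\<close>, into which the
    first step turns an accumulator \<open>Leaf\<close>.\<close>
  proof (rule ptime_fold[where T = "\<lambda>m. 5 + m + m * (m + 2)"])
    have size: "tsize (fold ?f l (Node u a)) \<le> 1 + tsize u + tsize a + length l * (tsize u + 2)" for l u a
    proof (induction l arbitrary: u a)
      case (Cons y l)
      have "tsize (fold ?f (y # l) (Node u a)) \<le> 1 + tsize (ttl u) + tsize (Node (ttl u) a) +
        length l * (tsize (ttl u) + 2)" using Cons.IH[of "ttl u" "Node (ttl u) a"] by simp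
      also have "\<dots> \<le> 1 + tsize u + tsize (Node u a) + length l * (tsize u + 2)"
        using tsize_thd_ttl[of u] by (intro add_mono mult_le_mono) auto
      finally show ?case by simp
    qed simp
    show "tsize (fold ?f l a) \<le> 5 + (tsize (mk l) + tsize a) + (tsize (mk l) + tsize a) * (tsize (mk l) + tsize a + 2)"
      for l a
    proof (cases a)
      case (Node u v)
      have "tsize (fold ?f l a) \<le> tsize a + length l * (tsize u + 2)" using size[of l u v] Node by simp
      also have "\<dots> \<le> 5 + (tsize (mk l) + tsize a) + (tsize (mk l) + tsize a) * (tsize (mk l) + tsize a + 2)"
        using length_le_tsize_mk[of l] Node by (intro add_mono mult_le_mono) auto
      finally show ?thesis .
    next
      case Leaf
      show ?thesis
      proof (cases l)
        case (Cons y l')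
        have "tsize (fold ?f l a) \<le> (5 + tsize a) + length l' * (tsize a + 2)"
          using size[of l' Leaf "Node Leaf Leaf"] Leaf Cons by simp
        also have "\<dots> \<le> 5 + (tsize (mk l) + tsize a) + (tsize (mk l) + tsize a) * (tsize (mk l) + tsize a + 2)"
          using length_le_tsize_mk[of l'] tsize_pos[of y] Cons by (intro add_mono mult_le_mono) auto
        finally show ?thesis .
      qed simp
    qed
  qed (intro ptime_intros pbound_intros assms)+
  then have "ptime (\<lambda>x. fold Node (ls (ttl (fold ?f (ls (F x)) (Node (F x) Leaf)))) Leaf)"
    by (intro ptime_intros)
  then show ?thesis unfolding fold plist_def by (simp add: fold_Node)
qed

text \<open>One digit of a binary increment: the head of \<open>a\<close> is the carry, its tail
  holds the digits already written, the latest first.\<close>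

fun inc_step :: "tree \<Rightarrow> tree \<Rightarrow> tree" where
  "inc_step y a = (if thd a = Leaf then Node Leaf (Node y (ttl a))
    else if y = Leaf then Node Leaf (Node (Node Leaf Leaf) (ttl a))
    else Node (Node Leaf Leaf) (Node Leaf (ttl a)))"

declare inc_step.simps [simp del]

lemma inc_step_simps [simp]:
  "inc_step y (Node Leaf r) = Node Leaf (Node y r)"
  "inc_step Leaf (Node (Node b c) r) = Node Leaf (Node (Node Leaf Leaf) r)"
  "inc_step (Node d e) (Node (Node b c) r) = Node (Node Leaf Leaf) (Node Leaf r)"
  by (simp_all add: inc_step.simps)

definition inc :: "tree \<Rightarrow> tree" where
  "inc t = (let a = fold inc_step (ls t) (Node (Node Leaf Leaf) Leaf) in
    mk (rev (ls (if thd a = Leaf then ttl a else Node (Node Leaf Leaf) (ttl a)))))"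

lemma tsize_inc_step: "tsize (inc_step y a) \<le> tsize a + tsize y + 8"
  using tsize_thd_ttl(2)[of a] by (auto simp: inc_step.simps)

lemma tsize_fold_inc_step: "tsize (fold inc_step l a) \<le> tsize a + 8 * tsize (mk l)"
proof (induction l arbitrary: a)
  case (Cons y l)
  show ?case using Cons[of "inc_step y a"] tsize_inc_step[of y a] by simp
qed simp

lemma ptime_inc:
  assumes "ptime F"
  shows "ptime (\<lambda>x. inc (F x))"
proof -
  have *: "ptime (\<lambda>x. fold inc_step (ls (F x)) (Node (Node Leaf Leaf) Leaf))"
  proof (rule ptime_fold[where T = "\<lambda>m. 8 * m"])
    show "ptime (\<lambda>z. inc_step (thd z) (ttl z))" unfolding inc_step.simps by (intro ptime_intros)
    show "tsize (fold inc_step l a) \<le> 8 * (tsize (mk l) + tsize a)" for l a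
      using tsize_fold_inc_step[of l a] by simp
  qed (intro ptime_intros pbound_intros assms)+
  show ?thesis unfolding inc_def Let_def by (intro ptime_intros *)
qed

lemma tsize_mk_rev: "tsize (mk (rev (ls t))) = tsize t"
proof -
  have "tsize (mk (rev l)) = tsize (mk l)" for l by (simp add: tsize_mk flip: rev_map)
  from this[of "ls t"] show ?thesis by simp
qed

text \<open>Counting iterates \<open>inc\<close>, so the growth has to be additive; a constant
  factor as in \<open>tsize_fold_inc_step\<close> would compound. The potential charges 4 for a
  pending carry, the cost of the one digit that it may still append.\<close>

lemma tsize_inc: "tsize (inc t) \<le> tsize t + 4"
proof -
  define pot where "pot a = tsize (ttl a) + (if thd a = Leaf then 0 else 4)" for a
  have "pot (fold inc_step l a) + 1 \<le> pot a + tsize (mk l)" for l a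
  proof (induction l arbitrary: a)
    case (Cons y l)
    have "pot (inc_step y a) \<le> pot a + 1 + tsize y"
      using tsize_pos[of y] by (auto simp: pot_def inc_step.simps simp del: tsize_pos)
    then show ?case using Cons.IH[of "inc_step y a"] by simp
  qed simp
  from this[of "ls t" "Node (Node Leaf Leaf) Leaf"] have
    "pot (fold inc_step (ls t) (Node (Node Leaf Leaf) Leaf)) \<le> tsize t + 4" by (simp add: pot_def)
  then show ?thesis unfolding inc_def Let_def tsize_mk_rev by (auto simp: pot_def split: if_splits)
qed

lemma enc_nat_0 [simp]: "enc_nat 0 = Leaf"
  by (simp add: enc_nat.simps)

text \<open>Without a carry the remaining digits are copied. With a carry, an even number absorbs it
  in its last digit, and an odd number passes it on to \<open>n div 2\<close>. The list
  \<open>out\<close> of digits already written is generalized in the induction.\<close>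

lemma enc_nat_Suc: "enc_nat (Suc n) = inc (enc_nat n)"
proof -
  define fin where "fin a = rev (ls (if thd a = Leaf then ttl a else Node (Node Leaf Leaf) (ttl a)))" for a
  have 1: "fin (fold inc_step l (Node Leaf (mk out))) = rev out @ l" for l out
  proof (induction l arbitrary: out)
    case (Cons y l)
    show ?case using Cons[of "y # out"] by simp
  qed (simp add: fin_def)
  have "fin (fold inc_step (ls (enc_nat n)) (Node (Node Leaf Leaf) (mk out))) =
    rev out @ ls (enc_nat (Suc n))" for out
  proof (induction n arbitrary: out rule: less_induct)
    case (less n)
    show ?case
    proof (cases "n = 0")
      case True
      then show ?thesis by (simp add: enc_nat.simps[of "Suc 0"] enc_bool_def fin_def)
    next
      case False
      then have n: "enc_nat n = Node (enc_bool (odd n)) (enc_nat (n div 2))"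
        by (simp add: enc_nat.simps[of n])
      have Sn: "enc_nat (Suc n) = Node (enc_bool (even n)) (enc_nat (Suc n div 2))"
        by (simp add: enc_nat.simps[of "Suc n"])
      show ?thesis
      proof (cases "even n")
        case True
        then show ?thesis unfolding n Sn using 1[of "ls (enc_nat (n div 2))" "Node Leaf Leaf # out"]
          by (simp add: enc_bool_def)
      next
        case odd: False
        have "Suc n div 2 = Suc (n div 2)" using odd by presburger
        then show ?thesis unfolding n Sn using less[of "n div 2" "Leaf # out"] odd False
          by (simp add: enc_bool_def)
      qed
    qed
  qed
  from this[of "[]"] have "mk (fin (fold inc_step (ls (enc_nat n)) (Node (Node Leaf Leaf) Leaf))) = enc_nat (Suc n)"
    by simp
  then show ?thesis by (simp add: inc_def fin_def Let_def)
qed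

lemma ptime_enc_nat_length [ptime_intros]:
  assumes "plist f"
  shows "ptime (\<lambda>x. enc_nat (length (f x)))"
proof -
  have *: "fold (\<lambda>_. inc) l (enc_nat n) = enc_nat (length l + n)" for l :: "tree list" and n
    by (induction l arbitrary: n) (simp_all add: enc_nat_Suc[symmetric])
  have "ptime (\<lambda>x. fold (\<lambda>_. inc) (ls (mk (f x))) Leaf)"
  proof (rule ptime_fold[where T = "\<lambda>m. 4 * m"])
    have "tsize (fold (\<lambda>_. inc) l a) \<le> tsize a + 4 * length l" for l :: "tree list" and a
    proof (induction l arbitrary: a)
      case (Cons y l)
      show ?case using Cons[of "inc a"] tsize_inc[of a] by simp
    qed simp
    note size = this
    show "tsize (fold (\<lambda>_. inc) l a) \<le> 4 * (tsize (mk l) + tsize a)" for l a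
      using size[of l a] length_le_tsize_mk[of l] by (simp add: algebra_simps)
  qed (intro ptime_intros pbound_intros ptime_inc assms)+
  then show ?thesis using *[of _ 0] by simp
qed

section \<open>Spanners of unit-length graphs\<close>

lemma path_length_unit:
  assumes "successively (\<lambda>a b. {a, b} \<in> E) p" "\<And>e. e \<in> E \<Longrightarrow> l e = 1"
  shows "path_length l p = length p - 1"
  using assms by (induction p rule: induct_list012) (auto simp: path_length_def)

text \<open>Between two visits of the same vertex the walk can be cut out; this shortens the walk
  and keeps its ends.\<close>

lemma walk_to_path:
  assumes "p \<noteq> []" "successively R p"
  shows "\<exists>p'. p' \<noteq> [] \<and> hd p' = hd p \<and> last p' = last p \<and> distinct p' \<and> successively R p' \<and>
    length p' \<le> length p"
  using assms
proof (induction "length p" arbitrary: p rule: less_induct)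
  case less
  show ?case
  proof (cases "distinct p")
    case True
    then show ?thesis using less.prems by blast
  next
    case False
    then obtain xs ys zs y where p: "p = xs @ [y] @ ys @ [y] @ zs"
      using not_distinct_decomp by blast
    let ?q = "xs @ [y] @ zs"
    have "successively R ?q" using less.prems(2) unfolding p
      by (auto simp: successively_append_iff successively_Cons)
    moreover have "hd ?q = hd p" "last ?q = last p" unfolding p by (cases xs; auto)+
    moreover have "length ?q < length p" unfolding p by simp
    ultimately show ?thesis using less.hyps[of ?q]
      by (metis append_Cons append_is_Nil_conv list.distinct(1) less_imp_le order_trans)
  qed
qed

text \<open>The lengths are natural numbers, so a nonempty set of them has a least element.\<close>

lemma graph_dist_attained:
  assumes "graph_path E u p v"
  obtains q where "graph_path E u q v" "graph_dist E l u v = ereal (real (path_length l q))"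
proof -
  obtain q where q: "graph_path E u q v" "\<And>p. graph_path E u p v \<Longrightarrow> path_length l q \<le> path_length l p"
    using ex_has_least_nat[of "\<lambda>p. graph_path E u p v" p "path_length l"] assms by blast
  have "graph_dist E l u v = ereal (real (path_length l q))"
    unfolding graph_dist_def
    by (rule antisym, rule INF_lower2[of q], simp add: q, simp, rule INF_greatest, simp add: q)
  then show ?thesis using that q by blast
qed

lemma graph_dist_le:
  assumes "graph_path E u p v"
  shows "graph_dist E l u v \<le> ereal (real (path_length l p))"
  unfolding graph_dist_def by (rule INF_lower2[of p]) (use assms in auto)

lemma graph_dist_lessE:
  assumes "graph_dist E l u v < c"
  obtains p where "graph_path E u p v" "ereal (real (path_length l p)) < c"
  using assms unfolding graph_dist_def INF_less_iff by auto

text \<open>Each edge of \<open>q\<close> is replaced by its own detour. Lengths of lists count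
  vertices, so a detour of \<open>r\<close> edges has \<open>r + 1\<close> entries.\<close>

lemma replace_edges_by_walks:
  assumes F: "\<And>u v. {u, v} \<in> E \<Longrightarrow> \<exists>p. graph_path F u p v \<and> length p \<le> r + 1"
  assumes "q \<noteq> []" "successively (\<lambda>a b. {a, b} \<in> E) q"
  shows "\<exists>p. p \<noteq> [] \<and> hd p = hd q \<and> last p = last q \<and> successively (\<lambda>a b. {a, b} \<in> F) p \<and>
    length p \<le> r * (length q - 1) + 1"
  using assms(2,3)
proof (induction q rule: induct_list012)
  case (2 x)
  show ?case by (rule exI[of _ "[x]"]) simp
next
  case (3 x y q)
  obtain p1 where p1: "graph_path F x p1 y" "length p1 \<le> r + 1" using F[of x y] 3 by auto
  obtain p2 where p2: "p2 \<noteq> []" "hd p2 = y" "last p2 = last (y # q)"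
    "successively (\<lambda>a b. {a, b} \<in> F) p2" "length p2 \<le> r * length q + 1" using 3 by auto
  obtain p2' where p2': "p2 = y # p2'" using p2 by (cases p2) auto
  \<comment> \<open>The vertex \<open>y\<close> ends \<open>p1\<close> and starts \<open>p2\<close>;
    using \<open>p2'\<close> lists it only once.\<close>
  have "successively (\<lambda>a b. {a, b} \<in> F) (p1 @ p2')"
    using p1 p2(4) unfolding p2' graph_path_def
    by (auto simp: successively_append_iff successively_Cons)
  moreover have "hd (p1 @ p2') = x" "p1 @ p2' \<noteq> []" using p1(1) by (auto simp: graph_path_def)
  moreover have "last (p1 @ p2') = last (y # q)"
    using p1(1) p2(3) unfolding p2' by (auto simp: graph_path_def last_append)
  moreover have "length (p1 @ p2') \<le> r * (length (x # y # q) - 1) + 1"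
    using p1(2) p2(5) unfolding p2' by simp
  ultimately show ?case by (intro exI[of _ "p1 @ p2'"]) simp
qed simp

text \<open>Stretch need only be checked on edges: detours strung together along a shortest path of
  \<open>E\<close> multiply its length by at most \<open>r\<close>.\<close>

lemma unit_spanner_iff:
  assumes V: "connected_graph V E" "\<Union>E \<subseteq> V" and l: "\<And>e. e \<in> E \<Longrightarrow> l e = 1"
    and loopfree: "\<And>u. {u} \<notin> E" and F: "F \<subseteq> E"
  shows "is_spanner V E l (of_nat r) F \<longleftrightarrow>
    (\<forall>u v. {u, v} \<in> E \<longrightarrow> (\<exists>p. graph_path F u p v \<and> length p \<le> r + 1))"
proof (intro iffI allI impI)
  fix u v assume sp: "is_spanner V E l (of_nat r) F" and uv: "{u, v} \<in> E"
  then have "u \<noteq> v" using loopfree[of u] by auto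
  then have "graph_path E u [u, v] v" using uv by (auto simp: graph_path_def)
  from graph_dist_le[OF this, of l] have "graph_dist E l u v \<le> 1"
    using l[OF uv] by (simp add: path_length_def one_ereal_def)
  then have "ereal (real r) * graph_dist E l u v \<le> ereal (real r) * 1"
    by (rule ereal_mult_left_mono) simp
  moreover have "u \<in> V" "v \<in> V" using uv V(2) by auto
  then have "graph_dist F l u v \<le> ereal (real r) * graph_dist E l u v"
    using sp by (simp add: is_spanner_def)
  ultimately have "graph_dist F l u v \<le> ereal (real r)" by (simp add: order_trans)
  \<comment> \<open>A path can be extracted from the infimum only below a strict bound. Since
    lengths are integers, less than \<open>r + 1\<close> is the same as at most
    \<open>r\<close>.\<close>
  then have "graph_dist F l u v < ereal (real (r + 1))" by (rule le_less_trans) simp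
  then obtain p where p: "graph_path F u p v" "path_length l p < r + 1"
    by (rule graph_dist_lessE) simp
  moreover have "path_length l p = length p - 1"
    using p(1) F l by (intro path_length_unit[where E = F]) (auto simp: graph_path_def)
  ultimately show "\<exists>p. graph_path F u p v \<and> length p \<le> r + 1" by (intro exI[of _ p]) auto
next
  assume *: "\<forall>u v. {u, v} \<in> E \<longrightarrow> (\<exists>p. graph_path F u p v \<and> length p \<le> r + 1)"
  have "graph_dist F l u v \<le> ereal (real r) * graph_dist E l u v" if uv: "u \<in> V" "v \<in> V" for u v
  proof -
    obtain q0 where "graph_path E u q0 v" using V uv unfolding connected_graph_def by blast
    from graph_dist_attained[OF this, of l] obtain q where q: "graph_path E u q v"
      "graph_dist E l u v = ereal (real (path_length l q))" .
    have lq: "path_length l q = length q - 1"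
      using q(1) l by (intro path_length_unit[where E = E]) (auto simp: graph_path_def)
    obtain p0 where p0: "p0 \<noteq> []" "hd p0 = hd q" "last p0 = last q"
      "successively (\<lambda>a b. {a, b} \<in> F) p0" "length p0 \<le> r * (length q - 1) + 1"
      using replace_edges_by_walks[of E F r q] * q(1) unfolding graph_path_def by blast
    obtain p where p: "graph_path F u p v" "length p \<le> length p0"
      using walk_to_path[OF p0(1,4)] p0(2,3) q(1) unfolding graph_path_def by metis
    have "path_length l p = length p - 1"
      using p(1) F l by (intro path_length_unit[where E = F]) (auto simp: graph_path_def)
    then have "path_length l p \<le> r * path_length l q" using p(2) p0(5) lq by simp
    then have "real (path_length l p) \<le> real r * real (path_length l q)"
      by (metis of_nat_le_iff of_nat_mult)
    then show ?thesis using graph_dist_le[OF p(1), of l] q(2) by (simp add: order_trans)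
  qed
  then show "is_spanner V E l (of_nat r) F" using F by (auto simp: is_spanner_def)
qed

section \<open>The spanner gadget for hitting set\<close>

locale hitting_gadget =
  fixes p a x y :: 'v and EL ST :: "'v set" and M :: "'v \<Rightarrow> 'v \<Rightarrow> bool" and K :: nat
    and V :: "'v set" and E E0 E1 E2 :: "'v set set" and w l :: "'v set \<Rightarrow> nat"
  assumes fin: "finite EL" "finite ST"
    and dist: "distinct [p, a, x, y]" "{p, a, x, y} \<inter> EL = {}" "{p, a, x, y} \<inter> ST = {}" "EL \<inter> ST = {}"
    and V: "V = {p, a, x, y} \<union> EL \<union> ST"
    and E0: "E0 = {{p, a}, {x, a}, {x, y}} \<union> {{e, y} | e. e \<in> EL} \<union>
      {{e, c} | e c. e \<in> EL \<and> c \<in> ST \<and> M e c}"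
    and E1: "E1 = {{e, a} | e. e \<in> EL}" and E2: "E2 = {{p, c} | c. c \<in> ST}"
    and E: "E = E0 \<union> E1 \<union> E2"
    and w: "\<And>e. e \<in> E0 \<Longrightarrow> w e = 0" "\<And>e. e \<in> E1 \<Longrightarrow> w e = 1" "\<And>e. e \<in> E2 \<Longrightarrow> w e = K + 1"
    and l: "\<And>e. e \<in> E \<Longrightarrow> l e = 1"
begin

lemma finite_V: "finite V"
  by (simp add: V fin)

lemma edge_sides: "e \<in> E \<Longrightarrow> \<exists>u \<in> {p, x} \<union> EL. \<exists>v \<in> {a, y} \<union> ST. e = {u, v}"
proof -
  assume "e \<in> E"
  then consider "e = {p, a}" | "e = {x, a}" | "e = {x, y}" | u where "e = {u, y}" "u \<in> EL"
    | u where "e = {u, a}" "u \<in> EL" | u v where "e = {u, v}" "u \<in> EL" "v \<in> ST"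
    | v where "e = {p, v}" "v \<in> ST"
    unfolding E E0 E1 E2 by auto
  then show ?thesis by cases blast+
qed

lemma sides: "({p, x} \<union> EL) \<union> ({a, y} \<union> ST) = V" "({p, x} \<union> EL) \<inter> ({a, y} \<union> ST) = {}"
  using dist by (auto simp: V)

lemma simple: "simple_graph V E"
  unfolding simple_graph_def
proof (intro conjI finite_V subsetI)
  fix e assume "e \<in> E"
  then obtain u v where uv: "u \<in> {p, x} \<union> EL" "v \<in> {a, y} \<union> ST" "e = {u, v}"
    using edge_sides by blast
  moreover have "u \<noteq> v" using uv(1,2) sides(2) by blast
  moreover have "u \<in> V" "v \<in> V" using uv(1,2) sides(1) by blast+
  ultimately show "e \<in> {{u, v} | u v. u \<in> V \<and> v \<in> V \<and> u \<noteq> v}" by blast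
qed (simp add: V)

lemma finite_E: "finite E"
proof -
  have "E \<subseteq> Pow V" using simple unfolding simple_graph_def by auto
  then show ?thesis using finite_V by (meson finite_Pow_iff finite_subset)
qed

lemma bipartite: "bipartite_graph V E"
  unfolding bipartite_graph_def by (intro exI conjI ballI) (rule sides edge_sides, assumption?)+

lemma walk_to_a: "v \<in> V \<Longrightarrow> \<exists>q. q \<noteq> [] \<and> hd q = v \<and> last q = a \<and> successively (\<lambda>a b. {a, b} \<in> E) q"
proof -
  assume "v \<in> V"
  then consider "v = a" | "v = p" | "v = x" | "v = y" | "v \<in> EL" | "v \<in> ST" unfolding V by auto
  then show ?thesis
  proof cases
    case 1
    then show ?thesis by (intro exI[of _ "[a]"]) simp
  next
    case 4
    then show ?thesis by (intro exI[of _ "[y, x, a]"]) (auto simp: E E0 insert_commute)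
  next
    case 6
    then show ?thesis by (intro exI[of _ "[v, p, a]"]) (auto simp: E E0 E2 insert_commute)
  qed (intro exI[of _ "[v, a]"], auto simp: E E0 E1 insert_commute)+
qed

lemma connected: "connected_graph V E"
  unfolding connected_graph_def
proof (intro ballI)
  fix u v assume "u \<in> V" "v \<in> V"
  then obtain q r where q: "q \<noteq> []" "hd q = u" "last q = a" "successively (\<lambda>a b. {a, b} \<in> E) q"
    and r: "r \<noteq> []" "hd r = v" "last r = a" "successively (\<lambda>a b. {a, b} \<in> E) r"
    using walk_to_a by meson
  \<comment> \<open>Both walks end in \<open>a\<close>; reversing the second one and dropping its
    first vertex joins them there.\<close>
  let ?w = "q @ tl (rev r)"
  have "successively (\<lambda>a b. {a, b} \<in> E) (rev r)" using r(4) by (simp add: insert_commute)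
  moreover have hd: "hd (rev r) = a" using r by (simp add: hd_rev)
  ultimately have "successively (\<lambda>a b. {a, b} \<in> E) ?w" using q r
    by (cases "rev r") (auto simp: successively_append_iff successively_Cons)
  moreover have "?w \<noteq> []" "hd ?w = u" using q by auto
  moreover have "last ?w = v"
    using r hd q(3) by (cases "rev r") (auto simp: last_append last_rev[of r, symmetric] split: if_splits)
  ultimately show "\<exists>p. graph_path E u p v"
    using walk_to_path[of ?w] unfolding graph_path_def by metis
qed

lemma instance_ok: "1 \<le> \<alpha> \<Longrightarrow> spanner_instance V E w l \<alpha>"
  using simple connected l by (simp add: spanner_instance_def)

lemma weights: "card (w ` E) \<le> 3"
proof -
  have "w ` E \<subseteq> {0, 1, K + 1}" using w by (auto simp: E)
  then show ?thesis by (rule order_trans[OF card_mono[rotated]]) (auto simp: card_insert_if)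
qed

lemma loopfree: "{u} \<notin> E"
  using simple unfolding simple_graph_def by (auto simp: doubleton_eq_iff)

lemma spanner_iff:
  assumes "F \<subseteq> E"
  shows "is_spanner V E l 3 F \<longleftrightarrow>
    (\<forall>u v. {u, v} \<in> E \<longrightarrow> (\<exists>p. graph_path F u p v \<and> length p \<le> 4))"
proof -
  have "\<Union> E \<subseteq> V" using simple by (auto simp: simple_graph_def)
  then show ?thesis
    using unit_spanner_iff[where V = V and E = E and F = F and l = l and r = 3]
      connected l loopfree assms by simp
qed

lemma w_unit: "e \<in> EL \<Longrightarrow> w {e, a} = 1"
  by (rule w(2)) (auto simp: E1)

text \<open>A spanner within the budget has no heavy edge, so in it \<open>p\<close> has no
  neighbour but \<open>a\<close>, and \<open>c\<close> only has neighbours that hit it. A detour for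
  \<open>{p, c}\<close> with at most four vertices is therefore \<open>p, a, e, c\<close>, and the
  kept edges at \<open>a\<close> give a hitting set. Conversely, the free edges and the edges from
  \<open>a\<close> to \<open>H\<close> suffice, as each \<open>{e, a}\<close> has the detour through
  \<open>x\<close> and \<open>y\<close>.\<close>

lemma hitting_iff:
  "(\<exists>F. is_spanner V E l 3 F \<and> (\<Sum>e \<in> F. w e) \<le> K) \<longleftrightarrow>
   (\<exists>H \<subseteq> EL. card H \<le> K \<and> (\<forall>c \<in> ST. \<exists>e \<in> H. M e c))"
proof
  assume "\<exists>F. is_spanner V E l 3 F \<and> (\<Sum>e \<in> F. w e) \<le> K"
  then obtain F where F: "is_spanner V E l 3 F" "(\<Sum>e \<in> F. w e) \<le> K" by blast
  have FE: "F \<subseteq> E" using F(1) by (simp add: is_spanner_def)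
  have finF: "finite F" using FE finite_E by (rule finite_subset)
  \<comment> \<open>A single edge of weight \<open>K + 1\<close> exceeds the budget.\<close>
  have noheavy: "e \<notin> E2" if "e \<in> F" for e
    using member_le_sum[of e F w] that finF F(2) w(3)[of e] by auto
  have light: "e \<in> E0 \<or> e \<in> E1" if "e \<in> F" for e
    using that FE noheavy[OF that] by (auto simp: E)
  let ?H = "{e \<in> EL. {e, a} \<in> F}"
  have "\<exists>e \<in> ?H. M e c" if c: "c \<in> ST" for c
  proof -
    have "{p, c} \<in> E" using c by (auto simp: E E2)
    then obtain q where q: "graph_path F p q c" "length q \<le> 4"
      using F(1) unfolding spanner_iff[OF FE] by blast
    have pz: "z = a" if "{p, z} \<in> F" for z
      using light[OF that] dist by (auto simp: E0 E1 doubleton_eq_iff)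
    have zc: "z \<in> EL \<and> M z c" if "{z, c} \<in> F" for z
      using light[OF that] dist c by (auto simp: E0 E1 doubleton_eq_iff)
    have q': "q \<noteq> []" "hd q = p" "last q = c" "distinct q" "successively (\<lambda>a b. {a, b} \<in> F) q"
      using q(1) by (auto simp: graph_path_def)
    have "p \<noteq> c" "a \<noteq> c" "a \<notin> EL" "p \<notin> EL" using c dist by auto
    consider q1 where "q = [q1]" | q1 q2 where "q = [q1, q2]" | q1 q2 q3 where "q = [q1, q2, q3]"
      | q1 q2 q3 q4 where "q = [q1, q2, q3, q4]"
      using q(2) q'(1) by (auto simp: length_Suc_conv le_Suc_eq numeral_eq_Suc)
    then show ?thesis
    proof cases
      case (4 q1 q2 q3 q4)
      then have "q2 = a" "q3 \<in> EL" "M q3 c" "{q2, q3} \<in> F" using q' pz[of q2] zc[of q3] by auto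
      then show ?thesis by (auto simp: insert_commute)
    next
      case (3 q1 q2 q3)
      then show ?thesis using q' pz[of q2] zc[of q2] \<open>a \<notin> EL\<close> by auto
    next
      case (2 q1 q2)
      then show ?thesis using q' zc[of p] \<open>p \<notin> EL\<close> by auto
    next
      case (1 q1)
      then show ?thesis using q' \<open>p \<noteq> c\<close> by auto
    qed
  qed
  moreover have "card ?H \<le> K"
  proof -
    have inj: "inj_on (\<lambda>e. {e, a}) ?H" by (auto simp: inj_on_def doubleton_eq_iff)
    have "card ?H = (\<Sum>e \<in> (\<lambda>e. {e, a}) ` ?H. 1)" by (simp add: card_image[OF inj])
    also have "\<dots> = (\<Sum>e \<in> (\<lambda>e. {e, a}) ` ?H. w e)"
      by (rule sum.cong) (auto simp: w_unit)
    also have "\<dots> \<le> (\<Sum>e \<in> F. w e)" by (rule sum_mono2) (use finF in auto)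
    finally show ?thesis using F(2) by simp
  qed
  ultimately show "\<exists>H \<subseteq> EL. card H \<le> K \<and> (\<forall>c \<in> ST. \<exists>e \<in> H. M e c)"
    by (intro exI[of _ ?H]) auto
next
  assume "\<exists>H \<subseteq> EL. card H \<le> K \<and> (\<forall>c \<in> ST. \<exists>e \<in> H. M e c)"
  then obtain H where H: "H \<subseteq> EL" "card H \<le> K" "\<And>c. c \<in> ST \<Longrightarrow> \<exists>e \<in> H. M e c" by blast
  have finH: "finite H" using H(1) fin(1) by (rule finite_subset)
  let ?F1 = "(\<lambda>e. {e, a}) ` H"
  let ?F = "E0 \<union> ?F1"
  have FE: "?F \<subseteq> E" using H(1) by (auto simp: E E1)
  then have finF: "finite ?F" using finite_E by (rule finite_subset)
  have "(\<Sum>e \<in> ?F. w e) \<le> (\<Sum>e \<in> E0. w e) + (\<Sum>e \<in> ?F1. w e)"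
    using finF by (subst sum.union_inter[symmetric]) auto
  also have "(\<Sum>e \<in> E0. w e) = 0" by (simp add: w(1))
  also have "(\<Sum>e \<in> ?F1. w e) = (\<Sum>e \<in> ?F1. 1)"
    by (rule sum.cong) (use H(1) in \<open>auto simp: w_unit\<close>)
  also have "(\<Sum>e \<in> ?F1. 1) \<le> K" using card_image_le[OF finH, of "\<lambda>e. {e, a}"] H(2) by simp
  finally have wF: "(\<Sum>e \<in> ?F. w e) \<le> K" by simp
  have path: "\<exists>q. graph_path ?F u q v \<and> length q \<le> 4" if uv: "{u, v} \<in> E" for u v
  proof -
    have sym: "\<exists>q. graph_path ?F v q u \<and> length q \<le> 4"
      if ex: "\<exists>q. graph_path ?F u q v \<and> length q \<le> 4" for u v
    proof -
      obtain q where "graph_path ?F u q v" "length q \<le> 4" using ex by blast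
      then show ?thesis
        by (intro exI[of _ "rev q"]) (auto simp: graph_path_def hd_rev last_rev insert_commute)
    qed
    have uv_neq: "u \<noteq> v" using uv loopfree[of u] by auto
    consider "{u, v} \<in> E0" | "{u, v} \<in> E1" | "{u, v} \<in> E2"
      using uv by (auto simp: E)
    then show ?thesis
    proof cases
      case 1
      then show ?thesis using uv_neq by (intro exI[of _ "[u, v]"]) (simp add: graph_path_def)
    next
      case 2
      then obtain e where e: "{u, v} = {e, a}" "e \<in> EL" by (auto simp: E1)
      have "\<exists>q. graph_path ?F a q e \<and> length q \<le> 4"
        using e(2) dist by (intro exI[of _ "[a, x, y, e]"]) (auto simp: graph_path_def E0 insert_commute)
      then show ?thesis using e(1) sym by (auto simp: doubleton_eq_iff)
    next
      case 3
      then obtain c where c: "{u, v} = {p, c}" "c \<in> ST" by (auto simp: E2)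
      obtain e where "e \<in> H" "M e c" using H(3) c(2) by blast
      then have "{p, a} \<in> E0" "{a, e} \<in> ?F1" "{e, c} \<in> E0" "e \<in> EL"
        using c(2) H(1) by (auto simp: E0 insert_commute)
      then have "\<exists>q. graph_path ?F p q c \<and> length q \<le> 4"
        using c(2) dist by (intro exI[of _ "[p, a, e, c]"]) (auto simp: graph_path_def)
      then show ?thesis using c(1) sym by (auto simp: doubleton_eq_iff)
    qed
  qed
  then show "\<exists>F. is_spanner V E l 3 F \<and> (\<Sum>e \<in> F. w e) \<le> K"
    using wF spanner_iff[OF FE] by blast
qed

end

section \<open>Hitting sets from weighted Fagin definability\<close>

lemma ptl_trans: "a \<in> set (ptl b) \<Longrightarrow> b \<in> set (ptl c) \<Longrightarrow> a \<in> set (ptl c)"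
  by (induction c) auto

lemma ptl_length: "a \<in> set (ptl b) \<Longrightarrow> length (ls a) < length (ls b)"
  by (induction b) auto

lemma ptl_ls: "a \<in> set (ptl b) \<Longrightarrow> set (ls a) \<subseteq> set (ls (ttl b))"
proof (induction b)
  case (Node b1 b2)
  then show ?case by (cases b2) auto
qed simp

lemma ptl_distinct: "a \<in> set (ptl b) \<Longrightarrow> distinct (ls b) \<Longrightarrow> distinct (ls a)"
  by (induction b) auto

lemma ptl_enc_unary: "ptl (enc_unary n) = map enc_unary (rev [0..<n])"
  by (induction n) auto

lemma enc_unary_inject [simp]: "enc_unary i = enc_unary j \<longleftrightarrow> i = j"
proof (induction i arbitrary: j)
  case 0
  show ?case by (cases j) auto
next
  case (Suc i)
  then show ?case by (cases j) auto
qed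

lemma enc_unary_in_ptl [simp]: "enc_unary i \<in> set (ptl (enc_unary j)) \<longleftrightarrow> i < j"
  by (auto simp: ptl_enc_unary)

lemma length_ls_enc_unary [simp]: "length (ls (enc_unary n)) = n"
  by (induction n) auto

lemma enc_nat_inject [simp]: "enc_nat m = enc_nat n \<longleftrightarrow> m = n"
proof
  show "enc_nat m = enc_nat n \<Longrightarrow> m = n"
  proof (induction m arbitrary: n rule: less_induct)
    case (less m)
    show ?case
    proof (cases "m = 0")
      case True
      then show ?thesis using less.prems by (simp add: enc_nat.simps[of n] split: if_splits)
    next
      case False
      then have n: "n \<noteq> 0" using less.prems by (cases "n = 0") (simp_all add: enc_nat.simps[of m])
      have "enc_bool (odd m) = enc_bool (odd n)" "enc_nat (m div 2) = enc_nat (n div 2)"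
        using less.prems False n by (auto simp: enc_nat.simps[of m] enc_nat.simps[of n])
      then have "odd m = odd n" "m div 2 = n div 2"
        using less.IH[of "m div 2" "n div 2"] False by (auto simp: enc_bool_def split: if_splits)
      then show ?thesis by presburger
    qed
  qed
qed simp

text \<open>Here \<open>z\<close> is an instance paired with its unary parameter, and
  \<open>thd (thd z)\<close> is the size of the universe in unary. The smaller numerals are turned
  into binary because the tuples of the relations name elements in binary.\<close>

definition universe :: "tree \<Rightarrow> tree list" where
  "universe z = map (\<lambda>t. enc_nat (length (ls t))) (ptl (thd (thd z)))"

definition cands :: "nat \<Rightarrow> tree \<Rightarrow> tree list" where
  "cands s z = map mk (List.n_lists s (universe z))"

text \<open>Two entries are put in front of the parameter \<open>k\<close>, so that the numerals
  from 0 to \<open>k + 1\<close> result; 0 and \<open>k + 1\<close> are the ranks of the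
  sentinels.\<close>

definition ranks :: "tree \<Rightarrow> tree list" where
  "ranks z = ptl (Node Leaf (Node Leaf (ttl z)))"

text \<open>A place is a suffix of the candidate list and stands for its first candidate. The empty
  suffix and the full list with an additional head \<open>Leaf\<close> are no candidates and leave
  room for the sentinels.\<close>

definition places :: "nat \<Rightarrow> tree \<Rightarrow> tree list" where
  "places s z = ptl (Node Leaf (Node Leaf (mk (cands s z))))"

definition entries :: "nat \<Rightarrow> tree \<Rightarrow> tree list" where
  "entries s z = concat (map (\<lambda>j. map (\<lambda>b. Node j b) (places s z)) (ranks z))"

definition guesses :: "nat \<Rightarrow> nat \<Rightarrow> tree \<Rightarrow> tree list" where
  "guesses s m z = map mk (List.n_lists m (entries s z))"

definition slot :: "tree \<Rightarrow> tree" where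
  "slot e = mk (map thd (ls e))"

definition slots :: "nat \<Rightarrow> tree \<Rightarrow> tree list" where
  "slots m z = map mk (List.n_lists m (ranks z))"

definition vals :: "nat \<Rightarrow> tree \<Rightarrow> tree list" where
  "vals M z = map mk (List.n_lists M (universe z))"

text \<open>The entries of both guesses may come from one increasing function. Only smaller ranks in
  \<open>e\<close> are compared with larger ones in \<open>e'\<close>; the other direction is
  \<open>compatible e' e\<close>.\<close>

definition compatible :: "tree \<Rightarrow> tree \<Rightarrow> bool" where
  "compatible e e' \<longleftrightarrow> (\<forall>p \<in> set (ls e). \<forall>q \<in> set (ls e').
     (thd p \<in> set (ptl (thd q)) \<longrightarrow> ttl p \<in> set (ptl (ttl q))) \<and> (thd p = thd q \<longrightarrow> ttl p = ttl q))"

text \<open>The excluded ranks 0 and \<open>k + 1\<close> are those of the sentinels, whose places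
  do not select a tuple.\<close>

definition inX :: "tree \<Rightarrow> tree \<Rightarrow> tree \<Rightarrow> bool" where
  "inX z c e \<longleftrightarrow> (\<exists>p \<in> set (ls e). thd p \<noteq> Leaf \<and> thd p \<noteq> Node Leaf (ttl z) \<and> thd (ttl p) = c)"

text \<open>The entries \<open>p\<close> and \<open>q\<close> have consecutive ranks. As places are
  suffixes of a list without repetitions, \<open>c\<close> lies strictly between them iff it occurs
  in the tail of the longer suffix but not in the shorter one.\<close>

definition outX :: "tree \<Rightarrow> tree \<Rightarrow> bool" where
  "outX c e \<longleftrightarrow> (\<exists>p \<in> set (ls e). \<exists>q \<in> set (ls e). thd q = Node Leaf (thd p) \<and>
     c \<in> set (ls (ttl (ttl q))) \<and> c \<notin> set (ls (ttl p)))"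

section \<open>Hitting sets of guesses correspond to enumerations\<close>

lemma ranks_eq: "ranks (Node x (enc_unary k)) = map enc_unary (rev [0..<k + 2])"
  by (simp add: ranks_def ptl_enc_unary)

lemma set_ranks: "set (ranks (Node x (enc_unary k))) = enc_unary ` {..k + 1}"
proof -
  have "{0..<k + 2} = {..k + 1}" by auto
  then show ?thesis by (simp only: ranks_eq set_map set_rev set_upt)
qed

lemma distinct_ranks: "distinct (ranks (Node x (enc_unary k)))"
  unfolding ranks_eq distinct_map by (simp add: inj_on_def del: upt_Suc)

lemma length_ranks: "length (ranks (Node x (enc_unary k))) = k + 2"
  by (simp add: ranks_eq)

lemma length_slots: "length (slots m (Node x (enc_unary k))) = (k + 2) ^ m"
  by (simp add: slots_def length_n_lists length_ranks)

lemma distinct_slots: "distinct (slots m (Node x (enc_unary k)))"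
  by (simp add: slots_def distinct_map inj_on_def distinct_n_lists distinct_ranks)

lemma mem_slots: "mk l \<in> set (slots m z) \<longleftrightarrow> length l = m \<and> set l \<subseteq> set (ranks z)"
  by (auto simp: slots_def set_n_lists image_iff)

lemma mem_guesses: "mk l \<in> set (guesses s m z) \<longleftrightarrow> length l = m \<and> set l \<subseteq> set (entries s z)"
  by (auto simp: guesses_def set_n_lists image_iff)

lemma set_entries: "set (entries s z) = {Node j b | j b. j \<in> set (ranks z) \<and> b \<in> set (places s z)}"
  by (auto simp: entries_def)

text \<open>An enumeration lists the chosen positions in increasing order; a position is the suffix of the
  list of candidates starting there, so that a shorter suffix is an earlier position.\<close>

definition enumeration :: "nat \<Rightarrow> tree list \<Rightarrow> (nat \<Rightarrow> tree) \<Rightarrow> bool" where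
  "enumeration k B f \<longleftrightarrow> (\<forall>j \<le> k + 1. f j \<in> set B) \<and> (\<forall>j \<le> k + 1. \<forall>i < j. f i \<in> set (ptl (f j)))"

definition chosen :: "nat \<Rightarrow> (nat \<Rightarrow> tree) \<Rightarrow> tree set" where
  "chosen k f = (\<lambda>j. thd (f j)) ` {1..k}"

definition agrees :: "nat \<Rightarrow> (nat \<Rightarrow> tree) \<Rightarrow> tree \<Rightarrow> bool" where
  "agrees k f e \<longleftrightarrow> (\<forall>p \<in> set (ls e). \<exists>j \<le> k + 1. p = Node (enc_unary j) (f j))"

text \<open>The budget forces exactly one guess per slot. The compatibility clauses then make any
  two guesses of \<open>H\<close> compatible, so that all their entries together form the graph of
  one increasing function on the ranks.\<close>

lemma hitting_set_enumeration:
  fixes x k s m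
  defines "z \<equiv> Node x (enc_unary k)"
  assumes m: "m \<ge> 1" and H: "H \<subseteq> set (guesses s m z)" "card H \<le> length (slots m z)"
    and hit_slot: "\<And>\<sigma>. \<sigma> \<in> set (slots m z) \<Longrightarrow> \<exists>e \<in> H. slot e = \<sigma>"
    and hit_compatible: "\<And>e \<sigma>. e \<in> set (guesses s m z) \<Longrightarrow> \<sigma> \<in> set (slots m z) \<Longrightarrow>
      \<exists>e' \<in> H. (slot e' = slot e \<and> e' \<noteq> e) \<or> (slot e' = \<sigma> \<and> compatible e e')"
  shows "\<exists>f. enumeration k (places s z) f \<and> (\<forall>e \<in> H. agrees k f e)"
proof -
  have finH: "finite H" using H(1) by (rule finite_subset) simp
  \<comment> \<open>All slots are met by at most as many guesses as there are slots, so
    \<open>slot\<close> is injective on \<open>H\<close>.\<close>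
  have "set (slots m z) \<subseteq> slot ` H" using hit_slot by fastforce
  then have "card (set (slots m z)) \<le> card (slot ` H)" using finH by (intro card_mono) auto
  then have "card H \<le> card (slot ` H)"
    using H(2) distinct_card[OF distinct_slots[of m x k]] by (simp add: z_def)
  then have inj: "inj_on slot H" using finH card_image_le[OF finH, of slot] by (intro eq_card_imp_inj_on) auto
  have slot_mem: "slot e \<in> set (slots m z)" if "e \<in> set (guesses s m z)" for e
  proof -
    from that obtain l where "e = mk l" by (metis mk_ls)
    with that show ?thesis by (auto simp: slot_def mem_slots mem_guesses set_entries)
  qed
  have compatible: "compatible e e'" if "e \<in> H" "e' \<in> H" for e e'
  proof -
    have "e \<in> set (guesses s m z)" "slot e' \<in> set (slots m z)" using that H(1) slot_mem by auto
    \<comment> \<open>This is the clause for \<open>e\<close> and the slot of \<open>e'\<close>. No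
      other guess in \<open>H\<close> shares the slot of \<open>e\<close>, so the clause is hit by
      the guess in the slot of \<open>e'\<close>, which is \<open>e'\<close> itself.\<close>
    from hit_compatible[OF this] obtain d where "d \<in> H" "slot d = slot e \<and> d \<noteq> e \<or> slot d = slot e' \<and> compatible e d"
      by blast
    then show ?thesis using inj that unfolding inj_on_def by metis
  qed
  define Q where "Q = (\<Union>e \<in> H. set (ls e))"
  have Q: "(thd p \<in> set (ptl (thd q)) \<longrightarrow> ttl p \<in> set (ptl (ttl q))) \<and> (thd p = thd q \<longrightarrow> ttl p = ttl q)"
    if "p \<in> Q" "q \<in> Q" for p q
    using that compatible unfolding Q_def compatible_def by blast
  have Q_entry: "p \<in> set (entries s z)" if p: "p \<in> Q" for p
  proof -
    obtain e where "e \<in> H" "p \<in> set (ls e)" using p by (auto simp: Q_def)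
    then show ?thesis using H(1) mem_guesses[of "ls e" s m z] by auto
  qed
  have "\<exists>b. Node (enc_unary j) b \<in> Q" if j: "j \<le> k + 1" for j
  proof -
    \<comment> \<open>The constant slot, nonempty as \<open>m \<ge> 1\<close>, makes the rank
      \<open>j\<close> occur in some entry.\<close>
    have "mk (replicate m (enc_unary j)) \<in> set (slots m z)"
      using j by (auto simp: mem_slots z_def set_ranks)
    then obtain e where e: "e \<in> H" "slot e = mk (replicate m (enc_unary j))" using hit_slot by blast
    then have *: "map thd (ls e) = replicate m (enc_unary j)" by (simp add: slot_def)
    with m obtain p where p: "p \<in> set (ls e)" by (cases "ls e") auto
    then have "thd p = enc_unary j" using * by (metis imageI in_set_replicate list.set_map)
    moreover have "p \<in> Q" using p e(1) by (auto simp: Q_def)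
    ultimately show ?thesis using Q_entry[of p] by (auto simp: set_entries)
  qed
  then obtain f where f: "\<And>j. j \<le> k + 1 \<Longrightarrow> Node (enc_unary j) (f j) \<in> Q" by metis
  have "enumeration k (places s z) f"
    unfolding enumeration_def
  proof (intro conjI allI impI)
    fix j assume j: "j \<le> k + 1"
    show "f j \<in> set (places s z)" using Q_entry[OF f[OF j]] by (simp add: set_entries)
    fix i assume "i < j"
    then show "f i \<in> set (ptl (f j))" using Q[OF f[of i] f[of j]] j by simp
  qed
  moreover have "agrees k f e" if e: "e \<in> H" for e
    unfolding agrees_def
  proof
    fix p assume p: "p \<in> set (ls e)"
    then have pQ: "p \<in> Q" using e by (auto simp: Q_def)
    from Q_entry[OF this] obtain j b where j: "p = Node (enc_unary j) b" "j \<le> k + 1"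
      by (auto simp: set_entries z_def set_ranks)
    then show "\<exists>j \<le> k + 1. p = Node (enc_unary j) (f j)" using Q[OF pQ f[OF j(2)]] by auto
  qed
  ultimately show ?thesis by blast
qed

text \<open>The guess that \<open>f\<close> itself makes in the slot \<open>l\<close>;
  \<open>length (ls j)\<close> decodes the numeral \<open>j\<close>.\<close>

definition guess_of :: "(nat \<Rightarrow> tree) \<Rightarrow> tree list \<Rightarrow> tree" where
  "guess_of f l = mk (map (\<lambda>j. Node j (f (length (ls j)))) l)"

lemma slot_guess_of [simp]: "slot (guess_of f l) = mk l"
  by (simp add: slot_def guess_of_def comp_def)

text \<open>One guess of \<open>f\<close> is taken per slot. A compatibility clause for
  \<open>e\<close> is hit by the guess of \<open>f\<close> in the slot of \<open>e\<close> if that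
  differs from \<open>e\<close>; otherwise \<open>e\<close> is a guess of \<open>f\<close> and
  compatible with the one in the slot \<open>\<sigma>\<close>.\<close>

lemma enumeration_hitting_set:
  fixes x k s m
  defines "z \<equiv> Node x (enc_unary k)"
  defines "L \<equiv> {l. length l = m \<and> set l \<subseteq> set (ranks z)}"
  assumes f: "enumeration k (places s z) f"
  shows "guess_of f ` L \<subseteq> set (guesses s m z)" "card (guess_of f ` L) \<le> length (slots m z)"
    and "\<And>\<sigma>. \<sigma> \<in> set (slots m z) \<Longrightarrow> \<exists>e \<in> guess_of f ` L. slot e = \<sigma>"
    and "\<And>e \<sigma>. e \<in> set (guesses s m z) \<Longrightarrow> \<sigma> \<in> set (slots m z) \<Longrightarrow>
      \<exists>e' \<in> guess_of f ` L. (slot e' = slot e \<and> e' \<noteq> e) \<or> (slot e' = \<sigma> \<and> compatible e e')"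
proof -
  have L: "L = set (List.n_lists m (ranks z))" by (auto simp: L_def set_n_lists)
  have slots: "\<sigma> \<in> set (slots m z) \<longleftrightarrow> (\<exists>l \<in> L. \<sigma> = mk l)" for \<sigma>
    by (auto simp: slots_def L)
  show "guess_of f ` L \<subseteq> set (guesses s m z)"
  proof
    fix e assume "e \<in> guess_of f ` L"
    then obtain l where l: "e = guess_of f l" "length l = m" "set l \<subseteq> enc_unary ` {..k + 1}"
      by (auto simp: L_def z_def set_ranks)
    have "Node j (f (length (ls j))) \<in> set (entries s z)" if jl: "j \<in> set l" for j
    proof -
      obtain i where i: "j = enc_unary i" "i \<le> k + 1" using subsetD[OF l(3) jl] by auto
      then have "f i \<in> set (places s z)" using f by (simp add: enumeration_def)
      then show ?thesis using i by (auto simp: set_entries z_def set_ranks)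
    qed
    then show "e \<in> set (guesses s m z)" using l(2) unfolding l(1) guess_of_def mem_guesses by auto
  qed
  have "card (guess_of f ` L) \<le> card L" unfolding L by (rule card_image_le) simp
  also have "\<dots> \<le> length (slots m z)" unfolding L slots_def by (simp add: card_length)
  finally show "card (guess_of f ` L) \<le> length (slots m z)" .
  show slot: "\<exists>e \<in> guess_of f ` L. slot e = \<sigma>" if "\<sigma> \<in> set (slots m z)" for \<sigma>
    using that by (auto simp: slots)
  have compatible: "compatible (guess_of f l) (guess_of f l')" if ll: "l \<in> L" "l' \<in> L" for l l'
    unfolding compatible_def
  proof (intro ballI)
    fix p q assume "p \<in> set (ls (guess_of f l))" "q \<in> set (ls (guess_of f l'))"
    then obtain i j where "p = Node (enc_unary i) (f i)" "q = Node (enc_unary j) (f j)" "j \<le> k + 1"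
      using ll by (force simp: guess_of_def L_def z_def set_ranks)
    then show "(thd p \<in> set (ptl (thd q)) \<longrightarrow> ttl p \<in> set (ptl (ttl q))) \<and> (thd p = thd q \<longrightarrow> ttl p = ttl q)"
      using f by (simp add: enumeration_def)
  qed
  show "\<exists>e' \<in> guess_of f ` L. (slot e' = slot e \<and> e' \<noteq> e) \<or> (slot e' = \<sigma> \<and> compatible e e')"
    if e: "e \<in> set (guesses s m z)" and \<sigma>: "\<sigma> \<in> set (slots m z)" for e \<sigma>
  proof -
    have "ls (slot e) \<in> L"
      using e mem_guesses[of "ls e" s m z] by (auto simp: L_def slot_def set_entries)
    moreover obtain l where "l \<in> L" "\<sigma> = mk l" using \<sigma> by (auto simp: slots)
    ultimately show ?thesis using compatible[of "ls (slot e)" l] slot_guess_of[of f "ls (slot e)"]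
      slot_guess_of[of f l] by (metis imageI mk_ls)
  qed
qed

section \<open>Chosen tuples and the gaps between them\<close>

locale enumeration_locale =
  fixes k :: nat and U :: "tree list" and f :: "nat \<Rightarrow> tree"
  assumes U: "distinct U" "Leaf \<notin> set U"
    and f: "enumeration k (ptl (Node Leaf (Node Leaf (mk U)))) f"
begin

lemma f_mono: "i < j \<Longrightarrow> j \<le> k + 1 \<Longrightarrow> f i \<in> set (ptl (f j))"
  using f by (simp add: enumeration_def)

lemma distinct_f: "j \<le> k + 1 \<Longrightarrow> distinct (ls (f j))"
  using f ptl_distinct[of "f j" "Node Leaf (mk U)"] U by (auto simp: enumeration_def)

text \<open>The place \<open>f 0\<close> is strictly shorter, so \<open>f j\<close> is not empty;
  \<open>f (k + 1)\<close> is strictly longer, so \<open>f j\<close> cannot be the place with the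
  additional head. This is what the sentinels are for.\<close>

lemma f_inner:
  assumes "1 \<le> j" "j \<le> k"
  shows "\<exists>c t. f j = Node c t \<and> c \<in> set U"
proof -
  have "f 0 \<in> set (ptl (f j))" using assms by (intro f_mono) auto
  then obtain c t where ct: "f j = Node c t" by (cases "f j") auto
  have "f (k + 1) \<in> set (Node Leaf (mk U) # ptl (Node Leaf (mk U)))"
    using f by (auto simp: enumeration_def)
  moreover have "f j \<in> set (ptl (f (k + 1)))" using assms by (intro f_mono) auto
  ultimately have "f j \<in> set (ptl (Node Leaf (mk U)))" using ptl_trans by auto
  from ptl_ls[OF this] show ?thesis using ct by auto
qed

lemma f_less_notin:
  assumes "i < j" "j \<le> k + 1" "f j = Node c t"
  shows "c \<notin> set (ls (f i))"
  using ptl_ls[OF f_mono[OF assms(1,2)]] distinct_f[OF assms(2)] assms(3) by auto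

lemma card_chosen: "card (chosen k f) = k"
proof -
  have "inj_on (\<lambda>j. thd (f j)) {1..k}"
  proof (rule linorder_inj_onI')
    fix i j assume ij: "i \<in> {1..k}" "j \<in> {1..k}" "i < j"
    obtain c t d u where c: "f i = Node c t" "f j = Node d u" using f_inner[of i] f_inner[of j] ij by auto
    then show "thd (f i) \<noteq> thd (f j)" using f_less_notin[of i j d u] ij by auto
  qed
  then show ?thesis by (simp add: chosen_def card_image)
qed

lemma chosen_subset: "chosen k f \<subseteq> set U"
  using f_inner by (fastforce simp: chosen_def)

lemma inX_sound:
  assumes "agrees k f e" "inX (Node x (enc_unary k)) c e"
  shows "c \<in> chosen k f"
proof -
  obtain p where "p \<in> set (ls e)" "thd p \<noteq> Leaf" "thd p \<noteq> Node Leaf (enc_unary k)" "thd (ttl p) = c"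
    using assms(2) by (auto simp: inX_def)
  moreover from this obtain j where "j \<le> k + 1" "p = Node (enc_unary j) (f j)"
    using assms(1) by (auto simp: agrees_def)
  moreover from calculation have "j \<noteq> 0" "j \<noteq> k + 1" by (cases j; auto)+
  ultimately show ?thesis by (auto simp: chosen_def)
qed

text \<open>Suppose \<open>c\<close> is the head of \<open>f j\<close>. For \<open>j \<le> i\<close>
  it would occur in the suffix \<open>f i\<close>; for \<open>j = Suc i\<close> it would occur twice
  in \<open>f j\<close>; and for larger \<open>j\<close> it could not occur in the shorter suffix
  \<open>f (Suc i)\<close>.\<close>

lemma outX_sound:
  assumes "agrees k f e" "outX c e"
  shows "c \<notin> chosen k f"
proof
  assume "c \<in> chosen k f"
  then obtain j where j: "1 \<le> j" "j \<le> k" "c = thd (f j)" by (auto simp: chosen_def)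
  obtain t where t: "f j = Node c t" using f_inner[OF j(1,2)] j(3) by auto
  obtain p q where pq: "p \<in> set (ls e)" "q \<in> set (ls e)" "thd q = Node Leaf (thd p)"
    "c \<in> set (ls (ttl (ttl q)))" "c \<notin> set (ls (ttl p))" using assms(2) by (auto simp: outX_def)
  obtain i where i: "i \<le> k + 1" "p = Node (enc_unary i) (f i)" using pq(1) assms(1) by (auto simp: agrees_def)
  obtain i' where i': "i' \<le> k + 1" "q = Node (enc_unary i') (f i')" using pq(2) assms(1) by (auto simp: agrees_def)
  have i'_eq: "i' = Suc i"
  proof -
    have "enc_unary i' = enc_unary (Suc i)" using pq(3) i i' by simp
    then show ?thesis by (simp only: enc_unary_inject)
  qed
  have c1: "c \<notin> set (ls (f i))" and c2: "c \<in> set (ls (ttl (f (Suc i))))"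
    using pq i i' i'_eq by auto
  have c3: "c \<in> set (ls (f (Suc i)))" using c2 by (cases "f (Suc i)") auto
  consider "j < i" | "j = i" | "j = Suc i" | "Suc i < j" by linarith
  then show False
  proof cases
    case 1
    from ptl_ls[OF f_mono[OF 1 i(1)]] have "c \<in> set (ls (ttl (f i)))" using t by auto
    then show False using c1 by (cases "f i") auto
  next
    case 2
    then show False using c1 t by simp
  next
    case 3
    then have "f (Suc i) = Node c t" using t by simp
    then show False using c2 distinct_f[of "Suc i"] 3 j(2) by simp
  next
    case 4
    then show False using f_less_notin[OF 4 _ t] c3 j by simp
  qed
qed

end

lemma sorted_wrt_ptl: "sorted_wrt (\<lambda>a b. a \<in> set (ptl b)) (rev (ptl t))"
  by (induction t) (auto simp: sorted_wrt_append)

lemma map_thd_ptl: "map thd (ptl (Node a (mk U))) = U @ [Leaf]"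
  by (induction U arbitrary: a) auto

text \<open>The suffixes headed by members of \<open>C\<close> are taken in order of length and
  framed by the two sentinels. A tuple outside \<open>C\<close> falls into the gap below the first
  of these places that contains it.\<close>

lemma exists_enumeration:
  assumes U: "distinct U" "Leaf \<notin> set U" and C: "C \<subseteq> set U" "card C = k"
  obtains f where "enumeration k (ptl (Node Leaf (Node Leaf (mk U)))) f" "chosen k f = C"
    "\<And>c. c \<in> set U - C \<Longrightarrow> \<exists>i \<le> k. c \<in> set (ls (ttl (f (Suc i)))) \<and> c \<notin> set (ls (f i))"
proof -
  let ?B = "ptl (Node Leaf (Node Leaf (mk U)))" and ?top = "Node Leaf (mk U)"
  let ?R = "\<lambda>a b. a \<in> set (ptl b)"
  \<comment> \<open>Reversing \<open>ptl\<close> lists the shortest suffix first. The empty suffix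
    is filtered out, since \<open>thd Leaf = Leaf\<close> is not in \<open>C\<close>.\<close>
  define mid where "mid = filter (\<lambda>t. thd t \<in> C) (rev (ptl ?top))"
  define fs where "fs = Leaf # mid @ [?top]"
  have LeafC: "Leaf \<notin> C" using C(1) U(2) by blast
  have len: "length mid = k"
  proof -
    have "length mid = length (filter (\<lambda>c. c \<in> C) (map thd (rev (ptl ?top))))"
      by (simp add: mid_def filter_map comp_def)
    also have "map thd (rev (ptl ?top)) = Leaf # rev U" by (simp only: rev_map[symmetric] map_thd_ptl) simp
    also have "filter (\<lambda>c. c \<in> C) (Leaf # rev U) = filter (\<lambda>c. c \<in> C) (rev U)" using LeafC by simp
    also have "length \<dots> = card (set (filter (\<lambda>c. c \<in> C) (rev U)))"
      by (rule distinct_card[symmetric]) (simp add: U)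
    also have "set (filter (\<lambda>c. c \<in> C) (rev U)) = C" using C(1) by auto
    finally show ?thesis using C(2) by simp
  qed
  have midR: "t \<in> set (ptl ?top)" "thd t \<in> C" if "t \<in> set mid" for t
    using that by (auto simp: mid_def split: if_splits)
  have Leaf_ptl: "Leaf \<in> set (ptl t)" if "t \<noteq> Leaf" for t
    using that by (induction t) auto
  have "t \<noteq> Leaf" if "t \<in> set mid" for t using midR(2)[OF that] LeafC by (cases t) auto
  then have "\<forall>t \<in> set (mid @ [?top]). Leaf \<in> set (ptl t)"
    using Leaf_ptl by (auto simp del: ptl.simps)
  moreover have "sorted_wrt ?R mid" unfolding mid_def by (intro sorted_wrt_filter sorted_wrt_ptl)
  then have "sorted_wrt ?R (mid @ [?top])"
    unfolding sorted_wrt_append using midR(1) by (simp del: ptl.simps)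
  ultimately have "sorted_wrt ?R fs" unfolding fs_def sorted_wrt.simps by blast
  then have sorted: "fs ! i \<in> set (ptl (fs ! j))" if "i < j" "j \<le> k + 1" for i j
    using that len by (auto simp: sorted_wrt_iff_nth_less fs_def)
  have fsB: "set fs \<subseteq> set ?B" using midR Leaf_ptl[of ?top] unfolding fs_def ptl.simps(2)[of Leaf ?top]
    by (auto simp del: ptl.simps)
  have "fs ! j \<in> set ?B" if "j \<le> k + 1" for j
    using that fsB nth_mem[of j fs] len by (auto simp: fs_def simp del: set_simps)
  then have enum: "enumeration k ?B (\<lambda>j. fs ! j)" using sorted by (auto simp: enumeration_def)
  interpret enumeration_locale k U "\<lambda>j. fs ! j" by unfold_locales (use U enum in auto)
  have inner: "fs ! j \<in> set mid" if "1 \<le> j" "j \<le> k" for j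
    using that len by (cases j) (simp_all add: fs_def nth_append)
  have "chosen k (\<lambda>j. fs ! j) \<subseteq> C" using inner midR(2) by (auto simp: chosen_def)
  moreover have "finite C" using C(1) by (rule finite_subset) simp
  ultimately have chosen: "chosen k (\<lambda>j. fs ! j) = C" using card_chosen C(2) by (intro card_seteq) auto
  have "\<exists>i \<le> k. c \<in> set (ls (ttl (fs ! Suc i))) \<and> c \<notin> set (ls (fs ! i))" if c: "c \<in> set U - C" for c
  proof -
    have top: "fs ! (k + 1) = ?top" using len by (simp add: fs_def nth_append)
    \<comment> \<open>The empty sentinel does not contain \<open>c\<close> and the top one does, so
      there is a step at which \<open>c\<close> enters. It is not the head there, because that head
      lies in \<open>C\<close> or is the additional \<open>Leaf\<close>.\<close>
    let ?P = "\<lambda>i. c \<in> set (ls (fs ! i))"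
    have "?P (k + 1)" using c by (simp only: top) simp
    moreover have "\<not> ?P 0" by (simp add: fs_def)
    ultimately obtain i where i: "i < k + 1" "\<not> ?P i" "?P (Suc i)"
      using ex_least_nat_less[of ?P "k + 1"] by blast
    have "c \<noteq> thd (fs ! Suc i)"
    proof (cases "Suc i = k + 1")
      case True
      then show ?thesis using c U(2) top by auto
    next
      case False
      then show ?thesis using inner[of "Suc i"] midR(2) i(1) c by auto
    qed
    then have "c \<in> set (ls (ttl (fs ! Suc i)))" using i(3) by (cases "fs ! Suc i") auto
    then show ?thesis using i by (intro exI[of _ i]) auto
  qed
  then show ?thesis using that[OF enum chosen] by blast
qed

section \<open>Valuations as trees and evaluation of formulas under partial knowledge\<close>

fun tnth :: "nat \<Rightarrow> tree \<Rightarrow> tree" where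
  "tnth 0 t = thd t"
| "tnth (Suc i) t = tnth i (ttl t)"

fun tupd :: "nat \<Rightarrow> tree \<Rightarrow> tree \<Rightarrow> tree" where
  "tupd 0 a t = Node a (ttl t)"
| "tupd (Suc i) a t = Node (thd t) (tupd i a (ttl t))"

lemma tnth_mk [simp]: "i < length l \<Longrightarrow> tnth i (mk l) = l ! i"
proof (induction i arbitrary: l)
  case 0
  then show ?case by (cases l) auto
next
  case (Suc i)
  then show ?case by (cases l) auto
qed

lemma tupd_mk [simp]: "i < length l \<Longrightarrow> tupd i a (mk l) = mk (l[i := a])"
proof (induction i arbitrary: l)
  case 0
  then show ?case by (cases l) auto
next
  case (Suc i)
  then show ?case by (cases l) auto
qed

definition encv :: "nat \<Rightarrow> (nat \<Rightarrow> nat) \<Rightarrow> tree" where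
  "encv M v = mk (map (\<lambda>i. enc_nat (v i)) [0..<M])"

lemma tnth_encv [simp]: "i < M \<Longrightarrow> tnth i (encv M v) = enc_nat (v i)"
  by (simp add: encv_def)

lemma tupd_encv [simp]: "x < M \<Longrightarrow> tupd x (enc_nat a) (encv M v) = encv M (v(x := a))"
  unfolding encv_def by (simp, intro nth_equalityI) (auto simp: nth_list_update)

fun all_vars :: "fm \<Rightarrow> nat set" where
  "all_vars (Eq x y) = {x, y}"
| "all_vars (Rel r xs) = set xs"
| "all_vars (XRel xs) = set xs"
| "all_vars (Neg \<phi>) = all_vars \<phi>"
| "all_vars (Conj \<phi> \<psi>) = all_vars \<phi> \<union> all_vars \<psi>"
| "all_vars (Disj \<phi> \<psi>) = all_vars \<phi> \<union> all_vars \<psi>"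
| "all_vars (Ex x \<phi>) = insert x (all_vars \<phi>)"
| "all_vars (All x \<phi>) = insert x (all_vars \<phi>)"

lemma finite_all_vars: "finite (all_vars \<phi>)"
  by (induction \<phi>) auto

text \<open>Occurrences are counted, each of which needs at most two entries of a guess as its
  certificate.\<close>

fun xcount :: "fm \<Rightarrow> nat" where
  "xcount (XRel xs) = 1"
| "xcount (Neg \<phi>) = xcount \<phi>"
| "xcount (Conj \<phi> \<psi>) = xcount \<phi> + xcount \<psi>"
| "xcount (Disj \<phi> \<psi>) = xcount \<phi> + xcount \<psi>"
| "xcount (Ex x \<phi>) = xcount \<phi>"
| "xcount (All x \<phi>) = xcount \<phi>"
| "xcount _ = 0"

text \<open>\<open>tev p \<phi> vs e z\<close> says that the partial knowledge of \<open>X\<close> contained in the guess \<open>e\<close>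
  suffices to see that \<open>\<phi>\<close> has truth value \<open>p\<close>. It is only used for formulas in which
  existential quantifiers precede a quantifier-free formula, hence the junk in the other cases.\<close>

fun tev :: "bool \<Rightarrow> fm \<Rightarrow> tree \<Rightarrow> tree \<Rightarrow> tree \<Rightarrow> bool" where
  "tev p (Eq x y) vs e z \<longleftrightarrow> (tnth x vs = tnth y vs) = p"
| "tev p (Rel r xs) vs e z \<longleftrightarrow>
     (mk (map (\<lambda>i. tnth i vs) xs) \<in> set (ls (tnth r (ttl (thd z))))) = p"
| "tev p (XRel xs) vs e z \<longleftrightarrow>
     (if p then inX z (mk (map (\<lambda>i. tnth i vs) xs)) e else outX (mk (map (\<lambda>i. tnth i vs) xs)) e)"
| "tev p (Neg \<phi>) vs e z \<longleftrightarrow> tev (\<not> p) \<phi> vs e z"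
| "tev p (Conj \<phi> \<psi>) vs e z \<longleftrightarrow>
     (if p then tev p \<phi> vs e z \<and> tev p \<psi> vs e z else tev p \<phi> vs e z \<or> tev p \<psi> vs e z)"
| "tev p (Disj \<phi> \<psi>) vs e z \<longleftrightarrow>
     (if p then tev p \<phi> vs e z \<or> tev p \<psi> vs e z else tev p \<phi> vs e z \<and> tev p \<psi> vs e z)"
| "tev p (Ex x \<phi>) vs e z \<longleftrightarrow> p \<and> (\<exists>a \<in> set (universe z). tev p \<phi> (tupd x a vs) e z)"
| "tev p (All x \<phi>) vs e z \<longleftrightarrow> False"

fun ex_prenex :: "fm \<Rightarrow> bool" where
  "ex_prenex (Ex x \<phi>) \<longleftrightarrow> ex_prenex \<phi>"
| "ex_prenex \<phi> \<longleftrightarrow> quantifier_free \<phi>"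

fun strip_all :: "fm \<Rightarrow> fm" where
  "strip_all (All x \<phi>) = strip_all \<phi>"
| "strip_all \<phi> = \<phi>"

lemma ex_prenex_quantifier_free: "quantifier_free \<phi> \<Longrightarrow> ex_prenex \<phi>"
  by (cases \<phi>) auto

lemma strip_all_ex_prenex: "ex_prenex \<phi> \<Longrightarrow> strip_all \<phi> = \<phi>"
  by (cases \<phi>) auto

text \<open>The two predicates are mutually inductive, so the levels below \<open>Pi_fm 2\<close>
  have to be described along with it.\<close>

lemma Sigma_Pi_shape:
  "Sigma_fm t \<phi> \<Longrightarrow> (t = 0 \<longrightarrow> quantifier_free \<phi>) \<and> (t = 1 \<longrightarrow> ex_prenex \<phi>)"
  "Pi_fm t \<phi> \<Longrightarrow> (t = 0 \<longrightarrow> quantifier_free \<phi>) \<and> (t = 2 \<longrightarrow> ex_prenex (strip_all \<phi>))"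
  by (induction rule: Sigma_fm_Pi_fm.inducts)
    (auto simp: ex_prenex_quantifier_free strip_all_ex_prenex numeral_2_eq_2)

lemma all_vars_strip_all: "all_vars (strip_all \<phi>) \<subseteq> all_vars \<phi>"
  by (induction \<phi>) auto

lemma xcount_strip_all [simp]: "xcount (strip_all \<phi>) = xcount \<phi>"
  by (induction \<phi>) auto

lemma wf_fm_strip_all: "wf_fm \<tau> s \<phi> \<Longrightarrow> wf_fm \<tau> s (strip_all \<phi>)"
  by (induction \<phi>) auto

text \<open>Where all valuations into the universe are quantified over anyway, a leading universal
  quantifier adds nothing, even if the same variable is bound again further inside.\<close>

lemma sat_strip_all:
  "(\<forall>v. (\<forall>i. v i < n) \<longrightarrow> sat n R S v \<phi>) \<longleftrightarrow> (\<forall>v. (\<forall>i. v i < n) \<longrightarrow> sat n R S v (strip_all \<phi>))"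
proof (induction \<phi>)
  case (All x \<phi>)
  have "(\<forall>v. (\<forall>i. v i < n) \<longrightarrow> sat n R S v (All x \<phi>)) \<longleftrightarrow> (\<forall>v. (\<forall>i. v i < n) \<longrightarrow> sat n R S v \<phi>)"
  proof (intro iffI allI impI)
    fix v :: "nat \<Rightarrow> nat"
    assume *: "\<forall>v. (\<forall>i. v i < n) \<longrightarrow> sat n R S v (All x \<phi>)" and v: "\<forall>i. v i < n"
    then have "sat n R S (v(x := v x)) \<phi>" by (simp del: fun_upd_triv)
    then show "sat n R S v \<phi>" by simp
  qed auto
  with All show ?case by simp
qed auto

lemma sat_cong: "(\<And>i. i \<in> free_vars \<phi> \<Longrightarrow> v i = v' i) \<Longrightarrow> sat n R S v \<phi> = sat n R S v' \<phi>"
proof (induction \<phi> arbitrary: v v')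
  case (Rel r xs)
  then have "map v xs = map v' xs" by simp
  then show ?case by (simp only: sat.simps)
next
  case (XRel xs)
  then have "map v xs = map v' xs" by simp
  then show ?case by (simp only: sat.simps)
next
  case (Conj \<phi> \<psi>)
  have 1: "sat n R S v \<phi> = sat n R S v' \<phi>" by (rule Conj.IH(1)) (rule Conj.prems, simp)
  have 2: "sat n R S v \<psi> = sat n R S v' \<psi>" by (rule Conj.IH(2)) (rule Conj.prems, simp)
  show ?case by (simp only: sat.simps 1 2)
next
  case (Disj \<phi> \<psi>)
  have 1: "sat n R S v \<phi> = sat n R S v' \<phi>" by (rule Disj.IH(1)) (rule Disj.prems, simp)
  have 2: "sat n R S v \<psi> = sat n R S v' \<psi>" by (rule Disj.IH(2)) (rule Disj.prems, simp)
  show ?case by (simp only: sat.simps 1 2)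
next
  case (Ex x \<phi>)
  have "sat n R S (v(x := a)) \<phi> = sat n R S (v'(x := a)) \<phi>" for a
  proof (rule Ex.IH)
    fix i assume "i \<in> free_vars \<phi>"
    then show "(v(x := a)) i = (v'(x := a)) i" using Ex.prems[of i] by (cases "i = x") auto
  qed
  then show ?case by (simp only: sat.simps)
next
  case (All x \<phi>)
  have "sat n R S (v(x := a)) \<phi> = sat n R S (v'(x := a)) \<phi>" for a
  proof (rule All.IH)
    fix i assume "i \<in> free_vars \<phi>"
    then show "(v(x := a)) i = (v'(x := a)) i" using All.prems[of i] by (cases "i = x") auto
  qed
  then show ?case by (simp only: sat.simps)
next
  case (Neg \<phi>)
  have 1: "sat n R S v \<phi> = sat n R S v' \<phi>" by (rule Neg.IH) (rule Neg.prems, simp)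
  show ?case by (simp only: sat.simps 1)
qed simp

lemma inj_enc_nat_list: "enc_list enc_nat xs = enc_list enc_nat ys \<longleftrightarrow> xs = ys"
  by (simp add: enc_list_conv_mk inj_map_eq_map inj_on_def)

lemma universe_unary: "thd (thd z) = enc_unary n \<Longrightarrow> universe z = map enc_nat (rev [0..<n])"
  by (simp add: universe_def ptl_enc_unary rev_map[symmetric] comp_def)

lemma set_universe_unary: "thd (thd z) = enc_unary n \<Longrightarrow> set (universe z) = enc_nat ` {..<n}"
  by (auto simp: universe_unary)

lemma set_lists_universe_unary:
  assumes "thd (thd z) = enc_unary n"
  shows "{l. length l = d \<and> set l \<subseteq> set (universe z)} = map enc_nat ` tuples n d"
proof (intro equalityI subsetI)
  fix l assume "l \<in> {l. length l = d \<and> set l \<subseteq> set (universe z)}"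
  then have l: "length l = d" "set l \<subseteq> enc_nat ` {..<n}" by (auto simp: set_universe_unary[OF assms])
  then obtain xs where "set xs \<subseteq> {..<n}" "l = map enc_nat xs"
    by (metis subset_code(1) lists_image in_lists_conv_set image_iff lists_eq_set mem_Collect_eq)
  then show "l \<in> map enc_nat ` tuples n d" using l(1) by (auto simp: tuples_def)
qed (auto simp: tuples_def set_universe_unary[OF assms] intro!: imageI)

lemma set_cands_unary:
  assumes "thd (thd z) = enc_unary n"
  shows "set (cands d z) = enc_list enc_nat ` tuples n d"
  using set_lists_universe_unary[OF assms, of d]
  by (auto simp: cands_def set_n_lists enc_list_conv_mk image_image)

section \<open>Correctness of the hitting set instance\<close>

locale wd_instance =
  fixes \<tau> :: "nat list" and s n :: nat and Rs :: "nat list list list" and k M :: nat and z :: tree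
  assumes wf: "wf_struct \<tau> (n, Rs)" and s: "s \<ge> 1"
    and z: "z = Node (enc_struct (n, Rs)) (enc_unary k)"
begin

lemma n_pos: "n \<ge> 1"
  using wf by (simp add: wf_struct_def)

lemma unary: "thd (thd z) = enc_unary n"
  by (simp add: z enc_struct_def)

lemmas set_universe = set_universe_unary[OF unary]
  and set_lists_universe = set_lists_universe_unary[OF unary]
  and set_cands = set_cands_unary[OF unary]

lemma distinct_universe: "distinct (universe z)"
  by (simp add: universe_unary[OF unary] distinct_map inj_on_def)

lemma distinct_cands: "distinct (cands s z)"
  by (simp add: cands_def distinct_map distinct_n_lists distinct_universe inj_on_def)

text \<open>Tuples have length \<open>s \<ge> 1\<close>, so none is encoded by \<open>Leaf\<close>.
  This keeps the heads of the sentinel places apart from the candidates.\<close>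

lemma Leaf_notin_cands: "Leaf \<notin> set (cands s z)"
proof
  assume "Leaf \<in> set (cands s z)"
  then obtain xs where "Leaf = enc_list enc_nat xs" "length xs = s"
    by (auto simp: set_cands tuples_def)
  then show False using s by (cases xs) auto
qed

lemma set_vals: "set (vals M z) = {encv M v | v. \<forall>i. v i < n}"
proof (intro equalityI subsetI)
  fix t assume "t \<in> set (vals M z)"
  then obtain xs where xs: "t = mk (map enc_nat xs)" "length xs = M" "set xs \<subseteq> {..<n}"
    using set_lists_universe[of M] by (auto simp: vals_def set_n_lists tuples_def)
  \<comment> \<open>Variables from \<open>M\<close> on get the value 0, which is an element because
    the universe is not empty.\<close>
  let ?v = "\<lambda>i. if i < M then xs ! i else 0"
  have "t = encv M ?v" unfolding xs(1) encv_def using xs(2) by (simp, intro nth_equalityI) auto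
  moreover have "?v i < n" for i using xs(2) subsetD[OF xs(3) nth_mem, of i] n_pos by auto
  ultimately show "t \<in> {encv M v | v. \<forall>i. v i < n}" by blast
next
  fix t assume "t \<in> {encv M v | v. \<forall>i. v i < n}"
  then show "t \<in> set (vals M z)" by (auto simp: encv_def vals_def set_n_lists set_universe image_iff)
qed

lemma rel_eq:
  assumes "r < length \<tau>"
  shows "set (ls (tnth r (ttl (thd z)))) = enc_list enc_nat ` set (Rs ! r)"
proof -
  have "r < length Rs" using assms wf by (simp add: wf_struct_def)
  then show ?thesis by (simp add: z enc_struct_def enc_list_conv_mk[of "enc_list (enc_list enc_nat)"]
      enc_list_conv_mk[of "enc_list enc_nat" "Rs ! r"])
qed

lemma tuple_encv: "set xs \<subseteq> {..<M} \<Longrightarrow> mk (map (\<lambda>i. tnth i (encv M v)) xs) = enc_list enc_nat (map v xs)"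
  by (auto simp: enc_list_conv_mk subset_iff)

abbreviation models :: "nat list set \<Rightarrow> (nat \<Rightarrow> nat) \<Rightarrow> fm \<Rightarrow> bool" where
  "models S v \<phi> \<equiv> sat n (\<lambda>r. set (Rs ! r)) S v \<phi>"

text \<open>Both truth values are treated at once, since negation exchanges them. Only the atoms of
  \<open>X\<close> consult the guess, and for these \<open>inX\<close> and \<open>outX\<close> are
  sound.\<close>

lemma tev_sound:
  assumes "enumeration k (places s z) f" "agrees k f e"
    and S: "S = {xs \<in> tuples n s. enc_list enc_nat xs \<in> chosen k f}"
    and "wf_fm \<tau> s \<phi>" "all_vars \<phi> \<subseteq> {..<M}" "\<forall>i. v i < n" "tev p \<phi> (encv M v) e z"
  shows "models S v \<phi> = p"
  using assms(4-)
proof (induction \<phi> arbitrary: p v)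
  case (Rel r xs)
  then show ?case
    by (simp add: rel_eq tuple_encv image_iff inj_enc_nat_list)
next
  case (XRel xs)
  interpret enumeration_locale k "cands s z" f
    using assms(1) distinct_cands Leaf_notin_cands by unfold_locales (auto simp: places_def)
  have "map v xs \<in> tuples n s" using XRel by (auto simp: tuples_def)
  then have "map v xs \<in> S \<longleftrightarrow> enc_list enc_nat (map v xs) \<in> chosen k f" by (simp add: S)
  then show ?case using XRel inX_sound[OF assms(2)] outX_sound[OF assms(2)]
    by (auto simp: tuple_encv z split: if_splits)
next
  case (Ex x \<phi>)
  then obtain a where a: "a < n" "tev True \<phi> (encv M (v(x := a))) e z" and p
    by (auto simp: set_universe)
  then have "models S (v(x := a)) \<phi> = True"
    by (intro Ex.IH a(2)) (use Ex.prems a(1) in simp_all)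
  then show ?case using a \<open>p\<close> by auto
qed (auto split: if_splits)

text \<open>An atom of \<open>X\<close> needs the rank of its tuple if that is chosen, and otherwise
  the two ranks around its gap; other atoms need none. Certificates of subformulas are appended,
  which is possible because further entries in a guess do no harm.\<close>

lemma tev_complete_quantifier_free:
  assumes S: "S \<subseteq> tuples n s" "chosen k f = enc_list enc_nat ` S"
    and gap: "\<And>c. c \<in> set (cands s z) - chosen k f \<Longrightarrow>
      \<exists>i \<le> k. c \<in> set (ls (ttl (f (Suc i)))) \<and> c \<notin> set (ls (f i))"
    and "wf_fm \<tau> s \<phi>" "all_vars \<phi> \<subseteq> {..<M}" "\<forall>i. v i < n" "quantifier_free \<phi>"
  shows "\<exists>js. length js \<le> 2 * xcount \<phi> \<and> set js \<subseteq> {..k + 1} \<and>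
    (\<forall>e. (\<forall>j \<in> set js. Node (enc_unary j) (f j) \<in> set (ls e)) \<longrightarrow> tev (models S v \<phi>) \<phi> (encv M v) e z)"
  using assms(4-)
proof (induction \<phi>)
  case (Eq x y)
  then show ?case by (intro exI[of _ "[]"]) auto
next
  case (Rel r xs)
  then show ?case
    by (intro exI[of _ "[]"]) (simp add: rel_eq tuple_encv image_iff inj_enc_nat_list)
next
  case (XRel xs)
  let ?c = "enc_list enc_nat (map v xs)"
  have tuple: "map v xs \<in> tuples n s" using XRel by (auto simp: tuples_def)
  have c: "?c \<in> chosen k f \<longleftrightarrow> map v xs \<in> S" by (auto simp: S(2) inj_enc_nat_list)
  show ?case
  proof (cases "map v xs \<in> S")
    case True
    then obtain j where j: "1 \<le> j" "j \<le> k" "thd (f j) = ?c" using c by (auto simp: chosen_def)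
    have "enc_unary j \<noteq> Leaf" "enc_unary j \<noteq> Node Leaf (enc_unary k)"
      using j enc_unary_inject[of j 0] enc_unary_inject[of j "Suc k"] by (auto simp del: enc_unary_inject)
    then have "inX z ?c e" if "Node (enc_unary j) (f j) \<in> set (ls e)" for e
      unfolding inX_def using j that by (intro bexI[of _ "Node (enc_unary j) (f j)"]) (auto simp: z)
    then show ?thesis using True j XRel.prems by (intro exI[of _ "[j]"]) (auto simp: tuple_encv)
  next
    case False
    have "?c \<in> set (cands s z) - chosen k f" using tuple False c by (simp add: set_cands)
    from gap[OF this] obtain i where i: "i \<le> k" "?c \<in> set (ls (ttl (f (Suc i))))" "?c \<notin> set (ls (f i))"
      by blast
    have "outX ?c e" if "Node (enc_unary i) (f i) \<in> set (ls e)" "Node (enc_unary (Suc i)) (f (Suc i)) \<in> set (ls e)" for e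
      unfolding outX_def using i that
      by (intro bexI[of _ "Node (enc_unary i) (f i)"] bexI[of _ "Node (enc_unary (Suc i)) (f (Suc i))"]) auto
    then show ?thesis using False i(1) XRel.prems by (intro exI[of _ "[i, Suc i]"]) (auto simp: tuple_encv)
  qed
next
  case (Conj \<phi> \<psi>)
  then obtain js ks where "length js \<le> 2 * xcount \<phi>" "set js \<subseteq> {..k + 1}"
    "\<And>e. (\<forall>j \<in> set js. Node (enc_unary j) (f j) \<in> set (ls e)) \<longrightarrow> tev (models S v \<phi>) \<phi> (encv M v) e z"
    and "length ks \<le> 2 * xcount \<psi>" "set ks \<subseteq> {..k + 1}"
    "\<And>e. (\<forall>j \<in> set ks. Node (enc_unary j) (f j) \<in> set (ls e)) \<longrightarrow> tev (models S v \<psi>) \<psi> (encv M v) e z"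
    by auto
  then show ?case by (intro exI[of _ "js @ ks"]) (auto; smt (verit))
next
  case (Disj \<phi> \<psi>)
  then obtain js ks where "length js \<le> 2 * xcount \<phi>" "set js \<subseteq> {..k + 1}"
    "\<And>e. (\<forall>j \<in> set js. Node (enc_unary j) (f j) \<in> set (ls e)) \<longrightarrow> tev (models S v \<phi>) \<phi> (encv M v) e z"
    and "length ks \<le> 2 * xcount \<psi>" "set ks \<subseteq> {..k + 1}"
    "\<And>e. (\<forall>j \<in> set ks. Node (enc_unary j) (f j) \<in> set (ls e)) \<longrightarrow> tev (models S v \<psi>) \<psi> (encv M v) e z"
    by auto
  then show ?case by (intro exI[of _ "js @ ks"]) (auto; smt (verit))
qed auto

text \<open>Witnesses of existential quantifiers are searched for by \<open>tev\<close> itself, so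
  they cost no entries of the guess.\<close>

lemma tev_complete:
  assumes S: "S \<subseteq> tuples n s" "chosen k f = enc_list enc_nat ` S"
    and gap: "\<And>c. c \<in> set (cands s z) - chosen k f \<Longrightarrow>
      \<exists>i \<le> k. c \<in> set (ls (ttl (f (Suc i)))) \<and> c \<notin> set (ls (f i))"
    and "wf_fm \<tau> s \<phi>" "all_vars \<phi> \<subseteq> {..<M}" "\<forall>i. v i < n" "ex_prenex \<phi>" "models S v \<phi>"
  shows "\<exists>js. length js \<le> 2 * xcount \<phi> \<and> set js \<subseteq> {..k + 1} \<and>
    (\<forall>e. (\<forall>j \<in> set js. Node (enc_unary j) (f j) \<in> set (ls e)) \<longrightarrow> tev True \<phi> (encv M v) e z)"
proof -
  have qf: "\<exists>js. length js \<le> 2 * xcount \<phi> \<and> set js \<subseteq> {..k + 1} \<and>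
      (\<forall>e. (\<forall>j \<in> set js. Node (enc_unary j) (f j) \<in> set (ls e)) \<longrightarrow> tev True \<phi> (encv M v) e z)"
    if "wf_fm \<tau> s \<phi>" "all_vars \<phi> \<subseteq> {..<M}" "\<forall>i. v i < n" "quantifier_free \<phi>" "models S v \<phi>" for v \<phi>
    using tev_complete_quantifier_free[OF S gap that(1-4)] that(5) by simp
  show ?thesis
  using assms(4-)
proof (induction \<phi> arbitrary: v rule: ex_prenex.induct)
  case (1 x \<phi>)
  then obtain a where a: "a < n" "models S (v(x := a)) \<phi>" by auto
  have "\<exists>js. length js \<le> 2 * xcount \<phi> \<and> set js \<subseteq> {..k + 1} \<and>
    (\<forall>e. (\<forall>j \<in> set js. Node (enc_unary j) (f j) \<in> set (ls e)) \<longrightarrow> tev True \<phi> (encv M (v(x := a))) e z)"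
    by (intro "1.IH" a(2)) (use "1.prems" a(1) in simp_all)
  then obtain js where js: "length js \<le> 2 * xcount \<phi>" "set js \<subseteq> {..k + 1}"
    "\<forall>e. (\<forall>j \<in> set js. Node (enc_unary j) (f j) \<in> set (ls e)) \<longrightarrow> tev True \<phi> (encv M (v(x := a))) e z"
    by blast
  have "tev True (Ex x \<phi>) (encv M v) e z" if "tev True \<phi> (encv M (v(x := a))) e z" for e
    using that a(1) "1.prems" by (auto simp: set_universe simp del: fun_upd_apply intro!: bexI[of _ "enc_nat a"])
  then show ?case using js by (intro exI[of _ js]) (simp only: xcount.simps, blast)
qed (rule qf; simp)+
qed

text \<open>Forward, \<open>H\<close> yields an enumeration whose chosen tuples form
  \<open>S\<close>, and soundness of \<open>tev\<close> gives the formula at all valuations.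
  Backward, the guesses made by an enumeration of \<open>S\<close> form the hitting set. The
  \<open>+ 1\<close> in \<open>m\<close> keeps slots nonempty even without atoms of
  \<open>X\<close>.\<close>

theorem hitting_set_iff:
  assumes \<phi>: "wf_fm \<tau> s \<phi>" "free_vars \<phi> = {}" "Pi_fm 2 \<phi>" "all_vars \<phi> \<subseteq> {..<M}"
    and m: "m = 2 * xcount \<phi> + 1"
  shows "(\<exists>H \<subseteq> set (guesses s m z). card H \<le> length (slots m z) \<and>
      (\<forall>\<sigma> \<in> set (slots m z). \<exists>e \<in> H. slot e = \<sigma>) \<and>
      (\<forall>e \<in> set (guesses s m z). \<forall>\<sigma> \<in> set (slots m z). \<exists>e' \<in> H.
        (slot e' = slot e \<and> e' \<noteq> e) \<or> (slot e' = \<sigma> \<and> compatible e e')) \<and>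
      (\<forall>v \<in> set (vals M z). \<exists>e \<in> H. tev True (strip_all \<phi>) v e z)) \<longleftrightarrow>
    (\<exists>S \<subseteq> tuples n s. card S = k \<and> models S (\<lambda>_. 0) \<phi>)"
    (is "?L \<longleftrightarrow> ?R")
proof
  let ?\<theta> = "strip_all \<phi>"
  have \<theta>: "wf_fm \<tau> s ?\<theta>" "all_vars ?\<theta> \<subseteq> {..<M}" "ex_prenex ?\<theta>"
    using \<phi> wf_fm_strip_all[of \<tau> s \<phi>] all_vars_strip_all[of \<phi>] Sigma_Pi_shape(2)[of 2 \<phi>] by auto
  show ?R if L: ?L
  proof -
    from L obtain H where H: "H \<subseteq> set (guesses s m z)" "card H \<le> length (slots m z)"
      "\<forall>\<sigma> \<in> set (slots m z). \<exists>e \<in> H. slot e = \<sigma>"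
      "\<forall>e \<in> set (guesses s m z). \<forall>\<sigma> \<in> set (slots m z). \<exists>e' \<in> H.
        (slot e' = slot e \<and> e' \<noteq> e) \<or> (slot e' = \<sigma> \<and> compatible e e')"
      "\<forall>v \<in> set (vals M z). \<exists>e \<in> H. tev True ?\<theta> v e z" by (elim exE conjE) (rule that)
    obtain f where en: "enumeration k (places s z) f" and ag: "\<And>e. e \<in> H \<Longrightarrow> agrees k f e"
      using hitting_set_enumeration[of m H s "enc_struct (n, Rs)" k, folded z,
        OF _ H(1,2) H(3)[rule_format] H(4)[rule_format]] m by auto
    interpret enumeration_locale k "cands s z" f
      using en distinct_cands Leaf_notin_cands by unfold_locales (auto simp: places_def)
    define S where "S = {xs \<in> tuples n s. enc_list enc_nat xs \<in> chosen k f}"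
    have "enc_list enc_nat ` S = chosen k f" using chosen_subset by (auto simp: S_def set_cands)
    moreover have "inj_on (enc_list enc_nat) S" by (simp add: inj_on_def inj_enc_nat_list)
    ultimately have "card S = k" using card_chosen by (metis card_image)
    moreover have "models S v ?\<theta>" if v: "\<forall>i. v i < n" for v
    proof -
      obtain e where "e \<in> H" "tev True ?\<theta> (encv M v) e z" using H(5)[rule_format, of "encv M v"] v by (auto simp: set_vals)
      then show ?thesis using tev_sound[OF en ag S_def \<theta>(1,2) v] by simp
    qed
    then have "\<forall>v. (\<forall>i. v i < n) \<longrightarrow> models S v ?\<theta>" by (intro allI impI)
    from this[folded sat_strip_all] have "models S (\<lambda>_. 0) \<phi>" using n_pos by (elim allE impE) (simp_all add: less_eq_Suc_le)
    moreover have "S \<subseteq> tuples n s" by (auto simp: S_def)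
    ultimately show ?thesis by blast
  qed
  show ?L if ?R
  proof -
    from that obtain S where S: "S \<subseteq> tuples n s" "card S = k" "models S (\<lambda>_. 0) \<phi>" by blast
    have "card (enc_list enc_nat ` S) = k"
      using S(2) by (simp add: card_image inj_on_def inj_enc_nat_list)
    moreover have "enc_list enc_nat ` S \<subseteq> set (cands s z)" using S(1) by (auto simp: set_cands)
    ultimately obtain f where f: "enumeration k (places s z) f" "chosen k f = enc_list enc_nat ` S"
      "\<And>c. c \<in> set (cands s z) - enc_list enc_nat ` S \<Longrightarrow>
        \<exists>i \<le> k. c \<in> set (ls (ttl (f (Suc i)))) \<and> c \<notin> set (ls (f i))"
      using exists_enumeration[OF distinct_cands Leaf_notin_cands] unfolding places_def by metis
    define L where "L = {l. length l = m \<and> set l \<subseteq> set (ranks z)}"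
    have "\<exists>e \<in> guess_of f ` L. tev True ?\<theta> v e z" if v: "v \<in> set (vals M z)" for v
    proof -
      obtain u where u: "v = encv M u" "\<forall>i. u i < n" using v by (auto simp: set_vals)
      \<comment> \<open>A sentence that holds under one valuation holds under all, so
        \<open>sat_strip_all\<close> transfers it to the stripped formula at
        \<open>u\<close>.\<close>
      have "models S w \<phi>" for w using S(3) sat_cong[of \<phi> w "\<lambda>_. 0"] \<phi>(2) by auto
      then have "\<forall>v. (\<forall>i. v i < n) \<longrightarrow> models S v \<phi>" by (intro allI impI)
      from spec[OF this[unfolded sat_strip_all[of n _ S \<phi>]], of u] have "models S u ?\<theta>"
        using u(2) by (rule mp)
      from tev_complete[OF S(1) f(2) _ \<theta>(1,2) u(2) \<theta>(3) this] f(2,3) obtain js where js: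
        "length js \<le> 2 * xcount \<phi>" "set js \<subseteq> {..k + 1}"
        "\<And>e. (\<forall>j \<in> set js. Node (enc_unary j) (f j) \<in> set (ls e)) \<Longrightarrow> tev True ?\<theta> v e z"
        using u(1) by auto
      \<comment> \<open>The certifying ranks are padded with rank 0 to the length of a slot.\<close>
      define l where "l = map enc_unary (js @ replicate (m - length js) 0)"
      have "Leaf \<in> enc_unary ` {..k + 1}" by (rule image_eqI[of _ _ 0]) simp_all
      then have "l \<in> L" using js(1,2) m by (auto simp: L_def l_def z set_ranks)
      moreover have "tev True ?\<theta> v (guess_of f l) z"
        by (rule js(3)) (auto simp: guess_of_def l_def)
      ultimately show ?thesis by blast
    qed
    note type3 = this
    note hs = enumeration_hitting_set[where k = k and s = s and x = "enc_struct (n, Rs)" and f = f and m = m,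
      folded z, folded L_def, OF f(1)]
    show ?thesis
      by (intro exI[of _ "guess_of f ` L"] conjI ballI) (fact hs type3)+
  qed
qed

end

section \<open>The reduction runs in polynomial time\<close>

definition tag :: "nat \<Rightarrow> tree" where
  "tag i = enc_unary i"

lemma tag_eq_iff [simp]: "tag i = tag j \<longleftrightarrow> i = j"
  by (simp add: tag_def)

lemma tag_eq_Leaf [simp]: "tag i = Leaf \<longleftrightarrow> i = 0" "Leaf = tag i \<longleftrightarrow> i = 0"
  by (cases i; simp add: tag_def)+

fun rels_ok :: "nat list \<Rightarrow> tree \<Rightarrow> tree \<Rightarrow> bool" where
  "rels_ok [] z t \<longleftrightarrow> t = Leaf"
| "rels_ok (a # \<tau>) z t \<longleftrightarrow> t \<noteq> Leaf \<and> (\<forall>y \<in> set (ls (thd t)). y \<in> set (cands a z)) \<and> rels_ok \<tau> z (ttl t)"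

definition valid :: "nat list \<Rightarrow> tree \<Rightarrow> bool" where
  "valid \<tau> z \<longleftrightarrow> thd (thd z) \<noteq> Leaf \<and> (\<forall>h \<in> set (ls (thd (thd z))). h = Leaf) \<and> rels_ok \<tau> z (ttl (thd z))"

text \<open>Three kinds of sets to be hit, told apart by tags: one for the use of each slot, one for
  the consistency of the guesses, one for the certification of each valuation.\<close>

definition clauses :: "nat \<Rightarrow> nat \<Rightarrow> nat \<Rightarrow> tree \<Rightarrow> tree list" where
  "clauses s m M z = map (\<lambda>\<sigma>. Node (tag 1) \<sigma>) (slots m z) @
     concat (map (\<lambda>e. map (\<lambda>\<sigma>. Node (tag 2) (Node e \<sigma>)) (slots m z)) (guesses s m z)) @
     map (\<lambda>v. Node (tag 3) v) (vals M z)"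

text \<open>A malformed input satisfies no clause, so it becomes a no-instance.\<close>

definition hits :: "nat list \<Rightarrow> fm \<Rightarrow> tree \<Rightarrow> tree \<Rightarrow> tree \<Rightarrow> bool" where
  "hits \<tau> \<theta> z e c \<longleftrightarrow> valid \<tau> z \<and>
     (thd c = tag 1 \<and> slot e = ttl c \<or>
      thd c = tag 2 \<and> (slot e = slot (thd (ttl c)) \<and> e \<noteq> thd (ttl c) \<or>
        slot e = ttl (ttl c) \<and> compatible (thd (ttl c)) e) \<or>
      thd c = tag 3 \<and> tev True \<theta> (ttl c) e z)"

lemma enc_unary_iff: "(\<exists>n. t = enc_unary n) \<longleftrightarrow> (\<forall>h \<in> set (ls t). h = Leaf)"
proof
  show "\<forall>h \<in> set (ls t). h = Leaf \<Longrightarrow> \<exists>n. t = enc_unary n"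
  proof (induction t)
    case Leaf
    show ?case by (rule exI[of _ 0]) simp
  next
    case (Node a b)
    then obtain n where "b = enc_unary n" by auto
    then show ?case using Node.prems by (intro exI[of _ "Suc n"]) simp
  qed
  show "\<exists>n. t = enc_unary n \<Longrightarrow> \<forall>h \<in> set (ls t). h = Leaf"
  proof (elim exE)
    fix n show "t = enc_unary n \<Longrightarrow> \<forall>h \<in> set (ls t). h = Leaf"
      by (induction n arbitrary: t) auto
  qed
qed

lemma rels_ok_iff:
  assumes "thd (thd z) = enc_unary n"
  shows "rels_ok \<tau> z t \<longleftrightarrow> (\<exists>Rs. t = enc_list (enc_list (enc_list enc_nat)) Rs \<and> length Rs = length \<tau> \<and>
    (\<forall>r < length \<tau>. set (Rs ! r) \<subseteq> tuples n (\<tau> ! r)))"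
proof (induction \<tau> arbitrary: t)
  case Nil
  then show ?case by auto
next
  case (Cons a \<tau>)
  have rel: "(\<forall>y \<in> set (ls u). y \<in> set (cands a z)) \<longleftrightarrow>
    (\<exists>R. u = enc_list (enc_list enc_nat) R \<and> set R \<subseteq> tuples n a)" for u
  proof
    assume "\<forall>y \<in> set (ls u). y \<in> set (cands a z)"
    then have "set (ls u) \<subseteq> enc_list enc_nat ` tuples n a" by (auto simp: set_cands_unary[OF assms])
    then obtain R where "set R \<subseteq> tuples n a" "ls u = map (enc_list enc_nat) R"
      by (metis subset_code(1) lists_image in_lists_conv_set image_iff lists_eq_set mem_Collect_eq)
    then show "\<exists>R. u = enc_list (enc_list enc_nat) R \<and> set R \<subseteq> tuples n a"
      by (metis enc_list_conv_mk mk_ls)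
  qed (auto simp: set_cands_unary[OF assms] enc_list_conv_mk[of "enc_list enc_nat"] intro!: imageI)
  show ?case
  proof (cases t)
    case Leaf
    have "enc_list (enc_list (enc_list enc_nat)) Rs \<noteq> Leaf" if "length Rs = length (a # \<tau>)" for Rs
      using that by (cases Rs) auto
    then show ?thesis using Leaf by (metis rels_ok.simps(2))
  next
    case (Node u t')
    have "rels_ok (a # \<tau>) z t \<longleftrightarrow> (\<exists>R Rs. u = enc_list (enc_list enc_nat) R \<and> set R \<subseteq> tuples n a \<and>
      t' = enc_list (enc_list (enc_list enc_nat)) Rs \<and> length Rs = length \<tau> \<and>
      (\<forall>r < length \<tau>. set (Rs ! r) \<subseteq> tuples n (\<tau> ! r)))"
      unfolding Node rels_ok.simps thd.simps ttl.simps rel Cons.IH by blast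
    also have "\<dots> \<longleftrightarrow> (\<exists>Rs. t = enc_list (enc_list (enc_list enc_nat)) Rs \<and> length Rs = length (a # \<tau>) \<and>
      (\<forall>r < length (a # \<tau>). set (Rs ! r) \<subseteq> tuples n ((a # \<tau>) ! r)))" (is "?A \<longleftrightarrow> ?B")
    proof
      assume ?A
      then obtain R Rs where R: "u = enc_list (enc_list enc_nat) R" "set R \<subseteq> tuples n a"
        "t' = enc_list (enc_list (enc_list enc_nat)) Rs" "length Rs = length \<tau>"
        "\<forall>r < length \<tau>. set (Rs ! r) \<subseteq> tuples n (\<tau> ! r)" by blast
      have "set ((R # Rs) ! r) \<subseteq> tuples n ((a # \<tau>) ! r)" if "r < length (a # \<tau>)" for r
        using that R(2,5) by (cases r) simp_all
      then show ?B using R unfolding Node by (intro exI[of _ "R # Rs"]) simp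
    next
      assume ?B
      then obtain Rs where Rs: "t = enc_list (enc_list (enc_list enc_nat)) Rs" "length Rs = length (a # \<tau>)"
        "\<And>r. r < length (a # \<tau>) \<Longrightarrow> set (Rs ! r) \<subseteq> tuples n ((a # \<tau>) ! r)" by blast
      then obtain R Rs' where "Rs = R # Rs'" by (cases Rs) auto
      then show ?A using Rs(1,2) Rs(3)[of 0] Rs(3)[of "Suc _"] unfolding Node
        by (intro exI[of _ R] exI[of _ Rs']) auto
    qed
    finally show ?thesis .
  qed
qed

text \<open>A reduction has to treat every tree, so it must itself decide whether the input encodes
  a structure of the vocabulary.\<close>

lemma valid_iff: "valid \<tau> (Node x kt) \<longleftrightarrow> (\<exists>n Rs. wf_struct \<tau> (n, Rs) \<and> x = enc_struct (n, Rs))"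
proof
  let ?z = "Node x kt"
  assume v: "valid \<tau> ?z"
  then obtain n where n: "thd x = enc_unary n" using enc_unary_iff[of "thd x"] by (auto simp: valid_def)
  obtain Rs where "ttl x = enc_list (enc_list (enc_list enc_nat)) Rs" "length Rs = length \<tau>"
    "\<forall>r < length \<tau>. set (Rs ! r) \<subseteq> tuples n (\<tau> ! r)"
    using v rels_ok_iff[of ?z n \<tau> "ttl x"] n by (auto simp: valid_def)
  moreover have "n \<noteq> 0" using v n by (cases "n = 0") (auto simp: valid_def)
  moreover have "x \<noteq> Leaf" using v by (auto simp: valid_def)
  ultimately show "\<exists>n Rs. wf_struct \<tau> (n, Rs) \<and> x = enc_struct (n, Rs)"
    using n by (intro exI[of _ n] exI[of _ Rs]) (cases x; auto simp: wf_struct_def enc_struct_def)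
next
  let ?z = "Node x kt"
  assume "\<exists>n Rs. wf_struct \<tau> (n, Rs) \<and> x = enc_struct (n, Rs)"
  then obtain n Rs where nR: "wf_struct \<tau> (n, Rs)" "x = enc_struct (n, Rs)" by blast
  then have n: "thd (thd ?z) = enc_unary n" by (simp add: enc_struct_def)
  have "enc_unary n \<noteq> Leaf" using nR(1) by (cases n) (auto simp: wf_struct_def)
  moreover have "rels_ok \<tau> ?z (ttl (thd ?z))"
    unfolding rels_ok_iff[OF n] using nR by (auto simp: wf_struct_def enc_struct_def)
  ultimately show "valid \<tau> ?z" unfolding valid_def n using enc_unary_iff[of "enc_unary n"] by blast
qed

lemma hits_iff_p_WD:
  assumes s: "s \<ge> 1" and \<phi>: "wf_fm \<tau> s \<phi>" "free_vars \<phi> = {}" "Pi_fm 2 \<phi>" "all_vars \<phi> \<subseteq> {..<M}"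
    and m: "m = 2 * xcount \<phi> + 1" and z: "z = Node x (enc_unary k)"
  shows "(\<exists>H \<subseteq> set (guesses s m z). card H \<le> length (slots m z) \<and>
    (\<forall>c \<in> set (clauses s m M z). \<exists>e \<in> H. hits \<tau> (strip_all \<phi>) z e c)) \<longleftrightarrow> (x, k) \<in> p_WD \<tau> s \<phi>"
    (is "?L \<longleftrightarrow> _")
proof (cases "valid \<tau> z")
  case False
  \<comment> \<open>There are \<open>(k + 2) ^ m\<close> slots, so some clause exists, which nothing
    hits on a malformed input.\<close>
  have "length (slots m z) > 0" by (simp add: z length_slots)
  then obtain \<sigma> where "\<sigma> \<in> set (slots m z)" by (cases "slots m z") auto
  then have "Node (tag 1) \<sigma> \<in> set (clauses s m M z)" by (simp add: clauses_def)
  then have "\<not> ?L" using False unfolding hits_def by blast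
  moreover have "(x, k) \<notin> p_WD \<tau> s \<phi>" using False unfolding p_WD_def z valid_iff by auto
  ultimately show ?thesis by blast
next
  case True
  have clauses: "(\<forall>c \<in> set (clauses s m M z). \<exists>e \<in> H. hits \<tau> (strip_all \<phi>) z e c) \<longleftrightarrow>
      (\<forall>\<sigma> \<in> set (slots m z). \<exists>e \<in> H. slot e = \<sigma>) \<and>
      (\<forall>e \<in> set (guesses s m z). \<forall>\<sigma> \<in> set (slots m z). \<exists>e' \<in> H.
        (slot e' = slot e \<and> e' \<noteq> e) \<or> (slot e' = \<sigma> \<and> compatible e e')) \<and>
      (\<forall>v \<in> set (vals M z). \<exists>e \<in> H. tev True (strip_all \<phi>) v e z)" for H
    unfolding clauses_def hits_def using True by (simp add: ball_Un)
  \<comment> \<open>This is stated for every decoding of \<open>x\<close>, because membership in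
    \<open>p_WD\<close> comes with a decoding of its own.\<close>
  have iff: "?L \<longleftrightarrow> (\<exists>S \<subseteq> tuples n s. card S = k \<and> sat n (\<lambda>r. set (Rs ! r)) S (\<lambda>_. 0) \<phi>)"
    if "wf_struct \<tau> (n, Rs)" "x = enc_struct (n, Rs)" for n Rs
  proof -
    interpret wd_instance \<tau> s n Rs k M z by unfold_locales (use that s z in auto)
    show ?thesis unfolding clauses by (rule hitting_set_iff[OF \<phi> m])
  qed
  obtain n Rs where nR: "wf_struct \<tau> (n, Rs)" "x = enc_struct (n, Rs)" using True valid_iff z by blast
  show ?thesis
  proof
    assume ?L
    with iff[OF nR] have "\<exists>S \<subseteq> tuples n s. card S = k \<and> sat n (\<lambda>r. set (Rs ! r)) S (\<lambda>_. 0) \<phi>"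
      by (rule iffD1)
    with nR have "\<exists>n Rs k'. (x, k) = (enc_struct (n, Rs), k') \<and> wf_struct \<tau> (n, Rs) \<and>
      (\<exists>S \<subseteq> tuples n s. card S = k' \<and> sat n (\<lambda>r. set (Rs ! r)) S (\<lambda>_. 0) \<phi>)"
      by (intro exI[of _ n] exI[of _ Rs] exI[of _ k] conjI) simp_all
    then show "(x, k) \<in> p_WD \<tau> s \<phi>" unfolding p_WD_def by (rule CollectI)
  next
    assume "(x, k) \<in> p_WD \<tau> s \<phi>"
    from this[unfolded p_WD_def mem_Collect_eq] obtain n' Rs' k' where
      *: "(x, k) = (enc_struct (n', Rs'), k') \<and> wf_struct \<tau> (n', Rs') \<and>
        (\<exists>S \<subseteq> tuples n' s. card S = k' \<and> sat n' (\<lambda>r. set (Rs' ! r)) S (\<lambda>_. 0) \<phi>)"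
      by (elim exE) (rule that)
    then have nR': "wf_struct \<tau> (n', Rs')" "x = enc_struct (n', Rs')" by simp_all
    from * have S: "\<exists>S \<subseteq> tuples n' s. card S = k \<and> sat n' (\<lambda>r. set (Rs' ! r)) S (\<lambda>_. 0) \<phi>"
      unfolding prod.inject by (elim conjE) (simp only:)
    from iff[OF nR'] S show ?L by (rule iffD2)
  qed
qed

section \<open>Polynomial-time computability of guesses, clauses and hits\<close>

lemma plist_universe [ptime_intros]: "ptime Z \<Longrightarrow> plist (\<lambda>x. universe (Z x))"
  unfolding universe_def by (intro ptime_intros)

lemma plist_cands [ptime_intros]: "ptime Z \<Longrightarrow> plist (\<lambda>x. cands s (Z x))"
  unfolding cands_def by (intro ptime_intros)

lemma plist_ranks [ptime_intros]: "ptime Z \<Longrightarrow> plist (\<lambda>x. ranks (Z x))"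
  unfolding ranks_def by (intro ptime_intros)

lemma plist_places [ptime_intros]: "ptime Z \<Longrightarrow> plist (\<lambda>x. places s (Z x))"
  unfolding places_def by (intro ptime_intros)

lemma plist_entries [ptime_intros]:
  assumes "ptime Z"
  shows "plist (\<lambda>x. entries s (Z x))"
  unfolding entries_def by (intro ptime_intros assms ptime_comp[OF assms])

lemma plist_guesses [ptime_intros]: "ptime Z \<Longrightarrow> plist (\<lambda>x. guesses s m (Z x))"
  unfolding guesses_def by (intro ptime_intros)

lemma ptime_slot [ptime_intros]: "ptime E \<Longrightarrow> ptime (\<lambda>x. slot (E x))"
  unfolding slot_def by (intro ptime_intros)

lemma plist_slots [ptime_intros]: "ptime Z \<Longrightarrow> plist (\<lambda>x. slots m (Z x))"
  unfolding slots_def by (intro ptime_intros)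

lemma plist_vals [ptime_intros]: "ptime Z \<Longrightarrow> plist (\<lambda>x. vals M (Z x))"
  unfolding vals_def by (intro ptime_intros)

lemma pdec_compatible [ptime_intros]:
  assumes "ptime E" "ptime F"
  shows "pdec (\<lambda>x. compatible (E x) (F x))"
  unfolding compatible_def by (intro ptime_intros assms ptime_comp[OF assms(2)])

lemma pdec_inX [ptime_intros]:
  assumes "ptime Z" "ptime C" "ptime E"
  shows "pdec (\<lambda>x. inX (Z x) (C x) (E x))"
  unfolding inX_def by (intro ptime_intros assms ptime_comp[OF assms(1)] ptime_comp[OF assms(2)])

lemma pdec_outX [ptime_intros]:
  assumes "ptime C" "ptime E"
  shows "pdec (\<lambda>x. outX (C x) (E x))"
  unfolding outX_def by (intro ptime_intros assms ptime_comp[OF assms(1)] ptime_comp[OF assms(2)])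

lemma ptime_tnth [ptime_intros]: "ptime F \<Longrightarrow> ptime (\<lambda>x. tnth i (F x))"
proof (induction i arbitrary: F)
  case (Suc i)
  show ?case unfolding tnth.simps by (intro Suc.IH ptime_ttl Suc.prems)
qed (unfold tnth.simps, rule ptime_thd)

lemma ptime_tupd [ptime_intros]: "ptime F \<Longrightarrow> ptime G \<Longrightarrow> ptime (\<lambda>x. tupd i (G x) (F x))"
proof (induction i arbitrary: F)
  case 0
  show ?case unfolding tupd.simps by (intro ptime_intros 0)
next
  case (Suc i)
  show ?case unfolding tupd.simps by (intro Suc.IH ptime_intros Suc.prems)
qed

lemma ptime_tnths [ptime_intros]: "ptime F \<Longrightarrow> ptime (\<lambda>x. mk (map (\<lambda>i. tnth i (F x)) xs))"
proof (induction xs)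
  case (Cons i xs)
  show ?case unfolding list.map mk.simps by (intro ptime_Node ptime_tnth Cons)
qed (unfold list.map mk.simps, rule ptime_const)

lemma pdec_eq_bool: "pdec P \<Longrightarrow> pdec (\<lambda>x. P x = p)"
  using pdec_not[of P] by (cases p) simp_all

text \<open>The formula is fixed, so the recursion over it unfolds into one program in which each
  existential quantifier becomes a loop over the universe.\<close>

lemma pdec_tev [ptime_intros]:
  "ptime V \<Longrightarrow> ptime E \<Longrightarrow> ptime Z \<Longrightarrow> pdec (\<lambda>x. tev p \<phi> (V x) (E x) (Z x))"
proof (induction \<phi> arbitrary: p V E Z)
  case (Ex y \<phi>)
  show ?case unfolding tev.simps
    by (intro ptime_intros Ex.IH Ex.prems Ex.prems[THEN ptime_comp])
next
  case (Eq y y')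
  then show ?case unfolding tev.simps by (intro pdec_eq_bool ptime_intros)
next
  case (Rel r xs)
  then show ?case unfolding tev.simps by (intro pdec_eq_bool ptime_tnths ptime_intros)
next
  case (XRel xs)
  then show ?case unfolding tev.simps by (intro ptime_tnths pdec_If pdec_inX pdec_outX pdec_const)
next
  case (All y \<phi>)
  show ?case unfolding tev.simps by (rule pdec_const)
next
  case (Neg \<phi>)
  then show ?case by simp
next
  case (Conj \<phi> \<psi>)
  show ?case unfolding tev.simps by (intro ptime_intros Conj.IH Conj.prems)
next
  case (Disj \<phi> \<psi>)
  show ?case unfolding tev.simps by (intro ptime_intros Disj.IH Disj.prems)
qed

lemma pdec_rels_ok [ptime_intros]: "ptime Z \<Longrightarrow> ptime T \<Longrightarrow> pdec (\<lambda>x. rels_ok \<tau> (Z x) (T x))"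
proof (induction \<tau> arbitrary: T)
  case (Cons a \<tau>)
  show ?case unfolding rels_ok.simps
    by (intro ptime_intros Cons.IH Cons.prems Cons.prems(1)[THEN ptime_comp])
qed (unfold rels_ok.simps, intro ptime_intros)

lemma pdec_valid [ptime_intros]: "ptime Z \<Longrightarrow> pdec (\<lambda>x. valid \<tau> (Z x))"
  unfolding valid_def by (intro ptime_intros)

lemma pdec_hits [ptime_intros]:
  "ptime Z \<Longrightarrow> ptime E \<Longrightarrow> ptime C \<Longrightarrow> pdec (\<lambda>x. hits \<tau> \<theta> (Z x) (E x) (C x))"
  unfolding hits_def by (intro ptime_intros)

lemma plist_clauses [ptime_intros]:
  assumes "ptime Z"
  shows "plist (\<lambda>x. clauses s m M (Z x))"
  unfolding clauses_def by (intro ptime_intros assms ptime_comp[OF assms])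

section \<open>Encoding the spanner instance\<close>

lemma enc_edge_inject: "enc_edge e = enc_edge e' \<longleftrightarrow> e = e'"
  by (cases e; cases e') (simp add: enc_edge_def)

text \<open>The truncation by \<open>nat\<close> loses only negative values, so the positive results
  3 and 1 determine numerator and denominator.\<close>

lemma enc_rat_eq_3: "enc_rat \<alpha> = enc_rat 3 \<longleftrightarrow> \<alpha> = 3"
proof
  assume eq: "enc_rat \<alpha> = enc_rat 3"
  obtain p q where pq: "quotient_of \<alpha> = (p, q)" by (cases "quotient_of \<alpha>")
  have 3: "quotient_of 3 = (3, 1)" by simp
  have "nat p = 3" "nat q = 1" using eq by (simp_all add: enc_rat_def pq 3)
  then have "quotient_of \<alpha> = quotient_of 3" using pq 3 by auto
  then show "\<alpha> = 3" by (rule quotient_of_inject)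
qed simp

lemma encodes_spanner_instance_iff:
  "encodes_spanner_instance (Node (enc_unary N) (Node (enc_list enc_edge es) (enc_rat 3))) V E w l \<alpha> \<longleftrightarrow>
    \<alpha> = 3 \<and> V = {..<N} \<and> E = {{u, v} | u v a b. (u, v, a, b) \<in> set es} \<and>
    (\<forall>(u, v, a, b) \<in> set es. w {u, v} = a \<and> l {u, v} = b)"
proof -
  have "inj enc_edge" by (simp add: inj_on_def enc_edge_inject)
  then have es: "enc_list enc_edge es = enc_list enc_edge es' \<longleftrightarrow> es = es'" for es'
    by (simp add: enc_list_conv_mk inj_map_eq_map)
  have "enc_rat 3 = enc_rat \<alpha> \<longleftrightarrow> \<alpha> = 3" using enc_rat_eq_3[of \<alpha>] by metis
  then show ?thesis unfolding encodes_spanner_instance_def tree.inject enc_unary_inject es by blast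
qed

text \<open>The tags 1 to 4 stand for \<open>p\<close>, \<open>a\<close>, \<open>x\<close>,
  \<open>y\<close>, tag 5 for elements and tag 6 for sets to be hit. All edges are directed from an
  odd to an even tag, that is, from one side of the bipartition to the other.\<close>

definition free_edge :: "(tree \<Rightarrow> tree \<Rightarrow> bool) \<Rightarrow> tree \<Rightarrow> tree \<Rightarrow> bool" where
  "free_edge h p q \<longleftrightarrow> thd p = tag 1 \<and> thd q = tag 2 \<or> thd p = tag 3 \<and> thd q = tag 2 \<or>
     thd p = tag 3 \<and> thd q = tag 4 \<or> thd p = tag 5 \<and> thd q = tag 4 \<or>
     thd p = tag 5 \<and> thd q = tag 6 \<and> h (ttl p) (ttl q)"

definition unit_edge :: "tree \<Rightarrow> tree \<Rightarrow> bool" where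
  "unit_edge p q \<longleftrightarrow> thd p = tag 5 \<and> thd q = tag 2"

definition heavy_edge :: "tree \<Rightarrow> tree \<Rightarrow> bool" where
  "heavy_edge p q \<longleftrightarrow> thd p = tag 1 \<and> thd q = tag 6"

text \<open>Vertices are numbered from the end of the list, so the four special vertices get the
  numbers 0 to 3 whatever the instance is.\<close>

definition labels :: "tree list \<Rightarrow> tree list \<Rightarrow> tree list" where
  "labels G C = map (\<lambda>e. Node (tag 5) e) G @ map (\<lambda>c. Node (tag 6) c) C @
     [Node (tag 4) Leaf, Node (tag 3) Leaf, Node (tag 2) Leaf, Node (tag 1) Leaf]"

text \<open>The vertex with label \<open>rev L ! u\<close> has number \<open>u\<close>: this is the length of the list of labels
  that follow it in \<open>L\<close>, so no search is needed to compute it.\<close>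

definition graph_edges :: "(tree \<Rightarrow> tree \<Rightarrow> bool) \<Rightarrow> nat \<Rightarrow> tree list \<Rightarrow> (nat \<times> nat \<times> nat \<times> nat) list" where
  "graph_edges h K L = concat (map (\<lambda>t. concat (map (\<lambda>t'.
     (if free_edge h (thd t) (thd t') then [(length (ls (ttl t)), length (ls (ttl t')), 0, 1)] else []) @
     (if unit_edge (thd t) (thd t') then [(length (ls (ttl t)), length (ls (ttl t')), 1, 1)] else []) @
     (if heavy_edge (thd t) (thd t') then [(length (ls (ttl t)), length (ls (ttl t')), K + 1, 1)] else []))
     (ptl (Node Leaf (mk L))))) (ptl (Node Leaf (mk L))))"

definition spanner_tree :: "(tree \<Rightarrow> tree \<Rightarrow> bool) \<Rightarrow> nat \<Rightarrow> tree list \<Rightarrow> tree" where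
  "spanner_tree h K L =
     Node (enc_unary (length L)) (Node (enc_list enc_edge (graph_edges h K L)) (enc_rat 3))"

text \<open>A suffix yields its head as the label and the length of its tail as the number. The
  condition \<open>p \<noteq> Leaf\<close> discards the empty suffix, which belongs to no
  vertex.\<close>

lemma ptl_labels:
  "(\<exists>t \<in> set (ptl (Node a (mk L))). thd t = p \<and> length (ls (ttl t)) = u \<and> p \<noteq> Leaf) \<longleftrightarrow>
    u < length L \<and> rev L ! u = p \<and> p \<noteq> Leaf"
proof (induction L arbitrary: a)
  case (Cons c L)
  have "(\<exists>t \<in> set (ptl (Node a (mk (c # L)))). thd t = p \<and> length (ls (ttl t)) = u \<and> p \<noteq> Leaf) \<longleftrightarrow>
    c = p \<and> length L = u \<and> p \<noteq> Leaf \<or> u < length L \<and> rev L ! u = p \<and> p \<noteq> Leaf"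
    using Cons[of c] by simp
  also have "\<dots> \<longleftrightarrow> u < length (c # L) \<and> rev (c # L) ! u = p \<and> p \<noteq> Leaf"
    by (auto simp: nth_append less_Suc_eq)
  finally show ?case .
qed auto

lemma mem_graph_edges:
  "(u, v, a, b) \<in> set (graph_edges h K L) \<longleftrightarrow> u < length L \<and> v < length L \<and> b = 1 \<and>
    (free_edge h (rev L ! u) (rev L ! v) \<and> a = 0 \<or> unit_edge (rev L ! u) (rev L ! v) \<and> a = 1 \<or>
     heavy_edge (rev L ! u) (rev L ! v) \<and> a = K + 1)"
proof -
  define Q where "Q p q \<longleftrightarrow> b = 1 \<and> (free_edge h p q \<and> a = 0 \<or> unit_edge p q \<and> a = 1 \<or>
    heavy_edge p q \<and> a = K + 1)" for p q
  have Q: "p \<noteq> Leaf \<and> q \<noteq> Leaf" if "Q p q" for p q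
    using that by (auto simp: Q_def free_edge_def unit_edge_def heavy_edge_def)
  let ?sf = "set (ptl (Node Leaf (mk L)))"
  have "(u, v, a, b) \<in> set (graph_edges h K L) \<longleftrightarrow>
    (\<exists>t \<in> ?sf. \<exists>t' \<in> ?sf. length (ls (ttl t)) = u \<and> length (ls (ttl t')) = v \<and> Q (thd t) (thd t'))"
    by (auto simp: graph_edges_def Q_def simp del: ptl.simps split: if_splits)
  also have "\<dots> \<longleftrightarrow> (\<exists>p q. (\<exists>t \<in> ?sf. thd t = p \<and> length (ls (ttl t)) = u \<and> p \<noteq> Leaf) \<and>
    (\<exists>t \<in> ?sf. thd t = q \<and> length (ls (ttl t)) = v \<and> q \<noteq> Leaf) \<and> Q p q)"
    using Q by blast
  also have "\<dots> \<longleftrightarrow> u < length L \<and> v < length L \<and> Q (rev L ! u) (rev L ! v)"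
    unfolding ptl_labels using Q by blast
  finally show ?thesis unfolding Q_def by blast
qed

text \<open>No edge gets two weights, so the three classes do define a weight function.\<close>

lemma hitting_gadget_weights:
  assumes "distinct [p, a, x, y]" "{p, a, x, y} \<inter> EL = {}" "{p, a, x, y} \<inter> ST = {}" "EL \<inter> ST = {}"
    and "E0 = {{p, a}, {x, a}, {x, y}} \<union> {{e, y} | e. e \<in> EL} \<union> {{e, c} | e c. e \<in> EL \<and> c \<in> ST \<and> M e c}"
    and "E1 = {{e, a} | e. e \<in> EL}" and "E2 = {{p, c} | c. c \<in> ST}"
  shows "E0 \<inter> E1 = {}" "E0 \<inter> E2 = {}" "E1 \<inter> E2 = {}"
  using assms by (auto simp: doubleton_eq_iff)

section \<open>The numbered graph is an instance of the gadget\<close>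

locale labelled_gadget =
  fixes h :: "tree \<Rightarrow> tree \<Rightarrow> bool" and K :: nat and G C :: "tree list"
begin

abbreviation "L \<equiv> labels G C"
abbreviation "N \<equiv> length L"
abbreviation "D \<equiv> rev L"
definition "EL = {u. u < N \<and> thd (D ! u) = tag 5}"
definition "ST = {u. u < N \<and> thd (D ! u) = tag 6}"
abbreviation "M u v \<equiv> h (ttl (D ! u)) (ttl (D ! v))"
definition "E0 = {{0, 1}, {2, 1}, {2, 3}} \<union> {{e, 3} | e. e \<in> EL} \<union>
  {{e, c} | e c. e \<in> EL \<and> c \<in> ST \<and> M e c}"
definition "E1 = {{e, 1 :: nat} | e. e \<in> EL}"
definition "E2 = {{0 :: nat, c} | c. c \<in> ST}"
abbreviation "es \<equiv> graph_edges h K L"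
abbreviation "E \<equiv> {{u, v} | u v a b. (u, v, a, b) \<in> set es}"

lemma D_eq: "D = [Node (tag 1) Leaf, Node (tag 2) Leaf, Node (tag 3) Leaf, Node (tag 4) Leaf] @
    rev (map (\<lambda>c. Node (tag 6) c) C) @ rev (map (\<lambda>e. Node (tag 5) e) G)"
  by (simp add: labels_def)

lemma N_eq: "N = 4 + length C + length G"
  by (simp add: labels_def)

lemma D_specials: "D ! 0 = Node (tag 1) Leaf" "D ! 1 = Node (tag 2) Leaf"
  "D ! 2 = Node (tag 3) Leaf" "D ! 3 = Node (tag 4) Leaf"
  unfolding D_eq by (simp_all add: numeral_eq_Suc)

lemma D_rest:
  assumes "4 \<le> u" "u < N"
  shows "(\<exists>c \<in> set C. D ! u = Node (tag 6) c) \<or> (\<exists>e \<in> set G. D ! u = Node (tag 5) e)"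
proof -
  let ?R = "rev (map (\<lambda>c. Node (tag 6) c) C) @ rev (map (\<lambda>e. Node (tag 5) e) G)"
  obtain i where i: "u = Suc (Suc (Suc (Suc i)))" using assms(1) by (auto simp: le_iff_add)
  have "D ! u = ?R ! i" unfolding D_eq i by simp
  moreover have "i < length ?R" using assms by (simp add: N_eq i)
  ultimately have "D ! u \<in> set ?R" using nth_mem by metis
  then show ?thesis by auto
qed

lemma D_tag:
  assumes "u < N"
  shows "thd (D ! u) = tag 1 \<longleftrightarrow> u = 0" "thd (D ! u) = tag 2 \<longleftrightarrow> u = 1"
    "thd (D ! u) = tag 3 \<longleftrightarrow> u = 2" "thd (D ! u) = tag 4 \<longleftrightarrow> u = 3"
    "thd (D ! u) = tag 5 \<or> thd (D ! u) = tag 6 \<longleftrightarrow> u \<ge> 4"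
proof -
  consider "u = 0" | "u = 1" | "u = 2" | "u = 3" | "u \<ge> 4" by linarith
  then have "(thd (D ! u) = tag 1 \<longleftrightarrow> u = 0) \<and> (thd (D ! u) = tag 2 \<longleftrightarrow> u = 1) \<and>
    (thd (D ! u) = tag 3 \<longleftrightarrow> u = 2) \<and> (thd (D ! u) = tag 4 \<longleftrightarrow> u = 3) \<and>
    (thd (D ! u) = tag 5 \<or> thd (D ! u) = tag 6 \<longleftrightarrow> u \<ge> 4)"
  proof cases
    case 5
    then show ?thesis using D_rest[OF 5 assms] by auto
  qed (simp_all only: D_specials thd.simps tag_eq_iff, simp_all)
  then show "thd (D ! u) = tag 1 \<longleftrightarrow> u = 0" "thd (D ! u) = tag 2 \<longleftrightarrow> u = 1"
    "thd (D ! u) = tag 3 \<longleftrightarrow> u = 2" "thd (D ! u) = tag 4 \<longleftrightarrow> u = 3"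
    "thd (D ! u) = tag 5 \<or> thd (D ! u) = tag 6 \<longleftrightarrow> u \<ge> 4" by blast+
qed

lemma EL_ST: "EL \<inter> ST = {}" "EL \<union> ST = {4..<N}"
proof -
  show "EL \<inter> ST = {}" by (auto simp: EL_def ST_def)
  have "u \<in> EL \<union> ST \<longleftrightarrow> u \<in> {4..<N}" for u
    using D_tag(5)[of u] unfolding EL_def ST_def by (cases "u < N") simp_all
  then show "EL \<union> ST = {4..<N}" by blast
qed

lemma special_disjoint: "{0, 1, 2, 3} \<inter> EL = {}" "{0, 1, 2, 3} \<inter> ST = {}"
proof -
  have "{0, 1, 2, 3} \<inter> (EL \<union> ST) = {}" unfolding EL_ST(2) by auto
  then show "{0, 1, 2, 3} \<inter> EL = {}" "{0, 1, 2, 3} \<inter> ST = {}" by blast+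
qed

context
  fixes u v
  assumes u: "u < N" and v: "v < N"
begin

lemma edges_free: "free_edge h (D ! u) (D ! v) \<longleftrightarrow> u = 0 \<and> v = 1 \<or> u = 2 \<and> v = 1 \<or>
    u = 2 \<and> v = 3 \<or> u \<in> EL \<and> v = 3 \<or> u \<in> EL \<and> v \<in> ST \<and> M u v"
  unfolding free_edge_def D_tag(1-4)[OF u] D_tag(1-4)[OF v] EL_def ST_def using u v by simp

lemma edges_unit: "unit_edge (D ! u) (D ! v) \<longleftrightarrow> u \<in> EL \<and> v = 1"
  unfolding unit_edge_def D_tag(1-4)[OF u] D_tag(1-4)[OF v] EL_def using u v by simp

lemma edges_heavy: "heavy_edge (D ! u) (D ! v) \<longleftrightarrow> u = 0 \<and> v \<in> ST"
  unfolding heavy_edge_def D_tag(1-4)[OF u] D_tag(1-4)[OF v] ST_def using u v by simp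

end

lemma mem_es: "(u, v, a, b) \<in> set es \<longleftrightarrow> b = 1 \<and>
    ((u = 0 \<and> v = 1 \<or> u = 2 \<and> v = 1 \<or> u = 2 \<and> v = 3 \<or> u \<in> EL \<and> v = 3 \<or> u \<in> EL \<and> v \<in> ST \<and> M u v) \<and> a = 0 \<or>
     u \<in> EL \<and> v = 1 \<and> a = 1 \<or> u = 0 \<and> v \<in> ST \<and> a = K + 1)"
    (is "_ \<longleftrightarrow> ?R")
proof -
  have "4 \<le> N" by (simp add: N_eq)
  moreover have "u < N" if "u \<in> EL" for u using that by (simp add: EL_def)
  moreover have "v < N" if "v \<in> ST" for v using that by (simp add: ST_def)
  ultimately have bound: "u < N \<and> v < N" if "u = 0 \<and> v = 1 \<or> u = 2 \<and> v = 1 \<or> u = 2 \<and> v = 3 \<or>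
    u \<in> EL \<and> (v = 3 \<or> v = 1 \<or> v \<in> ST) \<or> u = 0 \<and> v \<in> ST" for u v
    using that by auto
  show ?thesis
  proof (cases "u < N \<and> v < N")
    case True
    then have u: "u < N" and v: "v < N" by blast+
    show ?thesis unfolding mem_graph_edges edges_free[OF u v] edges_unit[OF u v] edges_heavy[OF u v]
      by (simp only: u v simp_thms conj_assoc)
  next
    case False
    then have "(u, v, a, b) \<notin> set es" unfolding mem_graph_edges by blast
    moreover have "\<not> ?R"
    proof
      assume ?R
      then have "u < N \<and> v < N" by (intro bound) blast
      with False show False by blast
    qed
    ultimately show ?thesis by blast
  qed
qed

lemma E_eq: "E = E0 \<union> E1 \<union> E2"
  unfolding mem_es E0_def E1_def E2_def by auto

lemma gadget:
  assumes "\<forall>(u, v, a, b) \<in> set es. w {u, v} = a \<and> l {u, v} = b"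
  shows "hitting_gadget 0 1 2 3 EL ST M K {..<N} E E0 E1 E2 w l"
proof
  have wl: "w {u, v} = a \<and> l {u, v} = b" if "(u, v, a, b) \<in> set es" for u v a b
    using assms that by blast
  show "finite EL" "finite ST" by (simp_all add: EL_def ST_def)
  show "{..<N} = {0, 1, 2, 3} \<union> EL \<union> ST" using EL_ST(2) by (auto simp: N_eq)
  show "w e = 0" if "e \<in> E0" for e
  proof -
    from that obtain u v where "e = {u, v}" "(u, v, 0, 1) \<in> set es" unfolding E0_def mem_es by blast
    then show ?thesis using wl[of u v "0" 1] by simp
  qed
  show "w e = 1" if "e \<in> E1" for e
  proof -
    from that obtain u v where "e = {u, v}" "(u, v, 1, 1) \<in> set es" unfolding E1_def mem_es by blast
    then show ?thesis using wl[of u v "1" 1] by simp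
  qed
  show "w e = K + 1" if "e \<in> E2" for e
  proof -
    from that obtain u v where "e = {u, v}" "(u, v, K + 1, 1) \<in> set es" unfolding E2_def mem_es by blast
    then show ?thesis using wl[of u v "K + 1" 1] by simp
  qed
  show "l e = 1" if "e \<in> E" for e
  proof -
    from that obtain u v a b where "e = {u, v}" "(u, v, a, b) \<in> set es" by blast
    then show ?thesis using wl[of u v a b] mem_es[of u v a b] by simp
  qed
qed (use EL_ST special_disjoint E_eq E0_def E1_def E2_def in auto)

lemma weights_exist: "\<exists>w l. \<forall>(u, v, a, b) \<in> set es. w {u, v} = a \<and> l {u, v} = (b :: nat)"
proof -
  have disj: "E0 \<inter> E1 = {}" "E0 \<inter> E2 = {}" "E1 \<inter> E2 = {}"
    by (rule hitting_gadget_weights[OF _ special_disjoint EL_ST(1) E0_def E1_def E2_def], simp)+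
  let ?w = "\<lambda>e. if e \<in> E0 then 0 else if e \<in> E1 then 1 else K + 1" and ?l = "\<lambda>_ :: nat set. 1 :: nat"
  have "?w {u, v} = a \<and> ?l {u, v} = b" if m: "(u, v, a, b) \<in> set es" for u v a b
  proof -
    have "b = 1" "{u, v} \<in> E0 \<and> a = 0 \<or> {u, v} \<in> E1 \<and> a = 1 \<or> {u, v} \<in> E2 \<and> a = K + 1"
      using m unfolding mem_es E0_def E1_def E2_def by blast+
    then show ?thesis using disj by auto
  qed
  note * = this
  show ?thesis
  proof (rule exI[of _ ?w], rule exI[of _ ?l], rule ballI)
    fix e assume e: "e \<in> set es"
    obtain u v a b where eq: "e = (u, v, a, b)" by (rule prod_cases4)
    show "case e of (u, v, a, b) \<Rightarrow> ?w {u, v} = a \<and> ?l {u, v} = b"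
      unfolding eq prod.case by (rule *[OF e[unfolded eq]])
  qed
qed

lemma encodes_iff: "encodes_spanner_instance (spanner_tree h K L) V F w l \<alpha> \<longleftrightarrow>
    \<alpha> = 3 \<and> V = {..<N} \<and> F = E \<and> (\<forall>(u, v, a, b) \<in> set es. w {u, v} = a \<and> l {u, v} = b)"
  unfolding spanner_tree_def by (rule encodes_spanner_instance_iff)

lemma spanner_tree_in_class: "(spanner_tree h K L, K) \<in> bipartite_unit_length_three_weights 3"
proof -
  obtain w l where wl: "\<forall>(u, v, a, b) \<in> set es. w {u, v} = a \<and> l {u, v} = b" using weights_exist by blast
  interpret hitting_gadget 0 1 2 3 EL ST "\<lambda>u v. M u v" K "{..<N}" E E0 E1 E2 w l by (rule gadget[OF wl])
  have "encodes_spanner_instance (spanner_tree h K L) {..<N} E w l 3" using wl by (simp only: encodes_iff)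
  note enc = this
  have "\<exists>V E w l. encodes_spanner_instance (spanner_tree h K L) V E w l 3 \<and> spanner_instance V E w l 3 \<and>
    (\<forall>e \<in> E. l e = 1) \<and> bipartite_graph V E \<and> card (w ` E) \<le> 3"
    by (rule exI, rule exI, rule exI, rule exI, rule conjI[OF enc])
      (intro conjI instance_ok bipartite weights ballI l, simp)
  then show ?thesis unfolding bipartite_unit_length_three_weights_def mem_Collect_eq prod.case .
qed

text \<open>An encoding fixes weights and lengths on the edges only. From left to right they are
  therefore arbitrary functions that agree with the edge list, from right to left those of
  \<open>weights_exist\<close>.\<close>

lemma spanner_tree_iff: "(spanner_tree h K L, K) \<in> Spanner \<longleftrightarrow>
    (\<exists>H \<subseteq> EL. card H \<le> K \<and> (\<forall>c \<in> ST. \<exists>e \<in> H. M e c))"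
proof
  assume "(spanner_tree h K L, K) \<in> Spanner"
  from this[unfolded Spanner_def mem_Collect_eq prod.case] obtain V F w l \<alpha> where
    *: "encodes_spanner_instance (spanner_tree h K L) V F w l \<alpha> \<and> spanner_instance V F w l \<alpha> \<and>
      (\<exists>S. is_spanner V F l \<alpha> S \<and> (\<Sum>e \<in> S. w e) \<le> K)" by (elim exE) (rule that)
  note enc = *[THEN conjunct1, unfolded encodes_iff]
  have eq: "\<alpha> = 3" "V = {..<N}" "F = E" and wl: "\<forall>(u, v, a, b) \<in> set es. w {u, v} = a \<and> l {u, v} = b"
    by (rule enc[THEN conjunct1] enc[THEN conjunct2, THEN conjunct1]
      enc[THEN conjunct2, THEN conjunct2, THEN conjunct1] enc[THEN conjunct2, THEN conjunct2, THEN conjunct2])+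
  interpret hitting_gadget 0 1 2 3 EL ST "\<lambda>u v. M u v" K "{..<N}" E E0 E1 E2 w l by (rule gadget[OF wl])
  show "\<exists>H \<subseteq> EL. card H \<le> K \<and> (\<forall>c \<in> ST. \<exists>e \<in> H. M e c)"
    using *[THEN conjunct2, THEN conjunct2] unfolding eq hitting_iff .
next
  assume H: "\<exists>H \<subseteq> EL. card H \<le> K \<and> (\<forall>c \<in> ST. \<exists>e \<in> H. M e c)"
  obtain w l where wl: "\<forall>(u, v, a, b) \<in> set es. w {u, v} = a \<and> l {u, v} = b" using weights_exist by blast
  interpret hitting_gadget 0 1 2 3 EL ST "\<lambda>u v. M u v" K "{..<N}" E E0 E1 E2 w l by (rule gadget[OF wl])
  have enc: "encodes_spanner_instance (spanner_tree h K L) {..<N} E w l 3" using wl by (simp only: encodes_iff)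
  have sp: "\<exists>S. is_spanner {..<N} E l 3 S \<and> (\<Sum>e \<in> S. w e) \<le> K" using H unfolding hitting_iff .
  have "\<exists>V E w l \<alpha>. encodes_spanner_instance (spanner_tree h K L) V E w l \<alpha> \<and>
    spanner_instance V E w l \<alpha> \<and> (\<exists>S. is_spanner V E l \<alpha> S \<and> (\<Sum>e \<in> S. w e) \<le> K)"
    by (rule exI, rule exI, rule exI, rule exI, rule exI, rule conjI[OF enc],
      rule conjI[OF instance_ok sp]) simp
  then show "(spanner_tree h K L, K) \<in> Spanner" unfolding Spanner_def mem_Collect_eq prod.case .
qed

lemma mem_D: "e \<in> set G \<Longrightarrow> \<exists>u \<in> EL. D ! u = Node (tag 5) e" "c \<in> set C \<Longrightarrow> \<exists>u \<in> ST. D ! u = Node (tag 6) c"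
proof -
  have D: "\<exists>u < N. D ! u = t" if "t \<in> set L" for t
    using that by (metis in_set_conv_nth length_rev set_rev)
  show "\<exists>u \<in> EL. D ! u = Node (tag 5) e" if "e \<in> set G"
    using that D[of "Node (tag 5) e"] by (force simp: labels_def EL_def)
  show "\<exists>u \<in> ST. D ! u = Node (tag 6) c" if "c \<in> set C"
    using that D[of "Node (tag 6) c"] by (force simp: labels_def ST_def)
qed

lemma D_EL: "u \<in> EL \<Longrightarrow> ttl (D ! u) \<in> set G"
  using D_rest[of u] D_tag(5)[of u] by (force simp: EL_def)

lemma D_ST: "u \<in> ST \<Longrightarrow> ttl (D ! u) \<in> set C"
  using D_rest[of u] D_tag(5)[of u] by (force simp: ST_def)

text \<open>Several vertices may carry the same label. Passing from vertices to their labels, or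
  from each label to one vertex that carries it, does not increase cardinalities and preserves which
  sets are hit.\<close>

lemma spanner_tree_hitting_iff: "(spanner_tree h K L, K) \<in> Spanner \<longleftrightarrow>
    (\<exists>H \<subseteq> set G. card H \<le> K \<and> (\<forall>c \<in> set C. \<exists>e \<in> H. h e c))"
  unfolding spanner_tree_iff
proof
  assume "\<exists>H \<subseteq> EL. card H \<le> K \<and> (\<forall>c \<in> ST. \<exists>e \<in> H. M e c)"
  then obtain H where H: "H \<subseteq> EL" "card H \<le> K" "\<And>c. c \<in> ST \<Longrightarrow> \<exists>e \<in> H. M e c" by blast
  have "finite H" using H(1) by (rule finite_subset) (simp add: EL_def)
  then have "card ((\<lambda>u. ttl (D ! u)) ` H) \<le> K" using H(2) card_image_le order_trans by blast
  moreover have "\<exists>e \<in> (\<lambda>u. ttl (D ! u)) ` H. h e c" if c: "c \<in> set C" for c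
  proof -
    obtain u where u: "u \<in> ST" "D ! u = Node (tag 6) c" using mem_D(2)[OF c] by blast
    then have "ttl (D ! u) = c" by simp
    with H(3)[OF u(1)] show ?thesis by auto
  qed
  moreover have "(\<lambda>u. ttl (D ! u)) ` H \<subseteq> set G" using H(1) D_EL by blast
  ultimately show "\<exists>H \<subseteq> set G. card H \<le> K \<and> (\<forall>c \<in> set C. \<exists>e \<in> H. h e c)" by blast
next
  assume "\<exists>H \<subseteq> set G. card H \<le> K \<and> (\<forall>c \<in> set C. \<exists>e \<in> H. h e c)"
  then obtain H where H: "H \<subseteq> set G" "card H \<le> K" "\<And>c. c \<in> set C \<Longrightarrow> \<exists>e \<in> H. h e c" by blast
  obtain f where f: "\<And>e. e \<in> set G \<Longrightarrow> f e \<in> EL \<and> D ! f e = Node (tag 5) e" using mem_D(1) by metis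
  have "finite H" using H(1) by (rule finite_subset) simp
  then have "card (f ` H) \<le> K" using H(2) card_image_le order_trans by blast
  moreover have "\<exists>u \<in> f ` H. M u c" if c: "c \<in> ST" for c
  proof -
    obtain e where "e \<in> H" "h e (ttl (D ! c))" using H(3)[OF D_ST[OF c]] by blast
    then show ?thesis using f[of e] H(1) by (intro bexI[of _ "f e"]) auto
  qed
  moreover have "f ` H \<subseteq> EL" using f H(1) by blast
  ultimately show "\<exists>H \<subseteq> EL. card H \<le> K \<and> (\<forall>c \<in> ST. \<exists>e \<in> H. M e c)" by blast
qed

end

section \<open>Composing reductions\<close>

fun exp_bound :: "exp \<Rightarrow> nat" where
  "exp_bound (Var i) = Suc i"
| "exp_bound ENil = 0"
| "exp_bound (ECons e f) = max (exp_bound e) (exp_bound f)"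
| "exp_bound (Hd e) = exp_bound e"
| "exp_bound (Tl e) = exp_bound e"

fun com_bound :: "com \<Rightarrow> nat" where
  "com_bound Skip = 0"
| "com_bound (Assign i e) = max (Suc i) (exp_bound e)"
| "com_bound (Seq c d) = max (com_bound c) (com_bound d)"
| "com_bound (Cond e c d) = max (exp_bound e) (max (com_bound c) (com_bound d))"
| "com_bound (While e c) = max (exp_bound e) (com_bound c)"

lemma eval_fun_upd: "exp_bound e \<le> v \<Longrightarrow> eval e (s(v := y)) = eval e s"
  by (induction e) auto

lemma exec_fun_upd: "exec c s t s' \<Longrightarrow> com_bound c \<le> v \<Longrightarrow> exec c (s(v := y)) t (s'(v := y))"
proof (induction rule: exec.induct)
  case (Assign i e s)
  have "exec (Assign i e) (s(v := y)) (1 + tsize (eval e (s(v := y)))) ((s(v := y))(i := eval e (s(v := y))))"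
    by (rule exec.Assign)
  moreover have "eval e (s(v := y)) = eval e s" using Assign by (simp add: eval_fun_upd)
  moreover have "(s(v := y))(i := eval e s) = (s(i := eval e s))(v := y)"
    using Assign by (intro fun_upd_twist) auto
  ultimately show ?case by (simp only:)
next
  case (Skip s)
  show ?case by (rule exec.Skip)
next
  case (Seq c s t s' d t' s'')
  show ?case by (rule exec.Seq[of _ _ _ "s'(v := y)"]) (use Seq in \<open>simp_all del: fun_upd_apply\<close>)
next
  case (IfTrue e s c t s' d)
  show ?case by (rule exec.IfTrue) (use IfTrue in \<open>simp_all add: eval_fun_upd del: fun_upd_apply\<close>)
next
  case (IfFalse e s d t s' c)
  show ?case by (rule exec.IfFalse) (use IfFalse in \<open>simp_all add: eval_fun_upd del: fun_upd_apply\<close>)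
next
  case (WhileFalse e s c)
  show ?case by (rule exec.WhileFalse) (use WhileFalse in \<open>simp_all add: eval_fun_upd del: fun_upd_apply\<close>)
next
  case (WhileTrue e s c t s' t' s'')
  show ?case by (rule exec.WhileTrue[of _ _ _ _ "s'(v := y)"]) (use WhileTrue in \<open>simp_all add: eval_fun_upd del: fun_upd_apply\<close>)
qed

text \<open>The program for \<open>F\<close> works at base 0 from any state, so whatever
  \<open>c\<close> leaves in the other variables is harmless.\<close>

lemma computes_in_ptime:
  assumes "ptime F"
  shows "\<exists>C d. \<forall>c x y t. computes_in c x y t \<longrightarrow>
    (\<exists>t' \<le> t + (tsize y + 2) ^ d. computes_in (Seq c C) x (F y) t')"
proof -
  obtain C d where C: "\<And>s. \<exists>s' t. exec C s t s' \<and> s' 0 = F (s 0) \<and> (\<forall>i < 0. s' i = s i) \<and>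
    t \<le> (tsize (s 0) + 2) ^ d" using ptimeE[OF assms, where b = 0] by blast
  have "\<exists>t' \<le> t + (tsize y + 2) ^ d. computes_in (Seq c C) x (F y) t'" if c: "computes_in c x y t" for c x y t
  proof -
    obtain s where s: "exec c ((\<lambda>_. Leaf)(0 := x)) t s" "s 0 = y" using c by (auto simp: computes_in_def)
    obtain s' t' where "exec C s t' s'" "s' 0 = F y" "t' \<le> (tsize y + 2) ^ d" using C[of s] s(2) by auto
    with s show ?thesis unfolding computes_in_def
      by (intro exI[of _ "t + t'"]) (auto intro: exec.Seq)
  qed
  then show ?thesis by blast
qed

text \<open>The time bound of the composed reduction depends on \<open>k\<close> and on
  \<open>g k\<close>, so the argument must survive an arbitrary program for
  \<open>g\<close>.\<close>

lemma computable_pair: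
  assumes "computable g"
  shows "\<exists>c. \<forall>n. \<exists>t. computes_in c (enc_unary n) (Node (enc_unary n) (enc_unary (g n))) t"
proof -
  obtain c where c: "\<And>n. \<exists>t. computes_in c (enc_unary n) (enc_unary (g n)) t"
    using assms unfolding computable_def by blast
  \<comment> \<open>This variable is not mentioned in \<open>c\<close> and, being positive, differs
    from the output variable 0.\<close>
  define v where "v = Suc (com_bound c)"
  let ?c = "Seq (Assign v (Var 0)) (Seq c (Assign 0 (ECons (Var v) (Var 0))))"
  have "\<exists>t. computes_in ?c (enc_unary n) (Node (enc_unary n) (enc_unary (g n))) t" for n
  proof -
    let ?s = "(\<lambda>_. Leaf)(0 := enc_unary n)"
    obtain t s where s: "exec c ?s t s" "s 0 = enc_unary (g n)" using c[of n] by (auto simp: computes_in_def)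
    have 1: "exec (Assign v (Var 0)) ?s (1 + tsize (eval (Var 0) ?s)) (?s(v := enc_unary n))"
      using exec.Assign[of v "Var 0" ?s] by simp
    have 2: "exec c (?s(v := enc_unary n)) t (s(v := enc_unary n))"
      by (rule exec_fun_upd[OF s(1)]) (simp add: v_def)
    let ?s2 = "s(v := enc_unary n)" and ?e = "ECons (Var v) (Var 0)"
    have "eval ?e ?s2 = Node (enc_unary n) (enc_unary (g n))" using s(2) by (simp add: v_def)
    with exec.Assign[of 0 ?e ?s2] obtain t' where
      3: "exec (Assign 0 ?e) ?s2 t' (?s2(0 := Node (enc_unary n) (enc_unary (g n))))" by metis
    show ?thesis unfolding computes_in_def using exec.Seq[OF 1 exec.Seq[OF 2 3]] by (metis fun_upd_same)
  qed
  then show ?thesis by blast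
qed

lemma computable_ptime:
  assumes "\<forall>n. \<exists>t. computes_in c (enc_unary n) (y n) t" "ptime F" "\<And>n. F (y n) = enc_unary (g n)"
  shows "computable g"
proof -
  obtain C d where C: "\<forall>c x y t. computes_in c x y t \<longrightarrow>
    (\<exists>t' \<le> t + (tsize y + 2) ^ d. computes_in (Seq c C) x (F y) t')"
    using computes_in_ptime[OF assms(2)] by (elim exE)
  have "\<exists>t. computes_in (Seq c C) (enc_unary n) (enc_unary (g n)) t" for n
  proof -
    obtain t where "computes_in c (enc_unary n) (y n) t" using assms(1) by blast
    from C[rule_format, OF this] show ?thesis unfolding assms(3) by blast
  qed
  then show ?thesis unfolding computable_def by blast
qed

text \<open>A power is computed by counting the \<open>d\<close>-tuples over a list.\<close>

lemma ptime_enc_unary_power: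
  assumes "plist f"
  shows "ptime (\<lambda>x. enc_unary (length (f x) ^ d))"
proof -
  have "ptime (\<lambda>x. enc_unary (length (map mk (List.n_lists d (f x)))))"
    by (intro ptime_enc_unary_length plist_n_lists assms)
  then show ?thesis by (simp add: length_n_lists)
qed

lemma computable_time_bound:
  assumes "computable g"
  shows "computable (\<lambda>k. (g k + 2 * k + 6) ^ d)"
proof -
  obtain c where c: "\<forall>n. \<exists>t. computes_in c (enc_unary n) (Node (enc_unary n) (enc_unary (g n))) t"
    using computable_pair[OF assms] by blast
  \<comment> \<open>On the pair of \<open>n\<close> and \<open>g n\<close> this list has
    \<open>g n + 2 * n + 6\<close> entries.\<close>
  let ?l = "\<lambda>x. ls (ttl x) @ ls (thd x) @ ls (thd x) @ [Leaf, Leaf, Leaf, Leaf, Leaf, Leaf]"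
  show ?thesis
  proof (rule computable_ptime[OF c])
    show "ptime (\<lambda>x. enc_unary (length (?l x) ^ d))"
      by (intro ptime_enc_unary_power ptime_intros)
    show "enc_unary (length (?l (Node (enc_unary n) (enc_unary (g n)))) ^ d) =
      enc_unary ((g n + 2 * n + 6) ^ d)" for n
    proof -
      have "length (?l (Node (enc_unary n) (enc_unary (g n)))) = g n + 2 * n + 6" by simp
      then show ?thesis by (simp only:)
    qed
  qed
qed

lemma computable_slots_bound:
  assumes "computable h"
  shows "computable (\<lambda>k. (h k + 2) ^ d)"
proof -
  obtain c where c: "\<forall>n. \<exists>t. computes_in c (enc_unary n) (enc_unary (h n)) t"
    using assms unfolding computable_def by blast
  show ?thesis
  proof (rule computable_ptime[OF c])
    show "ptime (\<lambda>x. enc_unary (length (Leaf # Leaf # ls x) ^ d))"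
      by (intro ptime_enc_unary_power ptime_intros)
    have "length (Leaf # Leaf # ls (enc_unary (h n))) = h n + 2" for n by simp
    then show "enc_unary (length (Leaf # Leaf # ls (enc_unary (h n))) ^ d) = enc_unary ((h n + 2) ^ d)" for n
      by (simp only:)
  qed
qed

lemma tsize_enc_unary [simp]: "tsize (enc_unary n) = 2 * n + 1"
  by (induction n) auto

text \<open>The running time of the first reduction bounds the size of its output, unless that is
  the unchanged input. So a polynomial-time continuation stays within an FPT bound. Parameters are
  encoded in unary, so \<open>k\<close> enters that bound as \<open>2 * k\<close>.\<close>

lemma fpt_reduces_into_ptime:
  assumes PQ: "fpt_reduces P Q" and F: "ptime F"
    and F_f: "\<And>x k. F (enc_param_instance (x, k)) = enc_param_instance (f (x, k))"
    and correct: "\<And>x k. (x, k) \<in> Q \<longleftrightarrow> f (x, k) \<in> R"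
    and snd: "\<And>x k. snd (f (x, k)) = (k + 2) ^ m" and C: "\<And>x k. f (x, k) \<in> C"
  shows "fpt_reduces_into C P R"
proof -
  obtain f1 c g h d where gh: "computable g" "computable h"
    and t1: "\<And>x k. \<exists>t \<le> g k * tsize x ^ d. computes_in c (enc_param_instance (x, k)) (enc_param_instance (f1 (x, k))) t"
    and f1: "\<And>x k. (x, k) \<in> P \<longleftrightarrow> f1 (x, k) \<in> Q" "\<And>x k. snd (f1 (x, k)) \<le> h k"
    using PQ unfolding fpt_reduces_def fpt_reduces_into_def by blast
  obtain c2 D where c2: "\<forall>c x y t. computes_in c x y t \<longrightarrow>
    (\<exists>t' \<le> t + (tsize y + 2) ^ D. computes_in (Seq c c2) x (F y) t')"
    using computes_in_ptime[OF F] by (elim exE)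
  let ?g = "\<lambda>k. (g k + 2 * k + 6) ^ (D + 1)" and ?h = "\<lambda>k. (h k + 2) ^ m"
    and ?d = "(d + 1) * (D + 1)"
  show ?thesis unfolding fpt_reduces_into_def
  proof (rule exI[of _ "f \<circ> f1"], rule exI[of _ "Seq c c2"], rule exI[of _ ?g],
      rule exI[of _ ?h], rule exI[of _ ?d], intro conjI allI)
    show "computable ?g" by (rule computable_time_bound[OF gh(1)])
    show "computable ?h" by (rule computable_slots_bound[OF gh(2)])
    fix x k
    let ?y = "enc_param_instance (f1 (x, k))"
    show "(x, k) \<in> P \<longleftrightarrow> (f \<circ> f1) (x, k) \<in> R"
      using f1(1)[of x k] correct[of "fst (f1 (x, k))" "snd (f1 (x, k))"] by simp
    show "snd ((f \<circ> f1) (x, k)) \<le> ?h k"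
      using snd[of "fst (f1 (x, k))" "snd (f1 (x, k))"] f1(2)[of x k] by (simp add: power_mono)
    show "(f \<circ> f1) (x, k) \<in> C" using C[of "fst (f1 (x, k))" "snd (f1 (x, k))"] by simp
    obtain t where t: "t \<le> g k * tsize x ^ d" "computes_in c (enc_param_instance (x, k)) ?y t"
      using t1 by blast
    obtain t' where t': "t' \<le> t + (tsize ?y + 2) ^ D" "computes_in (Seq c c2) (enc_param_instance (x, k)) (F ?y) t'"
      using c2[rule_format, OF t(2)] by blast
    have Fy: "F ?y = enc_param_instance ((f \<circ> f1) (x, k))"
      using F_f[of "fst (f1 (x, k))" "snd (f1 (x, k))"] by simp
    \<comment> \<open>An output larger than the running time can only be the unchanged input.\<close>
    have "?y = enc_param_instance (x, k) \<or> tsize ?y \<le> t"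
      using t(2) unfolding computes_in_def by (auto dest: exec_size[where i = 0])
    then have y: "tsize ?y \<le> t + tsize x + 2 * k + 2" by (auto simp: enc_param_instance_def)
    \<comment> \<open>This exceeds \<open>t + tsize x + 2 * k + 4\<close> by one, so that below
      \<open>(?B - 1) * ?B ^ D + ?B ^ D\<close> collapses to a single power.\<close>
    let ?B = "t + tsize x + 2 * k + 5"
    note t'(1)
    also have "t + (tsize ?y + 2) ^ D \<le> (t + tsize x + 2 * k + 4) * 1 + ?B ^ D"
      by (rule add_mono, simp, rule power_mono) (use y in simp_all)
    also have "\<dots> \<le> (t + tsize x + 2 * k + 4) * ?B ^ D + ?B ^ D"
      by (intro add_mono mult_le_mono) simp_all
    also have "\<dots> = ?B ^ (D + 1)" by (simp add: algebra_simps)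
    \<comment> \<open>As \<open>tsize x \<ge> 1\<close>, every summand of \<open>?B\<close> is at
      most its coefficient times \<open>tsize x ^ (d + 1)\<close>; the coefficients
      \<open>g k\<close>, \<open>1\<close> and \<open>2 * k + 5\<close> add up to
      \<open>g k + 2 * k + 6\<close>.\<close>
    also have "\<dots> \<le> ((g k + 2 * k + 6) * tsize x ^ (d + 1)) ^ (D + 1)"
    proof (rule power_mono)
      have X: "tsize x \<ge> 1" by (rule tsize_pos)
      have "tsize x ^ d \<le> tsize x ^ (d + 1)" by (rule power_increasing) (use X in auto)
      then have "t \<le> g k * tsize x ^ (d + 1)" using t(1) by (meson mult_le_mono2 order_trans)
      moreover have "tsize x \<le> tsize x ^ (d + 1)" using X by (simp add: self_le_power)
      moreover have "2 * k + 5 \<le> (2 * k + 5) * tsize x ^ (d + 1)" using X by simp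
      ultimately have "?B \<le> g k * tsize x ^ (d + 1) + tsize x ^ (d + 1) + (2 * k + 5) * tsize x ^ (d + 1)"
        by linarith
      then show "?B \<le> (g k + 2 * k + 6) * tsize x ^ (d + 1)" by (simp add: algebra_simps)
    qed simp
    also have "\<dots> = ?g k * tsize x ^ ?d" by (simp only: power_mult_distrib power_mult)
    finally show "\<exists>t \<le> ?g k * tsize x ^ ?d.
      computes_in (Seq c c2) (enc_param_instance (x, k)) (enc_param_instance ((f \<circ> f1) (x, k))) t"
      using t'(2) unfolding Fy by blast
  qed
qed

section \<open>The complete reduction to spanners\<close>

lemma ptime_spanner_tree:
  assumes h: "\<And>A B Z. ptime Z \<Longrightarrow> ptime A \<Longrightarrow> ptime B \<Longrightarrow> pdec (\<lambda>x. h (Z x) (A x) (B x))"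
    and f: "plist f" and l: "plist l"
  shows "ptime (\<lambda>x. spanner_tree (h x) (length (f x)) (l x))"
proof -
  have enc: "enc_edge (u, v, a, b) = Node (enc_nat u) (Node (enc_nat v) (Node (enc_nat a) (Node (enc_nat b) Leaf)))"
    for u v a b by (simp add: enc_edge_def)
  \<comment> \<open>Numbers are computed by counting lists; the heavy weight is the length of a list
    that is longer by one than the budget.\<close>
  have len: "length (f x) + 1 = length (Leaf # f x)" for x by simp
  have l': "plist (\<lambda>x. l (H x))" if "ptime H" for H
    using ptime_comp[OF l[unfolded plist_def] that] by (simp add: plist_def)
  have f': "plist (\<lambda>x. f (H x))" if "ptime H" for H
    using ptime_comp[OF f[unfolded plist_def] that] by (simp add: plist_def)
  show ?thesis
    unfolding spanner_tree_def enc_list_conv_mk graph_edges_def map_concat map_map comp_def map_append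
      if_distrib[of "map enc_edge"] list.map enc len free_edge_def unit_edge_def heavy_edge_def
    by (intro ptime_intros h l' f')
qed

text \<open>The class \<open>C\<close> is left open, so that one reduction serves the unrestricted
  problem as well as the restricted instances of stretch 3.\<close>

lemma W_hard_on_Spanner:
  assumes C: "bipartite_unit_length_three_weights 3 \<subseteq> C"
  shows "W_hard_on 2 Spanner C"
  unfolding W_hard_on_def
proof
  fix P assume "P \<in> W_class 2"
  then obtain \<tau> s \<phi> where s: "s \<ge> 1" and \<phi>: "wf_fm \<tau> s \<phi>" "free_vars \<phi> = {}" "Pi_fm 2 \<phi>"
    and P: "fpt_reduces P (p_WD \<tau> s \<phi>)" unfolding W_class_def by blast
  obtain M where M: "all_vars \<phi> \<subseteq> {..<M}"
    using finite_all_vars[of \<phi>] finite_nat_iff_bounded by blast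
  define m where "m = 2 * xcount \<phi> + 1"
  define sp where "sp z = spanner_tree (hits \<tau> (strip_all \<phi>) z) (length (slots m z))
    (labels (guesses s m z) (clauses s m M z))" for z
  define F where "F z = Node (sp z) (enc_unary (length (slots m z)))" for z
  \<comment> \<open>The new parameter is the number of slots, a function of \<open>k\<close> and the
    fixed formula alone.\<close>
  define f where "f = (\<lambda>(x, k). (sp (Node x (enc_unary k)), (k + 2) ^ m))"
  show "fpt_reduces_into C P Spanner"
  proof (rule fpt_reduces_into_ptime[OF P, where F = F and f = f and m = m])
    show "ptime F" unfolding F_def sp_def labels_def
      by (intro ptime_Node ptime_spanner_tree ptime_intros)
    fix x k
    show "F (enc_param_instance (x, k)) = enc_param_instance (f (x, k))"
      by (simp add: F_def f_def enc_param_instance_def length_slots)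
    show "snd (f (x, k)) = (k + 2) ^ m" by (simp add: f_def)
    define z where "z = Node x (enc_unary k)"
    have fx: "f (x, k) = (sp z, length (slots m z))" by (simp add: f_def z_def length_slots)
    show "f (x, k) \<in> C"
      unfolding fx sp_def by (rule subsetD[OF C labelled_gadget.spanner_tree_in_class])
    show "(x, k) \<in> p_WD \<tau> s \<phi> \<longleftrightarrow> f (x, k) \<in> Spanner"
      unfolding fx sp_def labelled_gadget.spanner_tree_hitting_iff
        hits_iff_p_WD[OF s \<phi> M m_def z_def] ..
  qed
qed

theorem theorem9:
  "W_hard 2 Spanner \<and>
   (\<exists>\<alpha>. \<alpha> \<ge> 1 \<and> W_hard_on 2 Spanner (bipartite_unit_length_three_weights \<alpha>))"
proof
  show "W_hard 2 Spanner" by (rule W_hard_on_Spanner) simp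
  show "\<exists>\<alpha>. \<alpha> \<ge> 1 \<and> W_hard_on 2 Spanner (bipartite_unit_length_three_weights \<alpha>)"
    by (intro exI[of _ 3] conjI W_hard_on_Spanner) simp_all
qed

end
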